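(* Let $\lambda\in\mathbb{R}\setminus\{0\}$, $L>0$, $R>0$, and let $\Gamma_0:[0,L]\to\mathbb{R}^2$ be a smooth planar curve, with curvature $k_0$, satisfying $|\Gamma_0'(x)|\equiv1$, $\Gamma_0(0)=(0,0)$, $\Gamma_0(L)=(R,0)$, $k_0(0)=k_0(L)=0$. Let $\gamma:[0,L]\times[0,\infty)\to\mathbb{R}^2$ be the solution of $$\begin{cases}\partial_t\gamma=(-2\partial_s^2\kappa-\kappa^3+\lambda^2\kappa)\,\boldsymbol{\nu},\\ \gamma(0,t)=(0,0),\quad\gamma(L,t)=(R,0),\quad\kappa(0,t)=\kappa(L,t)=0,\\ \gamma(x,0)=\Gamma_0(x).\end{cases}$$ Then there exist a sequence $\{t_i\}_{i=0}^\infty$ with $t_i\to\infty$ and a planar curve $\hat\gamma$ such that $\gamma(\cdot,t_i)$ converges to $\hat\gamma(\cdot)$, up to a reparametrization, in the $C^\infty$ topology as $t_i\to\infty$. Moreover $\hat\gamma$ is a stationary solution of the equation $\partial_t\gamma=(-2\partial_s^2\kappa-\kappa^3+\lambda^2\kappa)\,\boldsymbol{\nu}$ with the boundary conditions $\gamma(0,t)=(0,0)$, $\gamma(L,t)=(R,0)$, $\kappa(0,t)=\kappa(L,t)=0$, i.e. its curvature $\hat\kappa$ satisfies $2\partial_s^2\hat\kappa+\hat\kappa^3-\lambda^2\hat\kappa=0$, its endpoints are $(0,0)$ and $(R,0)$, and $\hat\kappa$ vanishes at both endpoints.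
   Context: For a smooth regular planar curve $\gamma$, $s$ denotes arc length, $\partial_s=|\partial_x\gamma|^{-1}\partial_x$, $\boldsymbol{\nu}=\mathfrak{R}\,\partial_s\gamma$ is the unit normal ($\mathfrak{R}$ the counterclockwise rotation by $\pi/2$), and $\kappa$ is the signed curvature, $\partial_s^2\gamma=\kappa\boldsymbol{\nu}$. For time-dependent curves these are the quantities of $\gamma(\cdot,t)$. The initial-boundary value problem $\partial_t\gamma=(-2\partial_s^2\kappa-\kappa^3+\lambda^2\kappa)\,\boldsymbol{\nu}$, $\gamma(0,t)=(0,0)$, $\gamma(L,t)=(R,0)$, $\kappa(0,t)=\kappa(L,t)=0$, $\gamma(x,0)=\Gamma_0(x)$ has a unique classical solution for all time, smooth for $t>0$. *)

theory Defs
  imports "HOL-Analysis.Analysis"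
begin

text \<open>
  Derivatives are taken within the domain \<open>S\<close>, hence one-sided at boundary points.
  The predicates are meant for convex sets with nonempty interior, where the derivative
  within \<open>S\<close> is unique; on such sets they express continuous differentiability up to
  the part of the boundary contained in \<open>S\<close>.
\<close>

primrec Ck_on :: "nat \<Rightarrow> 'a::real_normed_vector set \<Rightarrow> ('a \<Rightarrow> 'b::real_normed_vector) \<Rightarrow> bool" where
  "Ck_on 0 S f \<longleftrightarrow> continuous_on S f"
| "Ck_on (Suc k) S f \<longleftrightarrow>
     (\<exists>f'. (\<forall>p\<in>S. (f has_derivative f' p) (at p within S)) \<and> (\<forall>v. Ck_on k S (\<lambda>p. f' p v)))"

definition smooth_on :: "'a::real_normed_vector set \<Rightarrow> ('a \<Rightarrow> 'b::real_normed_vector) \<Rightarrow> bool" where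
  "smooth_on S f \<longleftrightarrow> (\<forall>k. Ck_on k S f)"

definition dx :: "real \<Rightarrow> (real \<Rightarrow> 'a::real_normed_vector) \<Rightarrow> real \<Rightarrow> 'a" where
  "dx L f x = vector_derivative f (at x within {0..L})"

definition regular_curve :: "real \<Rightarrow> (real \<Rightarrow> real^2) \<Rightarrow> bool" where
  "regular_curve L c \<longleftrightarrow> (\<forall>x\<in>{0..L}. dx L c x \<noteq> 0)"

text \<open>The arc length derivative of \<open>f\<close> along the curve \<open>c\<close>.\<close>

definition ds :: "real \<Rightarrow> (real \<Rightarrow> real^2) \<Rightarrow> (real \<Rightarrow> 'a::real_normed_vector) \<Rightarrow> real \<Rightarrow> 'a" where
  "ds L c f x = dx L f x /\<^sub>R norm (dx L c x)"

definition rot :: "real^2 \<Rightarrow> real^2" where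
  "rot v = vector [- (v $ 2), v $ 1]"

definition unit_normal :: "real \<Rightarrow> (real \<Rightarrow> real^2) \<Rightarrow> real \<Rightarrow> real^2" where
  "unit_normal L c x = rot (ds L c c x)"

text \<open>
  The coefficient of the second arc length derivative with respect to the unit normal;
  see \<open>curvature_equation\<close> below.
\<close>

definition curvature :: "real \<Rightarrow> (real \<Rightarrow> real^2) \<Rightarrow> real \<Rightarrow> real" where
  "curvature L c x = ds L c (ds L c c) x \<bullet> unit_normal L c x"

lemma curvature_equation:
  assumes "L > 0" "Ck_on 2 {0..L} c" "regular_curve L c" "x \<in> {0..L}"
  shows "ds L c (ds L c c) x = curvature L c x *\<^sub>R unit_normal L c x"
proof -
  let ?S = "{0..L}"
  let ?T = "ds L c c"
  obtain c' where c': "\<And>p. p \<in> ?S \<Longrightarrow> (c has_derivative c' p) (at p within ?S)"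
    and c'1: "\<And>v. Ck_on 1 ?S (\<lambda>p. c' p v)"
    using assms(2) unfolding numeral_2_eq_2 One_nat_def Ck_on.simps(2)[of "Suc 0"] by blast
  have ne: "at p within ?S \<noteq> bot" if "p \<in> ?S" for p
    using that assms(1) by (simp add: trivial_limit_within islimpt_Icc)
  have dxc: "dx L c p = c' p 1" if "p \<in> ?S" for p
  proof -
    have "(c has_vector_derivative c' p 1) (at p within ?S)"
    proof -
      have lin: "linear (c' p)"
        by (rule has_derivative_linear[OF c'[OF that]])
      have "c' p h = h *\<^sub>R c' p 1" for h
        using linear_scale[OF lin, of h 1] unfolding real_scaleR_def mult_1_right .
      then have "c' p = (\<lambda>h. h *\<^sub>R c' p 1)"
        by (rule ext)
      then show ?thesis
        unfolding has_vector_derivative_def by (rule has_derivative_eq_rhs[OF c'[OF that]])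
    qed
    then show ?thesis
      unfolding dx_def using vector_derivative_within[OF ne[OF that]] by blast
  qed
  obtain d where d: "\<And>p. p \<in> ?S \<Longrightarrow> ((\<lambda>p. c' p 1) has_derivative d p) (at p within ?S)"
    using c'1[of 1] unfolding One_nat_def Ck_on.simps by blast
  have nz: "c' p 1 \<noteq> 0" if "p \<in> ?S" for p
    using assms(3) dxc[OF that] that unfolding regular_curve_def by metis
  have T_eq: "?T p = c' p 1 /\<^sub>R norm (c' p 1)" if "p \<in> ?S" for p
    using dxc[OF that] by (simp add: ds_def)
  have unit: "?T p \<bullet> ?T p = 1" if "p \<in> ?S" for p
    using nz[OF that] unfolding T_eq[OF that] dot_square_norm by simp
  have c'd: "(\<lambda>p. c' p 1) differentiable (at x within ?S)"
    using d[OF assms(4)] by (auto simp: differentiable_def)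
  have "(norm \<circ> (\<lambda>p. c' p 1)) differentiable (at x within ?S)"
    by (rule differentiable_chain_within[OF c'd])
      (simp add: differentiable_at_withinI differentiable_norm_at nz[OF assms(4)])
  then have "(\<lambda>p. inverse (norm (c' p 1))) differentiable (at x within ?S)"
    by (intro differentiable_inverse) (auto simp: o_def nz[OF assms(4)])
  then have "(\<lambda>p. c' p 1 /\<^sub>R norm (c' p 1)) differentiable (at x within ?S)"
    by (intro differentiable_scaleR c'd)
  then have "?T differentiable (at x within ?S)"
    by (rule differentiable_transform_within[OF _ zero_less_one assms(4)]) (simp add: T_eq)
  then have T': "(?T has_vector_derivative dx L ?T x) (at x within ?S)"
    by (simp add: dx_def vector_derivative_works)
  have "((\<lambda>p. ?T p \<bullet> ?T p) has_vector_derivative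
          ?T x \<bullet> dx L ?T x + dx L ?T x \<bullet> ?T x) (at x within ?S)"
    by (rule bounded_bilinear.has_vector_derivative[OF bounded_bilinear_inner T' T'])
  moreover have "((\<lambda>p. ?T p \<bullet> ?T p) has_vector_derivative 0) (at x within ?S)"
    by (rule has_vector_derivative_transform[OF assms(4) _ has_vector_derivative_const[of 1]])
      (simp add: unit)
  ultimately have "?T x \<bullet> dx L ?T x + dx L ?T x \<bullet> ?T x = 0"
    by (rule vector_derivative_unique_within[OF ne[OF assms(4)]])
  then have orth: "?T x \<bullet> dx L ?T x = 0"
    using inner_commute[of "dx L ?T x" "?T x"] by linarith
  have plane: "w = (w \<bullet> rot u) *\<^sub>R rot u" if "u \<bullet> u = 1" "u \<bullet> w = 0" for u w :: "real^2"
  proof -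
    have u: "u$1 * u$1 + u$2 * u$2 = 1" and uw: "u$1 * w$1 + u$2 * w$2 = 0"
      using that by (simp_all add: inner_vec_def sum_2)
    have ip: "w \<bullet> rot u = w$2 * u$1 - w$1 * u$2"
      by (simp add: rot_def inner_vec_def sum_2)
    have "w$1 = (w$2 * u$1 - w$1 * u$2) * - u$2" "w$2 = (w$2 * u$1 - w$1 * u$2) * u$1"
      using u uw by algebra+
    then show ?thesis
      unfolding vec_eq_iff forall_2 ip by (simp only: vector_scaleR_component rot_def vector_2 real_scaleR_def)
  qed
  have "?T x \<bullet> ds L c ?T x = 0"
    using orth by (simp add: ds_def[of L c ?T])
  from plane[OF unit[OF assms(4)] this] show ?thesis
    by (simp add: curvature_def unit_normal_def)
qed

definition elastic_speed :: "real \<Rightarrow> real \<Rightarrow> (real \<Rightarrow> real^2) \<Rightarrow> real \<Rightarrow> real" where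
  "elastic_speed lam L c x =
     - 2 * ds L c (ds L c (curvature L c)) x - (curvature L c x)^3 + lam\<^sup>2 * curvature L c x"

definition boundary_conditions :: "real \<Rightarrow> real \<Rightarrow> (real \<Rightarrow> real^2) \<Rightarrow> bool" where
  "boundary_conditions L R c \<longleftrightarrow>
     c 0 = vector [0, 0] \<and> c L = vector [R, 0] \<and> curvature L c 0 = 0 \<and> curvature L c L = 0"

text \<open>
  Classical solutions: immersed, smooth up to the spatial boundary for positive times, and
  continuous down to the initial time.  No derivative is required to be continuous at
  \<open>t = 0\<close>: the initial curve is only assumed to satisfy the boundary conditions, not the
  higher compatibility conditions that differentiability at the corners would need.
\<close>

definition elastic_flow_solution ::
  "real \<Rightarrow> real \<Rightarrow> real \<Rightarrow> (real \<Rightarrow> real^2) \<Rightarrow> (real \<Rightarrow> real \<Rightarrow> real^2) \<Rightarrow> bool" where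
  "elastic_flow_solution lam L R \<Gamma>0 \<gamma> \<longleftrightarrow>
     continuous_on ({0..L} \<times> {0..}) (\<lambda>(x, t). \<gamma> x t) \<and>
     smooth_on ({0..L} \<times> {0<..}) (\<lambda>(x, t). \<gamma> x t) \<and>
     (\<forall>t\<ge>0. regular_curve L (\<lambda>x. \<gamma> x t)) \<and>
     (\<forall>t>0. \<forall>x\<in>{0..L}.
        (\<gamma> x has_vector_derivative
           elastic_speed lam L (\<lambda>y. \<gamma> y t) x *\<^sub>R unit_normal L (\<lambda>y. \<gamma> y t) x) (at t)) \<and>
     (\<forall>t\<ge>0. boundary_conditions L R (\<lambda>x. \<gamma> x t)) \<and>
     (\<forall>x\<in>{0..L}. \<gamma> x 0 = \<Gamma>0 x)"

definition stationary_solution :: "real \<Rightarrow> real \<Rightarrow> real \<Rightarrow> (real \<Rightarrow> real^2) \<Rightarrow> bool" where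
  "stationary_solution lam L R c \<longleftrightarrow>
     smooth_on {0..L} c \<and> regular_curve L c \<and>
     (\<forall>x\<in>{0..L}. 2 * ds L c (ds L c (curvature L c)) x + (curvature L c x)^3
                   - lam\<^sup>2 * curvature L c x = 0) \<and>
     boundary_conditions L R c"

text \<open>Orientation-preserving diffeomorphisms of \<open>[0, L]\<close>.\<close>

definition reparametrization :: "real \<Rightarrow> (real \<Rightarrow> real) \<Rightarrow> bool" where
  "reparametrization L \<phi> \<longleftrightarrow>
     bij_betw \<phi> {0..L} {0..L} \<and> smooth_on {0..L} \<phi> \<and> (\<forall>x\<in>{0..L}. dx L \<phi> x > 0)"

definition smoothly_converges ::
  "real \<Rightarrow> (nat \<Rightarrow> real \<Rightarrow> real^2) \<Rightarrow> (real \<Rightarrow> real^2) \<Rightarrow> bool" where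
  "smoothly_converges L c c_lim \<longleftrightarrow>
     (\<forall>n. uniform_limit {0..L} (\<lambda>i. (dx L ^^ n) (c i)) ((dx L ^^ n) c_lim) sequentially)"

end

(*
  The energy, the integral of \<kappa>^2 + lam^2 with respect to arc length, decreases along the flow
  at the rate of the squared L^2 norm of the normal speed V, so V tends to 0 in L^2 along a sequence
  of times; the length stays between R and a multiple of the energy.

  For smooth convergence all arc length derivatives of \<kappa> are bounded uniformly for t >= 1
  (nothing is differentiable up to t = 0).  The
  time derivative of the n-th one is -2 times the (n+4)-th plus a differential polynomial of lower
  scaling order, and the boundary conditions force all even derivatives to vanish at the end points.
  Hence boundary terms disappear, the L^2 norms of the derivatives are log-convex in n, and log-convexity
  absorbs the lower order terms into the square of the L^2 norm of the (n+2)-th derivative.  The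
  resulting inequality y' <= K - c y bounds y, the square of the L^2 norm of the n-th derivative.

  After reparametrization by constant speed all derivatives of the curves are bounded, so a
  diagonal Arzela-Ascoli argument gives a smooth limit, and V vanishes in the limit.
*)

theory Submission
  imports Defs "HOL-Complex_Analysis.Great_Picard" "HOL-Library.Diagonal_Subsequence"
begin

section \<open>Calculus of smooth functions\<close>

text \<open>The proof turns on a count of exponents. If the L^2 norm of order j is at most A r^(2j),
  then a factor \<open>\<kappa> i\<close> counts r^(2i+1) uniformly and r^(2i) in L^2. The error
  terms in the evolution of the n-th norm then grow at most like r^(4n+6), whereas the good term is
  comparable to r^(4n+8); this gap permits the absorption whatever the constants are. The obstacle
  is a lone factor \<open>\<kappa> (n + 3)\<close>: the count admits it, although its order lies
  outside the interpolation range from 0 to n + 2. Parity excludes it, because the evolution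
  respects the parity of the scaling weight. The same parity makes the even derivatives vanish at
  the ends. The energy inequality is run for even n, and odd orders are interpolated between even
  ones. The interpolation constants do not involve the length of the curve: every derivative has a
  zero on it, so two consecutive L^2 norms alone bound the supremum.\<close>

lemma has_vector_derivative_continuous_on:
  "(\<And>x. x \<in> S \<Longrightarrow> (f has_vector_derivative f' x) (at x within S)) \<Longrightarrow> continuous_on S f"
  unfolding has_vector_derivative_def by (rule has_derivative_continuous_on)

lemma Ck_on_cong:
  assumes "Ck_on k S f" "\<And>p. p \<in> S \<Longrightarrow> g p = f p"
  shows "Ck_on k S g"
proof (cases k)
  case 0
  then show ?thesis using assms continuous_on_cong[of S S g f] by simp
next
  case (Suc m)
  then obtain f' where f': "\<And>p. p \<in> S \<Longrightarrow> (f has_derivative f' p) (at p within S)"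
    "\<And>v. Ck_on m S (\<lambda>p. f' p v)" using assms(1) by auto
  have "(g has_derivative f' p) (at p within S)" if "p \<in> S" for p
    using has_derivative_transform[OF that assms(2) f'(1)[OF that]] by blast
  then show ?thesis using f'(2) Suc by auto
qed

lemma Ck_on_SucD: "Ck_on (Suc k) S f \<Longrightarrow> Ck_on k S f"
proof (induction k arbitrary: f)
  case 0
  then show ?case using has_derivative_continuous_on by auto
next
  case (Suc k)
  then obtain f' where f': "\<forall>p\<in>S. (f has_derivative f' p) (at p within S)"
    "\<And>v. Ck_on (Suc k) S (\<lambda>p. f' p v)" by (subst (asm) Ck_on.simps(2)) blast
  have "\<And>v. Ck_on k S (\<lambda>p. f' p v)" using Suc.IH f'(2) by blast
  then show ?case using f'(1) by auto
qed

lemma Ck_on_const: "Ck_on k S (\<lambda>p. c)"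
  by (induction k arbitrary: c) (auto intro!: exI[where x="\<lambda>p v. 0"])

lemma Ck_on_add: "Ck_on k S f \<Longrightarrow> Ck_on k S g \<Longrightarrow> Ck_on k S (\<lambda>p. f p + g p)"
proof (induction k arbitrary: f g)
  case 0
  then show ?case by (auto intro: continuous_on_add)
next
  case (Suc k)
  then obtain f' g' where *:
    "\<forall>p\<in>S. (f has_derivative f' p) (at p within S)" "\<And>v. Ck_on k S (\<lambda>p. f' p v)"
    "\<forall>p\<in>S. (g has_derivative g' p) (at p within S)" "\<And>v. Ck_on k S (\<lambda>p. g' p v)" by auto
  show ?case unfolding Ck_on.simps
    by (rule exI[where x="\<lambda>p v. f' p v + g' p v"]) (use * in \<open>auto intro!: has_derivative_add Suc.IH\<close>)
qed

lemma Ck_on_bilinear: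
  assumes "bounded_bilinear b"
  shows "Ck_on k S f \<Longrightarrow> Ck_on k S g \<Longrightarrow> Ck_on k S (\<lambda>p. b (f p) (g p))"
proof (induction k arbitrary: f g)
  case 0
  then show ?case using bounded_bilinear.continuous_on[OF assms] by auto
next
  case (Suc k)
  then obtain f' g' where *:
    "\<forall>p\<in>S. (f has_derivative f' p) (at p within S)" "\<And>v. Ck_on k S (\<lambda>p. f' p v)"
    "\<forall>p\<in>S. (g has_derivative g' p) (at p within S)" "\<And>v. Ck_on k S (\<lambda>p. g' p v)" by auto
  show ?case unfolding Ck_on.simps
    by (rule exI[where x="\<lambda>p v. b (f p) (g' p v) + b (f' p v) (g p)"])
      (use * Suc.prems[THEN Ck_on_SucD] in
        \<open>auto intro!: bounded_bilinear.FDERIV[OF assms] Ck_on_add Suc.IH\<close>)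
qed

lemmas Ck_on_mult = Ck_on_bilinear[OF bounded_bilinear_mult]
lemmas Ck_on_scaleR = Ck_on_bilinear[OF bounded_bilinear_scaleR]
lemmas Ck_on_inner = Ck_on_bilinear[OF bounded_bilinear_inner]

lemma Ck_on_linear:
  assumes "bounded_linear h"
  shows "Ck_on k S f \<Longrightarrow> Ck_on k S (\<lambda>p. h (f p))"
proof (induction k arbitrary: f)
  case 0
  then show ?case using bounded_linear.continuous_on[OF assms] by auto
next
  case (Suc k)
  then obtain f' where *:
    "\<forall>p\<in>S. (f has_derivative f' p) (at p within S)" "\<And>v. Ck_on k S (\<lambda>p. f' p v)" by auto
  show ?case unfolding Ck_on.simps
    by (rule exI[where x="\<lambda>p v. h (f' p v)"])
      (use * in \<open>auto intro!: bounded_linear.has_derivative[OF assms] Suc.IH\<close>)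
qed

text \<open>The derivative of 1/f is built from 1/f itself and f', so the induction hypothesis for
  1/f closes the step. \<open>Ck_on_sqrt\<close> is bootstrapped in the same way.\<close>

lemma Ck_on_inverse:
  fixes f :: "_ \<Rightarrow> real"
  assumes "\<And>p. p \<in> S \<Longrightarrow> f p \<noteq> 0"
  shows "Ck_on k S f \<Longrightarrow> Ck_on k S (\<lambda>p. inverse (f p))"
proof (induction k)
  case 0
  then show ?case using assms by (auto intro!: continuous_on_inverse)
next
  case (Suc k)
  then obtain f' where *:
    "\<forall>p\<in>S. (f has_derivative f' p) (at p within S)" "\<And>v. Ck_on k S (\<lambda>p. f' p v)" by auto
  have i: "Ck_on k S (\<lambda>p. inverse (f p))" using Suc Ck_on_SucD by blast
  have m: "Ck_on k S (\<lambda>p. - (inverse (f p) * f' p v * inverse (f p)))" for v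
    by (rule Ck_on_linear[where h="\<lambda>x. - x"]) (intro bounded_linear_minus bounded_linear_ident Ck_on_mult i *(2))+
  show ?case unfolding Ck_on.simps
    by (rule exI[where x="\<lambda>p v. - (inverse (f p) * f' p v * inverse (f p))"])
      (use * assms m in \<open>auto intro!: has_derivative_inverse\<close>)
qed

lemma Ck_on_sqrt:
  fixes f :: "_ \<Rightarrow> real"
  assumes "\<And>p. p \<in> S \<Longrightarrow> f p > 0"
  shows "Ck_on k S f \<Longrightarrow> Ck_on k S (\<lambda>p. sqrt (f p))"
proof (induction k)
  case 0
  then show ?case by (auto intro!: continuous_on_real_sqrt)
next
  case (Suc k)
  then obtain f' where *:
    "\<forall>p\<in>S. (f has_derivative f' p) (at p within S)" "\<And>v. Ck_on k S (\<lambda>p. f' p v)" by auto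
  have i: "Ck_on k S (\<lambda>p. sqrt (f p))" using Suc Ck_on_SucD by blast
  have m: "Ck_on k S (\<lambda>p. f' p v * (inverse (sqrt (f p)) * (1/2)))" for v
    using assms by (intro Ck_on_mult *(2) Ck_on_inverse i Ck_on_const) (metis less_irrefl real_sqrt_eq_zero_cancel_iff)
  have d: "((\<lambda>p. sqrt (f p)) has_derivative (\<lambda>v. f' p v * (inverse (sqrt (f p)) * (1/2)))) (at p within S)"
    if "p \<in> S" for p
    by (rule has_derivative_eq_rhs[OF has_derivative_real_sqrt]) (use assms that * in \<open>auto simp: field_simps\<close>)
  show ?case unfolding Ck_on.simps
    by (rule exI[where x="\<lambda>p v. f' p v * (inverse (sqrt (f p)) * (1/2))"]) (use d m in auto)
qed

text \<open>The outer function comes as a tower \<open>G\<close> of successive derivatives, because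
  the chain rule passes from \<open>G n\<close> to \<open>G (Suc n)\<close> and the induction has to
  cover all n at once.\<close>

lemma Ck_on_compose_real:
  fixes f :: "_ \<Rightarrow> real"
  assumes "\<And>p. p \<in> S \<Longrightarrow> f p \<in> T"
    and G: "\<And>n y. y \<in> T \<Longrightarrow> (G n has_vector_derivative G (Suc n) y) (at y within T)"
  shows "Ck_on k S f \<Longrightarrow> Ck_on k S (\<lambda>p. G n (f p))"
proof (induction k arbitrary: n)
  case 0
  have "continuous_on T (G n)" using G has_vector_derivative_continuous_on by blast
  then show ?case using 0 assms by (auto intro!: continuous_on_compose2[of T "G n"])
next
  case (Suc k)
  then obtain f' where *:
    "\<forall>p\<in>S. (f has_derivative f' p) (at p within S)" "\<And>v. Ck_on k S (\<lambda>p. f' p v)" by auto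
  have "((\<lambda>p. G n (f p)) has_derivative (\<lambda>v. f' p v *\<^sub>R G (Suc n) (f p))) (at p within S)" if "p \<in> S" for p
  proof (rule has_derivative_in_compose2[where t=T and s=S and g="G n" and g'="\<lambda>y h. h *\<^sub>R G (Suc n) y"])
    show "\<And>x. x \<in> T \<Longrightarrow> (G n has_derivative (\<lambda>h. h *\<^sub>R G (Suc n) x)) (at x within T)"
      using G by (simp add: has_vector_derivative_def)
  qed (use assms that * in auto)
  moreover have "Ck_on k S (\<lambda>p. f' p v *\<^sub>R G (Suc n) (f p))" for v
    by (intro Ck_on_scaleR *(2) Suc.IH Ck_on_SucD[OF Suc.prems])
  ultimately show ?case unfolding Ck_on.simps
    by (intro exI[where x="\<lambda>p v. f' p v *\<^sub>R G (Suc n) (f p)"]) auto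
qed

lemma smooth_on_add: "smooth_on S f \<Longrightarrow> smooth_on S g \<Longrightarrow> smooth_on S (\<lambda>p. f p + g p)"
  by (simp add: smooth_on_def Ck_on_add)

lemma smooth_on_const: "smooth_on S (\<lambda>p. c)"
  by (simp add: smooth_on_def Ck_on_const)

lemma smooth_on_bilinear:
  "bounded_bilinear b \<Longrightarrow> smooth_on S f \<Longrightarrow> smooth_on S g \<Longrightarrow> smooth_on S (\<lambda>p. b (f p) (g p))"
  by (simp add: smooth_on_def Ck_on_bilinear)

lemma smooth_on_linear:
  "bounded_linear h \<Longrightarrow> smooth_on S f \<Longrightarrow> smooth_on S (\<lambda>p. h (f p))"
  by (simp add: smooth_on_def Ck_on_linear)

lemma smooth_on_inverse:
  fixes f :: "_ \<Rightarrow> real"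
  shows "smooth_on S f \<Longrightarrow> (\<And>p. p \<in> S \<Longrightarrow> f p \<noteq> 0) \<Longrightarrow> smooth_on S (\<lambda>p. inverse (f p))"
  by (simp add: smooth_on_def Ck_on_inverse)

lemma smooth_on_norm:
  fixes f :: "_ \<Rightarrow> _ :: real_inner"
  assumes "smooth_on S f" "\<And>p. p \<in> S \<Longrightarrow> f p \<noteq> 0"
  shows "smooth_on S (\<lambda>p. norm (f p))"
  using assms unfolding smooth_on_def norm_eq_sqrt_inner
  by (intro allI Ck_on_sqrt Ck_on_inner) auto

lemma smooth_on_cong:
  "smooth_on S f \<Longrightarrow> (\<And>p. p \<in> S \<Longrightarrow> g p = f p) \<Longrightarrow> smooth_on S g"
  unfolding smooth_on_def using Ck_on_cong by blast

section \<open>Functions on an interval\<close>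

lemma at_Icc_neq_bot: "L > 0 \<Longrightarrow> x \<in> {0..L::real} \<Longrightarrow> at x within {0..L} \<noteq> bot"
  by (simp add: trivial_limit_within islimpt_Icc)

lemma dx_eqI:
  assumes "L > 0" "x \<in> {0..L}" "(f has_vector_derivative d) (at x within {0..L})"
  shows "dx L f x = d"
  unfolding dx_def using vector_derivative_within[OF at_Icc_neq_bot[OF assms(1,2)] assms(3)] .

text \<open>\<open>vector_derivative\<close> chooses among all derivatives at the point, so it
  suffices that both functions have the same ones; the equality holds even where there is
  none.\<close>

lemma dx_cong:
  assumes "\<And>y. y \<in> {0..L} \<Longrightarrow> f y = g y" "x \<in> {0..L}"
  shows "dx L f x = dx L g x"
  unfolding dx_def vector_derivative_def
proof -
  have "(f has_vector_derivative d) (at x within {0..L}) = (g has_vector_derivative d) (at x within {0..L})" for d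
    by (intro iffI; erule has_vector_derivative_transform[OF assms(2), rotated]) (simp_all only: assms(1))
  then show "(SOME d. (f has_vector_derivative d) (at x within {0..L})) = (SOME d. (g has_vector_derivative d) (at x within {0..L}))"
    by simp
qed

lemma dx_iter_eqI:
  assumes "L > 0" "\<And>n x. x \<in> {0..L} \<Longrightarrow> (G n has_vector_derivative G (Suc n) x) (at x within {0..L})"
    and "\<And>x. x \<in> {0..L} \<Longrightarrow> f x = G 0 x" "x \<in> {0..L}"
  shows "(dx L ^^ n) f x = G n x"
  using assms(4)
proof (induction n arbitrary: x)
  case (Suc n)
  then show ?case using dx_cong[of L "(dx L ^^ n) f" "G n" x] dx_eqI[OF assms(1) _ assms(2)] by simp
qed (use assms in simp)

text \<open>In one dimension the derivative in direction v is v times the next member of the tower,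
  and each member is continuous because it is differentiable. Time slices and the limit curve are
  shown to be smooth in this way.\<close>

lemma smooth_on_derivs:
  assumes "\<And>n x. x \<in> S \<Longrightarrow> (G n has_vector_derivative G (Suc n) x) (at x within S)"
  shows "smooth_on S (G n)"
proof -
  have "Ck_on k S (G n)" for k
  proof (induction k arbitrary: n)
    case 0
    show ?case using assms has_vector_derivative_continuous_on by (simp, blast)
  next
    case (Suc k)
    show ?case unfolding Ck_on.simps
      by (rule exI[where x="\<lambda>p v. v *\<^sub>R G (Suc n) p"])
        (use assms Suc in \<open>auto simp: has_vector_derivative_def intro!: Ck_on_scaleR Ck_on_const\<close>)
  qed
  then show ?thesis by (simp add: smooth_on_def)
qed

section \<open>Functions on a space-time strip\<close>

text \<open>The strip leaves out t = 0, where a solution is only required to be continuous.\<close>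

definition smooth_xt :: "real \<Rightarrow> (real \<Rightarrow> real \<Rightarrow> 'a::real_normed_vector) \<Rightarrow> bool" where
  "smooth_xt L f \<longleftrightarrow> smooth_on ({0..L} \<times> {0<..}) (\<lambda>(x, t). f x t)"

definition DX :: "real \<Rightarrow> (real \<Rightarrow> real \<Rightarrow> 'a::real_normed_vector) \<Rightarrow> real \<Rightarrow> real \<Rightarrow> 'a" where
  "DX L f x t = dx L (\<lambda>y. f y t) x"

definition DT :: "(real \<Rightarrow> real \<Rightarrow> 'a::real_normed_vector) \<Rightarrow> real \<Rightarrow> real \<Rightarrow> 'a" where
  "DT f x t = vector_derivative (f x) (at t)"

lemma DT_eqI: "(f x has_vector_derivative d) (at t) \<Longrightarrow> DT f x t = d"
  unfolding DT_def by (rule vector_derivative_at)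

lemma DX_eqI: "L > 0 \<Longrightarrow> x \<in> {0..L} \<Longrightarrow>
    ((\<lambda>y. f y t) has_vector_derivative d) (at x within {0..L}) \<Longrightarrow> DX L f x t = d"
  unfolding DX_def by (rule dx_eqI)

lemma DX_cong: "(\<And>y. y \<in> {0..L} \<Longrightarrow> f y t = g y t) \<Longrightarrow> x \<in> {0..L} \<Longrightarrow> DX L f x t = DX L g x t"
  unfolding DX_def by (rule dx_cong)

lemma DT_cong:
  assumes "\<And>s. s > 0 \<Longrightarrow> f x s = g x s" "t > 0"
  shows "DT f x t = DT g x t"
proof -
  have "\<forall>\<^sub>F s in nhds t. f x s = g x s"
    using eventually_nhds_in_open[of "{0<..}" t] assms by (auto elim: eventually_mono)
  then show ?thesis unfolding DT_def by (intro vector_derivative_cong_eq) auto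
qed

context
  fixes L :: real and f :: "real \<Rightarrow> real \<Rightarrow> 'a::real_normed_vector"
  assumes L: "L > 0" and f: "smooth_xt L f"
begin

text \<open>The partial derivatives are the total derivative in the directions (1, 0) and (0, 1).
  The witness in \<open>Ck_on\<close> may change with k, so they are obtained for each k separately;
  uniqueness then identifies them with \<open>DX\<close> and \<open>DT\<close>.\<close>

lemma smooth_xt_partials:
  obtains fx ft where
    "\<And>x t. x \<in> {0..L} \<Longrightarrow> t > 0 \<Longrightarrow> ((\<lambda>y. f y t) has_vector_derivative fx x t) (at x within {0..L})"
    "\<And>x t. x \<in> {0..L} \<Longrightarrow> t > 0 \<Longrightarrow> (f x has_vector_derivative ft x t) (at t)"
    "Ck_on k ({0..L} \<times> {0<..}) (\<lambda>(x, t). fx x t)"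
    "Ck_on k ({0..L} \<times> {0<..}) (\<lambda>(x, t). ft x t)"
proof -
  let ?S = "{0..L} \<times> {0::real<..}"
  have "Ck_on (Suc k) ?S (\<lambda>(x,t). f x t)" using f by (simp add: smooth_xt_def smooth_on_def del: Ck_on.simps)
  then obtain f' where d: "\<And>p. p \<in> ?S \<Longrightarrow> ((\<lambda>(x,t). f x t) has_derivative f' p) (at p within ?S)"
    and c: "\<And>v. Ck_on k ?S (\<lambda>p. f' p v)" unfolding Ck_on.simps by auto
  have 1: "((\<lambda>y. f y t) has_vector_derivative f' (x, t) (1, 0)) (at x within {0..L})"
    if "x \<in> {0..L}" "t > 0" for x t
  proof -
    have "((\<lambda>y. (\<lambda>(x,t). f x t) (y,t)) has_derivative (\<lambda>h. f' (x,t) (h, 0))) (at x within {0..L})"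
      by (rule has_derivative_in_compose2[where t="?S" and s="{0..L}" and g="\<lambda>(x,t). f x t" and f="\<lambda>y. (y,t)"])
        (use that d in \<open>auto intro!: derivative_eq_intros\<close>)
    moreover have "(\<lambda>h. f' (x,t) (h, 0)) = (\<lambda>h. h *\<^sub>R f' (x,t) (1,0))"
    proof
      fix h show "f' (x,t) (h, 0) = h *\<^sub>R f' (x,t) (1,0)"
      using linear_scale[OF has_derivative_linear[OF d[of "(x,t)"]], of h "(1,0)"] that by auto
    qed
    ultimately show ?thesis unfolding has_vector_derivative_def by (simp only: split_conv)
  qed
  have 2: "(f x has_vector_derivative f' (x, t) (0, 1)) (at t)"
    if "x \<in> {0..L}" "t > 0" for x t
  proof -
    have "((\<lambda>s. (\<lambda>(x,t). f x t) (x,s)) has_derivative (\<lambda>h. f' (x,t) (0, h))) (at t within {0<..})"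
      by (rule has_derivative_in_compose2[where t="?S" and s="{0<..}" and g="\<lambda>(x,t). f x t" and f="\<lambda>s. (x,s)"])
        (use that d in \<open>auto intro!: derivative_eq_intros\<close>)
    moreover have "(\<lambda>h. f' (x,t) (0, h)) = (\<lambda>h. h *\<^sub>R f' (x,t) (0,1))"
    proof
      fix h show "f' (x,t) (0, h) = h *\<^sub>R f' (x,t) (0,1)"
      using linear_scale[OF has_derivative_linear[OF d[of "(x,t)"]], of h "(0,1)"] that by auto
    qed
    \<comment> \<open>The half line of positive times is open, so the time derivative is
      two-sided.\<close>
    moreover have "at t within {0<..} = at t" using that by (intro at_within_open) auto
    ultimately show ?thesis unfolding has_vector_derivative_def by (simp only: split_conv)
  qed
  show ?thesis
  proof (rule that[of "\<lambda>x t. f' (x, t) (1, 0)" "\<lambda>x t. f' (x, t) (0, 1)"])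
    show "Ck_on k ?S (\<lambda>(x, t). f' (x, t) (1, 0))" "Ck_on k ?S (\<lambda>(x, t). f' (x, t) (0, 1))"
      using c[of "(1,0)"] c[of "(0,1)"] by (simp_all only: case_prod_unfold prod.collapse)
  qed (fact 1, fact 2)
qed

lemma DX: "x \<in> {0..L} \<Longrightarrow> t > 0 \<Longrightarrow>
    ((\<lambda>y. f y t) has_vector_derivative DX L f x t) (at x within {0..L})"
  by (rule smooth_xt_partials[of 0]) (metis DX_eqI[OF L])

lemma DT: "x \<in> {0..L} \<Longrightarrow> t > 0 \<Longrightarrow> (f x has_vector_derivative DT f x t) (at t)"
  by (rule smooth_xt_partials[of 0]) (metis DT_eqI)

lemma smooth_xt_DX: "smooth_xt L (DX L f)"
  unfolding smooth_xt_def smooth_on_def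
proof
  fix k show "Ck_on k ({0..L} \<times> {0<..}) (\<lambda>(x, t). DX L f x t)"
  proof (rule smooth_xt_partials[of k])
    fix fx ft
    assume *: "\<And>x t. x \<in> {0..L} \<Longrightarrow> t > 0 \<Longrightarrow> ((\<lambda>y. f y t) has_vector_derivative fx x t) (at x within {0..L})"
      and c: "Ck_on k ({0..L} \<times> {0<..}) (\<lambda>(x, t). fx x t)"
    show ?thesis by (intro Ck_on_cong[OF c]) (auto intro!: DX_eqI[OF L] *)
  qed
qed

lemma smooth_xt_DT: "smooth_xt L (DT f)"
  unfolding smooth_xt_def smooth_on_def
proof
  fix k show "Ck_on k ({0..L} \<times> {0<..}) (\<lambda>(x, t). DT f x t)"
  proof (rule smooth_xt_partials[of k])
    fix fx ft
    assume *: "\<And>x t. x \<in> {0..L} \<Longrightarrow> t > 0 \<Longrightarrow> (f x has_vector_derivative ft x t) (at t)"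
      and c: "Ck_on k ({0..L} \<times> {0<..}) (\<lambda>(x, t). ft x t)"
    show ?thesis by (intro Ck_on_cong[OF c]) (auto intro!: DT_eqI *)
  qed
qed

lemma smooth_xt_continuous: "continuous_on ({0..L} \<times> {0<..}) (\<lambda>(x, t). f x t)"
  using f unfolding smooth_xt_def smooth_on_def using Ck_on.simps(1) by blast

lemma smooth_xt_continuous_x: "t > 0 \<Longrightarrow> continuous_on {0..L} (\<lambda>x. f x t)"
  by (rule has_vector_derivative_continuous_on[OF DX])

end

lemma integral_slice_has_derivative:
  fixes f :: "real \<Rightarrow> real \<Rightarrow> 'a::banach"
  assumes "L > 0" "smooth_xt L f" "a \<in> {0..L}" "t > 0"
  shows "((\<lambda>t. integral {0..a} (\<lambda>x. f x t)) has_vector_derivative integral {0..a} (\<lambda>x. DT f x t)) (at t)"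
proof -
  have "((\<lambda>t. integral (cbox 0 a) (\<lambda>x. f x t)) has_vector_derivative integral (cbox 0 a) (\<lambda>x. DT f x t)) (at t within {0<..})"
  proof (rule leibniz_rule_vector_derivative)
    show "continuous_on ({0<..} \<times> cbox 0 a) (\<lambda>(t, x). DT f x t)"
    proof -
      have "continuous_on ({0<..} \<times> cbox 0 a) (\<lambda>p. (\<lambda>(x,t). DT f x t) (snd p, fst p))"
        by (rule continuous_on_compose2[OF smooth_xt_continuous[OF assms(1) smooth_xt_DT[OF assms(1,2)]]])
          (use assms in \<open>auto intro!: continuous_intros\<close>)
      then show ?thesis by (simp add: case_prod_unfold)
    qed
    show "(\<lambda>x. f x s) integrable_on cbox 0 a" if "s \<in> {0<..}" for s
      using continuous_on_subset[OF smooth_xt_continuous_x[OF assms(1,2)], of s "{0..a}"] that assms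
      by (auto intro!: integrable_continuous_real)
  qed (use assms DT[OF assms(1,2)] in \<open>auto intro: has_vector_derivative_at_within\<close>)
  moreover have "at t within {0<..} = at t" using assms by (intro at_within_open) auto
  ultimately show ?thesis by simp
qed

text \<open>The detour through integrals keeps the identity valid up to x = 0 and x = L:
  \<open>DX L f\<close> integrates to f a - f 0, the Leibniz rule differentiates this in time, and
  differentiation in the upper limit a recovers the integrand.\<close>

lemma DT_DX_commute:
  fixes f :: "real \<Rightarrow> real \<Rightarrow> 'a::banach"
  assumes "L > 0" "smooth_xt L f" "x \<in> {0..L}" "t > 0"
  shows "DT (DX L f) x t = DX L (DT f) x t"
proof -
  have FTC: "integral {0..a} (\<lambda>y. DX L f y s) = f a s - f 0 s" if "a \<in> {0..L}" "s > 0" for a s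
  proof -
    have "((\<lambda>y. f y s) has_vector_derivative DX L f y s) (at y within {0..a})" if "y \<in> {0..a}" for y
      using has_vector_derivative_within_subset[OF DX[OF assms(1,2)], of y s "{0..a}"] that \<open>a \<in> _\<close> \<open>s > 0\<close> by auto
    then show ?thesis using that
      by (intro integral_unique fundamental_theorem_of_calculus) auto
  qed
  have *: "integral {0..a} (\<lambda>y. DT (DX L f) y t) + DT f 0 t = DT f a t" if a: "a \<in> {0..L}" for a
  proof -
    have "((\<lambda>s. integral {0..a} (\<lambda>y. DX L f y s)) has_vector_derivative (DT f a t - DT f 0 t)) (at t)"
    proof (rule has_vector_derivative_transform_within_open[where S="{0<..}"])
      show "((\<lambda>s. f a s - f 0 s) has_vector_derivative DT f a t - DT f 0 t) (at t)"
        using assms a by (intro has_vector_derivative_diff DT) auto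
    qed (use assms a FTC in auto)
    from vector_derivative_unique_at[OF this integral_slice_has_derivative[OF assms(1) smooth_xt_DX[OF assms(1,2)] a assms(4)]]
    show ?thesis by (metis diff_add_cancel)
  qed
  have c: "continuous_on {0..L} (\<lambda>y. DT (DX L f) y t)"
    using assms smooth_xt_continuous_x smooth_xt_DX smooth_xt_DT by blast
  have "((\<lambda>a. integral {0..a} (\<lambda>y. DT (DX L f) y t) + DT f 0 t) has_vector_derivative DT (DX L f) x t + 0) (at x within {0..L})"
    by (intro has_vector_derivative_add integral_has_vector_derivative[OF c assms(3)] has_vector_derivative_const)
  then have "((\<lambda>a. integral {0..a} (\<lambda>y. DT (DX L f) y t) + DT f 0 t) has_vector_derivative DT (DX L f) x t) (at x within {0..L})"
    by simp
  then have "((\<lambda>a. DT f a t) has_vector_derivative DT (DX L f) x t) (at x within {0..L})"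
    by (rule has_vector_derivative_transform[OF assms(3), rotated]) (simp only: *)
  then show ?thesis using DX_eqI[OF assms(1,3)] by metis
qed

section \<open>Closure properties of smooth functions on the strip\<close>

lemma smooth_xt_add: "smooth_xt L f \<Longrightarrow> smooth_xt L g \<Longrightarrow> smooth_xt L (\<lambda>x t. f x t + g x t)"
  using smooth_on_add by (fastforce simp: smooth_xt_def case_prod_unfold)

lemma smooth_xt_const: "smooth_xt L (\<lambda>x t. c)"
  using smooth_on_const by (fastforce simp: smooth_xt_def case_prod_unfold)

lemma smooth_xt_bilinear: "bounded_bilinear b \<Longrightarrow> smooth_xt L f \<Longrightarrow> smooth_xt L g \<Longrightarrow>
    smooth_xt L (\<lambda>x t. b (f x t) (g x t))"
  using smooth_on_bilinear[of b "{0..L} \<times> {0<..}" "\<lambda>(x,t). f x t" "\<lambda>(x,t). g x t"]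
  by (simp add: smooth_xt_def case_prod_unfold)

lemmas smooth_xt_mult = smooth_xt_bilinear[OF bounded_bilinear_mult]
lemmas smooth_xt_scaleR = smooth_xt_bilinear[OF bounded_bilinear_scaleR]
lemmas smooth_xt_inner = smooth_xt_bilinear[OF bounded_bilinear_inner]

lemma smooth_xt_linear: "bounded_linear h \<Longrightarrow> smooth_xt L f \<Longrightarrow> smooth_xt L (\<lambda>x t. h (f x t))"
  using smooth_on_linear[of h "{0..L} \<times> {0<..}" "\<lambda>(x,t). f x t"]
  by (simp add: smooth_xt_def case_prod_unfold)

lemma smooth_xt_inverse:
  fixes f :: "_ \<Rightarrow> _ \<Rightarrow> real"
  shows "smooth_xt L f \<Longrightarrow> (\<And>x t. x \<in> {0..L} \<Longrightarrow> t > 0 \<Longrightarrow> f x t \<noteq> 0) \<Longrightarrow> smooth_xt L (\<lambda>x t. inverse (f x t))"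
  unfolding smooth_xt_def case_prod_unfold by (rule smooth_on_inverse) auto

lemma smooth_xt_norm:
  fixes f :: "_ \<Rightarrow> _ \<Rightarrow> _ :: real_inner"
  shows "smooth_xt L f \<Longrightarrow> (\<And>x t. x \<in> {0..L} \<Longrightarrow> t > 0 \<Longrightarrow> f x t \<noteq> 0) \<Longrightarrow> smooth_xt L (\<lambda>x t. norm (f x t))"
  unfolding smooth_xt_def case_prod_unfold by (rule smooth_on_norm) auto

lemma smooth_xt_cong:
  "smooth_xt L f \<Longrightarrow> (\<And>x t. x \<in> {0..L} \<Longrightarrow> t > 0 \<Longrightarrow> g x t = f x t) \<Longrightarrow> smooth_xt L g"
  unfolding smooth_xt_def by (erule smooth_on_cong) auto

section \<open>Geometry of the flow\<close>

lemma bounded_linear_rot: "bounded_linear rot"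
  unfolding linear_conv_bounded_linear[symmetric]
  by (rule linearI) (simp_all add: rot_def vec_eq_iff forall_2)

lemma rot_rot: "rot (rot u) = - u"
  by (simp add: rot_def vec_eq_iff forall_2)

lemma inner_rot: "rot u \<bullet> rot w = u \<bullet> w" "u \<bullet> rot u = 0" "rot u \<bullet> u = 0"
  by (simp_all add: rot_def inner_vec_def sum_2)

lemma norm_rot: "norm (rot u) = norm u"
  by (simp add: norm_eq_sqrt_inner inner_rot)

lemma smooth_xt_slice:
  assumes "L > 0" "smooth_xt L f" "t > 0"
  shows "smooth_on {0..L} (\<lambda>x. f x t)"
proof -
  have s: "smooth_xt L ((DX L ^^ n) f)" for n
    by (induction n) (use assms smooth_xt_DX in auto)
  show ?thesis
    using smooth_on_derivs[of "{0..L}" "\<lambda>n x. (DX L ^^ n) f x t" 0] DX[OF assms(1) s _ assms(3)] by simp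
qed

lemma DX_bilinear:
  assumes "L > 0" "bounded_bilinear b" "smooth_xt L f" "smooth_xt L g" "x \<in> {0..L}" "t > 0"
  shows "DX L (\<lambda>x t. b (f x t) (g x t)) x t = b (f x t) (DX L g x t) + b (DX L f x t) (g x t)"
  by (rule DX_eqI[OF assms(1,5)])
    (intro bounded_bilinear.has_vector_derivative[OF assms(2)] DX assms)

lemma DT_bilinear:
  assumes "L > 0" "bounded_bilinear b" "smooth_xt L f" "smooth_xt L g" "x \<in> {0..L}" "t > 0"
  shows "DT (\<lambda>x t. b (f x t) (g x t)) x t = b (f x t) (DT g x t) + b (DT f x t) (g x t)"
  by (rule DT_eqI)
    (intro bounded_bilinear.has_vector_derivative[OF assms(2)] DT[OF assms(1)] assms)

lemma DX_linear:
  assumes "L > 0" "bounded_linear h" "smooth_xt L f" "x \<in> {0..L}" "t > 0"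
  shows "DX L (\<lambda>x t. h (f x t)) x t = h (DX L f x t)"
  by (rule DX_eqI[OF assms(1,4)])
    (intro bounded_linear.has_vector_derivative[OF assms(2)] DX assms)

lemma DT_linear:
  assumes "L > 0" "bounded_linear h" "smooth_xt L f" "x \<in> {0..L}" "t > 0"
  shows "DT (\<lambda>x t. h (f x t)) x t = h (DT f x t)"
  by (rule DT_eqI)
    (intro bounded_linear.has_vector_derivative[OF assms(2)] DT[OF assms(1)] assms)

lemma DX_add:
  assumes "L > 0" "smooth_xt L f" "smooth_xt L g" "x \<in> {0..L}" "t > 0"
  shows "DX L (\<lambda>x t. f x t + g x t) x t = DX L f x t + DX L g x t"
  by (rule DX_eqI[OF assms(1,4)]) (intro has_vector_derivative_add DX assms)

lemma DT_add:
  assumes "L > 0" "smooth_xt L f" "smooth_xt L g" "x \<in> {0..L}" "t > 0"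
  shows "DT (\<lambda>x t. f x t + g x t) x t = DT f x t + DT g x t"
  by (rule DT_eqI) (intro has_vector_derivative_add DT[OF assms(1)] assms)

locale elastic_flow =
  fixes lam L R :: real and \<gamma> :: "real \<Rightarrow> real \<Rightarrow> real^2"
  assumes L_pos: "L > 0"
    and smooth: "smooth_xt L \<gamma>"
    and regular: "t > 0 \<Longrightarrow> regular_curve L (\<lambda>x. \<gamma> x t)"
    and evolution: "t > 0 \<Longrightarrow> x \<in> {0..L} \<Longrightarrow>
      (\<gamma> x has_vector_derivative
         elastic_speed lam L (\<lambda>y. \<gamma> y t) x *\<^sub>R unit_normal L (\<lambda>y. \<gamma> y t) x) (at t)"
    and boundary: "t > 0 \<Longrightarrow> boundary_conditions L R (\<lambda>x. \<gamma> x t)"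
begin

definition speed :: "real \<Rightarrow> real \<Rightarrow> real" where
  "speed x t = norm (DX L \<gamma> x t)"

definition Ds :: "(real \<Rightarrow> real \<Rightarrow> 'a::real_normed_vector) \<Rightarrow> real \<Rightarrow> real \<Rightarrow> 'a" where
  "Ds f x t = ds L (\<lambda>y. \<gamma> y t) (\<lambda>y. f y t) x"

definition tang :: "real \<Rightarrow> real \<Rightarrow> real^2" where
  "tang = Ds \<gamma>"

definition nrml :: "real \<Rightarrow> real \<Rightarrow> real^2" where
  "nrml x t = rot (tang x t)"

primrec \<kappa> :: "nat \<Rightarrow> real \<Rightarrow> real \<Rightarrow> real" where
  "\<kappa> 0 = (\<lambda>x t. curvature L (\<lambda>y. \<gamma> y t) x)"
| "\<kappa> (Suc n) = Ds (\<kappa> n)"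

definition V :: "real \<Rightarrow> real \<Rightarrow> real" where
  "V x t = elastic_speed lam L (\<lambda>y. \<gamma> y t) x"

declare \<kappa>.simps(1) [simp del]

lemma V_eq: "V x t = - 2 * \<kappa> 2 x t - (\<kappa> 0 x t)^3 + lam\<^sup>2 * \<kappa> 0 x t"
  by (simp add: V_def elastic_speed_def numeral_2_eq_2 Ds_def \<kappa>.simps(1))

lemma Ds_eq: "Ds f x t = DX L f x t /\<^sub>R speed x t"
  by (simp add: Ds_def ds_def speed_def DX_def)

lemma speed_pos: "x \<in> {0..L} \<Longrightarrow> t > 0 \<Longrightarrow> speed x t > 0"
  using regular by (simp add: speed_def DX_def regular_curve_def)

lemma DX_eq: "x \<in> {0..L} \<Longrightarrow> t > 0 \<Longrightarrow> DX L f x t = speed x t *\<^sub>R Ds f x t"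
  using speed_pos[of x t] by (simp add: Ds_eq)

lemma smooth_speed: "smooth_xt L speed"
  unfolding speed_def
  using smooth_xt_norm[OF smooth_xt_DX[OF L_pos smooth]] speed_pos by (fastforce simp: speed_def)

lemma smooth_Ds: "smooth_xt L f \<Longrightarrow> smooth_xt L (Ds f)"
  unfolding Ds_eq[abs_def]
  by (intro smooth_xt_scaleR smooth_xt_inverse smooth_speed smooth_xt_DX[OF L_pos]) (use speed_pos in force)+

lemma smooth_tang: "smooth_xt L tang"
  unfolding tang_def by (rule smooth_Ds[OF smooth])

lemma smooth_nrml: "smooth_xt L nrml"
  unfolding nrml_def by (rule smooth_xt_linear[OF bounded_linear_rot smooth_tang])

lemma \<kappa>_0_eq: "\<kappa> 0 x t = Ds tang x t \<bullet> nrml x t"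
  by (simp add: \<kappa>.simps(1) curvature_def unit_normal_def Ds_def tang_def nrml_def)

lemma smooth_\<kappa>: "smooth_xt L (\<kappa> n)"
proof (induction n)
  case 0
  show ?case unfolding \<kappa>_0_eq by (intro smooth_xt_inner smooth_Ds smooth_tang smooth_nrml)
qed (simp add: smooth_Ds)

lemma smooth_V: "smooth_xt L V"
  unfolding V_eq diff_conv_add_uminus
  unfolding power3_eq_cube
  by (intro smooth_xt_add smooth_xt_mult smooth_xt_const smooth_\<kappa>
      smooth_xt_linear[OF bounded_linear_minus[OF bounded_linear_ident]])

lemma Ds_has_vector_derivative:
  "smooth_xt L f \<Longrightarrow> x \<in> {0..L} \<Longrightarrow> t > 0 \<Longrightarrow>
    ((\<lambda>y. f y t) has_vector_derivative speed x t *\<^sub>R Ds f x t) (at x within {0..L})"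
  using DX[OF L_pos] DX_eq by metis

lemma Ds_cong: "(\<And>y. y \<in> {0..L} \<Longrightarrow> f y t = g y t) \<Longrightarrow> x \<in> {0..L} \<Longrightarrow> Ds f x t = Ds g x t"
  using DX_cong[of L f t g x] by (simp add: Ds_eq)

lemma Ds_bilinear:
  assumes "bounded_bilinear b" "smooth_xt L f" "smooth_xt L g" "x \<in> {0..L}" "t > 0"
  shows "Ds (\<lambda>x t. b (f x t) (g x t)) x t = b (f x t) (Ds g x t) + b (Ds f x t) (g x t)"
  unfolding Ds_eq DX_bilinear[OF L_pos assms] scaleR_right_distrib
    bounded_bilinear.scaleR_left[OF assms(1)] bounded_bilinear.scaleR_right[OF assms(1)] ..

lemmas Ds_mult = Ds_bilinear[OF bounded_bilinear_mult]
lemmas Ds_scaleR = Ds_bilinear[OF bounded_bilinear_scaleR]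

lemma Ds_linear:
  assumes "bounded_linear h" "smooth_xt L f" "x \<in> {0..L}" "t > 0"
  shows "Ds (\<lambda>x t. h (f x t)) x t = h (Ds f x t)"
  unfolding Ds_eq DX_linear[OF L_pos assms] linear_scale[OF bounded_linear.linear[OF assms(1)]] ..

lemma Ds_add:
  assumes "smooth_xt L f" "smooth_xt L g" "x \<in> {0..L}" "t > 0"
  shows "Ds (\<lambda>x t. f x t + g x t) x t = Ds f x t + Ds g x t"
  unfolding Ds_eq DX_add[OF L_pos assms] scaleR_right_distrib ..

lemma norm_tang: "x \<in> {0..L} \<Longrightarrow> t > 0 \<Longrightarrow> norm (tang x t) = 1"
  using speed_pos[of x t] by (simp add: tang_def Ds_eq speed_def)

lemma norm_nrml: "x \<in> {0..L} \<Longrightarrow> t > 0 \<Longrightarrow> norm (nrml x t) = 1"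
  by (simp add: nrml_def norm_rot norm_tang)

lemma frenet_tang: "x \<in> {0..L} \<Longrightarrow> t > 0 \<Longrightarrow> Ds tang x t = \<kappa> 0 x t *\<^sub>R nrml x t"
  using curvature_equation[OF L_pos, of "\<lambda>x. \<gamma> x t" x] regular[of t] smooth_xt_slice[OF L_pos smooth, of t]
  by (simp add: smooth_on_def del: Ck_on.simps) (simp add: Ds_def tang_def nrml_def unit_normal_def \<kappa>.simps(1))

text \<open>Rotation is linear and therefore commutes with \<open>Ds\<close>; applied twice it is
  -1, which turns the formula for the tangent into this one.\<close>

lemma frenet_nrml:
  assumes "x \<in> {0..L}" "t > 0"
  shows "Ds nrml x t = - \<kappa> 0 x t *\<^sub>R tang x t"
proof -
  have "Ds nrml x t = rot (Ds tang x t)"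
    using Ds_linear[OF bounded_linear_rot smooth_tang assms] by (simp add: nrml_def[abs_def])
  then show ?thesis
    by (simp add: frenet_tang[OF assms] linear_scale[OF bounded_linear.linear[OF bounded_linear_rot]] nrml_def rot_rot)
qed

section \<open>Evolution of the geometric quantities\<close>

lemma DT_\<gamma>: "x \<in> {0..L} \<Longrightarrow> t > 0 \<Longrightarrow> DT \<gamma> x t = V x t *\<^sub>R nrml x t"
  using DT_eqI[OF evolution] by (simp add: V_def nrml_def tang_def Ds_def unit_normal_def)

text \<open>The end points do not move, so the velocity, which is \<open>V\<close> times a unit
  vector, vanishes there.\<close>

lemma V_boundary:
  assumes "t > 0"
  shows "V 0 t = 0" "V L t = 0"
proof -
  have "V x t = 0" if "x \<in> {0..L}" "\<And>s. s > 0 \<Longrightarrow> \<gamma> x s = c" for x c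
  proof -
    have "DT \<gamma> x t = DT (\<lambda>x t. c) x t" by (rule DT_cong) (use that assms in auto)
    also have "\<dots> = 0" by (rule DT_eqI) simp
    finally show ?thesis using DT_\<gamma>[OF that(1) assms] norm_nrml[OF that(1) assms] by auto
  qed
  from this[of 0] this[of L] show "V 0 t = 0" "V L t = 0"
    using boundary L_pos by (auto simp: boundary_conditions_def)
qed

lemma \<kappa>_0_boundary: "t > 0 \<Longrightarrow> \<kappa> 0 0 t = 0" "t > 0 \<Longrightarrow> \<kappa> 0 L t = 0"
  using boundary by (auto simp: boundary_conditions_def \<kappa>.simps(1))

lemma DT_DX_\<gamma>:
  assumes "x \<in> {0..L}" "t > 0"
  shows "DT (DX L \<gamma>) x t = speed x t *\<^sub>R (Ds V x t *\<^sub>R nrml x t - (V x t * \<kappa> 0 x t) *\<^sub>R tang x t)"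
proof -
  have "DT (DX L \<gamma>) x t = DX L (DT \<gamma>) x t"
    by (rule DT_DX_commute[OF L_pos smooth assms])
  also have "\<dots> = DX L (\<lambda>x t. V x t *\<^sub>R nrml x t) x t"
    by (rule DX_cong) (use assms DT_\<gamma> in auto)
  also have "\<dots> = speed x t *\<^sub>R (V x t *\<^sub>R Ds nrml x t + Ds V x t *\<^sub>R nrml x t)"
    by (simp add: DX_eq[OF assms] Ds_scaleR[OF smooth_V smooth_nrml assms])
  finally show ?thesis by (simp add: frenet_nrml[OF assms])
qed

text \<open>Obtained by differentiating the squared speed, where only the tangential part of
  \<open>DT_DX_\<gamma>\<close> survives.\<close>

lemma DT_speed:
  assumes "x \<in> {0..L}" "t > 0"
  shows "DT speed x t = - \<kappa> 0 x t * V x t * speed x t"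
proof -
  have "DT (\<lambda>x t. speed x t * speed x t) x t = DT (\<lambda>x t. DX L \<gamma> x t \<bullet> DX L \<gamma> x t) x t"
    by (simp add: speed_def dot_square_norm power2_eq_square)
  then have "2 * speed x t * DT speed x t = 2 * (DX L \<gamma> x t \<bullet> DT (DX L \<gamma>) x t)"
    using DT_bilinear[OF L_pos bounded_bilinear_mult smooth_speed smooth_speed assms]
      DT_bilinear[OF L_pos bounded_bilinear_inner smooth_xt_DX[OF L_pos smooth] smooth_xt_DX[OF L_pos smooth] assms]
    by (simp add: inner_commute)
  also have "DX L \<gamma> x t = speed x t *\<^sub>R tang x t"
    by (simp add: DX_eq[OF assms] tang_def)
  also have "(speed x t *\<^sub>R tang x t) \<bullet> DT (DX L \<gamma>) x t = - (speed x t * speed x t * (V x t * \<kappa> 0 x t))"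
    using norm_tang[OF assms]
    by (simp add: DT_DX_\<gamma>[OF assms] inner_diff_right nrml_def inner_rot dot_square_norm)
  finally have "speed x t * DT speed x t = speed x t * (- \<kappa> 0 x t * V x t * speed x t)"
    by (simp add: algebra_simps)
  then show ?thesis using speed_pos[OF assms] by (metis less_irrefl mult_left_cancel)
qed

text \<open>The commutator of the two derivatives: \<open>Ds\<close> divides by the speed, whose
  logarithmic time derivative is minus curvature times \<open>V\<close>.\<close>

lemma DT_Ds:
  fixes f :: "real \<Rightarrow> real \<Rightarrow> 'a::banach"
  assumes "smooth_xt L f" "x \<in> {0..L}" "t > 0"
  shows "DT (Ds f) x t = Ds (DT f) x t + (\<kappa> 0 x t * V x t) *\<^sub>R Ds f x t"
proof -
  have "speed x t *\<^sub>R Ds (DT f) x t = DT (DX L f) x t"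
    using DT_DX_commute[OF L_pos assms] DX_eq assms by metis
  also have "\<dots> = DT (\<lambda>x t. speed x t *\<^sub>R Ds f x t) x t"
    by (rule DT_cong) (use assms DX_eq in auto)
  also have "\<dots> = speed x t *\<^sub>R DT (Ds f) x t + DT speed x t *\<^sub>R Ds f x t"
    by (rule DT_bilinear[OF L_pos bounded_bilinear_scaleR smooth_speed smooth_Ds[OF assms(1)] assms(2,3)])
  finally have "speed x t *\<^sub>R DT (Ds f) x t = speed x t *\<^sub>R (Ds (DT f) x t + (\<kappa> 0 x t * V x t) *\<^sub>R Ds f x t)"
    by (simp add: DT_speed[OF assms(2,3)] algebra_simps)
  then show ?thesis using speed_pos[OF assms(2,3)] by simp
qed

lemma DT_tang:
  assumes "x \<in> {0..L}" "t > 0"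
  shows "DT tang x t = Ds V x t *\<^sub>R nrml x t"
proof -
  have "DT tang x t = Ds (DT \<gamma>) x t + (\<kappa> 0 x t * V x t) *\<^sub>R tang x t"
    unfolding tang_def by (rule DT_Ds[OF smooth assms])
  also have "Ds (DT \<gamma>) x t = Ds (\<lambda>x t. V x t *\<^sub>R nrml x t) x t"
    by (rule Ds_cong) (use assms DT_\<gamma> in auto)
  also have "\<dots> = V x t *\<^sub>R Ds nrml x t + Ds V x t *\<^sub>R nrml x t"
    by (rule Ds_scaleR[OF smooth_V smooth_nrml assms])
  finally show ?thesis by (simp add: frenet_nrml[OF assms] algebra_simps)
qed

text \<open>Curvature is the normal component of \<open>Ds tang\<close>. The motion of the normal
  contributes nothing, since its time derivative is tangential while \<open>Ds tang\<close> is
  normal; the quadratic term is the commutator.\<close>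

lemma DT_\<kappa>_0:
  assumes "x \<in> {0..L}" "t > 0"
  shows "DT (\<kappa> 0) x t = Ds (Ds V) x t + (\<kappa> 0 x t)^2 * V x t"
proof -
  have "DT (Ds tang) x t = Ds (DT tang) x t + (\<kappa> 0 x t * V x t) *\<^sub>R Ds tang x t"
    by (rule DT_Ds[OF smooth_tang assms])
  also have "Ds (DT tang) x t = Ds (\<lambda>x t. Ds V x t *\<^sub>R nrml x t) x t"
    by (rule Ds_cong) (use assms DT_tang in auto)
  also have "\<dots> = Ds V x t *\<^sub>R Ds nrml x t + Ds (Ds V) x t *\<^sub>R nrml x t"
    by (rule Ds_scaleR[OF smooth_Ds[OF smooth_V] smooth_nrml assms])
  finally have 1: "DT (Ds tang) x t \<bullet> nrml x t = Ds (Ds V) x t + (\<kappa> 0 x t)^2 * V x t"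
    using norm_nrml[OF assms]
    by (simp add: frenet_nrml[OF assms] frenet_tang[OF assms] inner_add_left inner_diff_left dot_square_norm power2_eq_square)
      (simp add: nrml_def inner_rot)
  have "DT nrml x t = rot (DT tang x t)"
    using DT_linear[OF L_pos bounded_linear_rot smooth_tang assms] by (simp add: nrml_def[abs_def])
  then have 2: "Ds tang x t \<bullet> DT nrml x t = 0"
    by (simp add: DT_tang[OF assms] frenet_tang[OF assms] linear_scale[OF bounded_linear.linear[OF bounded_linear_rot]] inner_rot)
  have "DT (\<kappa> 0) x t = Ds tang x t \<bullet> DT nrml x t + DT (Ds tang) x t \<bullet> nrml x t"
    unfolding \<kappa>_0_eq[abs_def]
    by (rule DT_bilinear[OF L_pos bounded_bilinear_inner smooth_Ds[OF smooth_tang] smooth_nrml assms])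
  then show ?thesis using 1 2 by simp
qed

end

section \<open>Differential polynomials in the curvature\<close>

text \<open>
  A list \<open>[i\<^sub>1, \<dots>, i\<^sub>r]\<close> stands for the monomial \<open>\<kappa> i\<^sub>1 \<cdots> \<kappa> i\<^sub>r\<close> in the arc length derivatives
  of the curvature.  Under scaling it has weight \<open>wt\<close>; \<open>mu\<close> is twice the exponent with which
  it enters the interpolation estimate, each factor contributing \<open>i + 1/2\<close>.
\<close>

definition mu :: "nat list \<Rightarrow> nat" where
  "mu l = (\<Sum>i\<leftarrow>l. 2 * i + 1)"

definition wt :: "nat list \<Rightarrow> nat" where
  "wt l = (\<Sum>i\<leftarrow>l. i + 1)"

lemma mu_simps [simp]: "mu [] = 0" "mu (i # l) = 2 * i + 1 + mu l" "mu (l @ l') = mu l + mu l'"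
  by (simp_all add: mu_def)

lemma wt_simps [simp]: "wt [] = 0" "wt (i # l) = i + 1 + wt l" "wt (l @ l') = wt l + wt l'"
  by (simp_all add: wt_def)

lemma mu_ge: "i \<in> set l \<Longrightarrow> 2 * i + 1 \<le> mu l"
  by (induction l) auto

text \<open>An entry i adds i + 1 to the weight, and an odd sum has an odd summand.\<close>

lemma even_index_of_odd_wt: "odd (wt l) \<Longrightarrow> \<exists>i\<in>set l. even i"
  by (induction l) auto

context elastic_flow
begin

definition mon :: "nat list \<Rightarrow> real \<Rightarrow> real \<Rightarrow> real" where
  "mon l x t = (\<Prod>i\<leftarrow>l. \<kappa> i x t)"

text \<open>Finite sums of monomials with \<open>mu\<close> at most p. Of the weight only the parity
  is recorded: the flow is not homogeneous, having a linear term of weight 1 beside the cubic one of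
  weight 3, but it preserves parity. Equality is asked on the strip only, where the derivatives have
  a meaning.\<close>

inductive dpoly :: "nat \<Rightarrow> nat \<Rightarrow> (real \<Rightarrow> real \<Rightarrow> real) \<Rightarrow> bool" for p w where
  mon: "mu l \<le> p \<Longrightarrow> even (wt l + w) \<Longrightarrow>
    (\<And>x t. x \<in> {0..L} \<Longrightarrow> t > 0 \<Longrightarrow> f x t = c * mon l x t) \<Longrightarrow> dpoly p w f"
| add: "dpoly p w f \<Longrightarrow> dpoly p w g \<Longrightarrow>
    (\<And>x t. x \<in> {0..L} \<Longrightarrow> t > 0 \<Longrightarrow> h x t = f x t + g x t) \<Longrightarrow> dpoly p w h"

lemma smooth_mon: "smooth_xt L (mon l)"
  unfolding mon_def[abs_def]
  by (induction l) (auto intro: smooth_xt_const smooth_xt_mult smooth_\<kappa>)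

lemma dpoly_smooth: "dpoly p w f \<Longrightarrow> smooth_xt L f"
proof (induction rule: dpoly.induct)
  case (mon l f c)
  show ?case by (rule smooth_xt_cong[OF smooth_xt_mult[OF smooth_xt_const smooth_mon]]) (rule mon(3))
next
  case (add f g h)
  show ?case by (rule smooth_xt_cong[OF smooth_xt_add[OF add.IH]]) (rule add(3))
qed

lemma dpoly_cong:
  assumes "dpoly p w f" "\<And>x t. x \<in> {0..L} \<Longrightarrow> t > 0 \<Longrightarrow> g x t = f x t"
  shows "dpoly p w g"
  using assms(1)
proof cases
  case (mon l c)
  show ?thesis by (rule dpoly.mon[OF mon(1,2)]) (simp only: mon(3) assms(2))
next
  case (add f1 f2)
  show ?thesis by (rule dpoly.add[OF add(1,2)]) (simp only: add(3) assms(2))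
qed

lemma dpoly_mono: "dpoly p w f \<Longrightarrow> p \<le> p' \<Longrightarrow> even (w + w') \<Longrightarrow> dpoly p' w' f"
proof (induction rule: dpoly.induct)
  case (mon l f c)
  show ?case by (rule dpoly.mon[OF _ _ mon(3)]) (use mon in auto)
next
  case (add f g h)
  show ?case by (rule dpoly.add[OF add.IH add.hyps(3)]) (use add in auto)
qed

lemma dpoly_plus: "dpoly p w f \<Longrightarrow> dpoly p w g \<Longrightarrow> dpoly p w (\<lambda>x t. f x t + g x t)"
  by (rule dpoly.add) auto

lemma dpoly_const: "even w \<Longrightarrow> dpoly p w (\<lambda>x t. c)"
  by (rule dpoly.mon[where l="[]" and c=c]) (auto simp: mon_def)

lemma dpoly_\<kappa>: "dpoly (2 * n + 1) (n + 1) (\<kappa> n)"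
  by (rule dpoly.mon[where l="[n]" and c=1]) (auto simp: mon_def)

lemma dpoly_mult:
  assumes "dpoly p w f" "dpoly p' w' g"
  shows "dpoly (p + p') (w + w') (\<lambda>x t. f x t * g x t)"
  using assms(1)
proof (induction rule: dpoly.induct)
  case f: (mon l f c)
  show ?case using assms(2)
  proof (induction rule: dpoly.induct)
    case g: (mon l' g c')
    show ?case
      by (rule dpoly.mon[where l="l @ l'" and c="c * c'"])
        (use f(1,2) g(1,2) in \<open>auto simp: f(3) g(3) mon_def\<close>)
  next
    case (add g1 g2 h)
    show ?case by (rule dpoly.add[OF add.IH]) (simp add: add.hyps(3) algebra_simps)
  qed
next
  case (add f1 f2 h)
  show ?case by (rule dpoly.add[OF add.IH]) (simp add: add.hyps(3) algebra_simps)
qed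

lemma dpoly_cmult: "dpoly p w f \<Longrightarrow> dpoly p w (\<lambda>x t. c * f x t)"
  using dpoly_mult[OF dpoly_const[of 0 0 c]] by simp

text \<open>In each term of the product rule one index rises by one, which adds 2 to
  \<open>mu\<close> and 1 to \<open>wt\<close>.\<close>

lemma dpoly_Ds_mon: "dpoly (mu l + 2) (wt l + 1) (Ds (mon l))"
proof (induction l)
  case Nil
  have "Ds (mon []) x t = 0" if "x \<in> {0..L}" "t > 0" for x t
    using DX_eqI[OF L_pos that(1), of "mon []" t 0] by (simp add: Ds_eq mon_def)
  \<comment> \<open>The zero function has to be presented with a monomial of odd weight; the
    coefficient 0 makes any such monomial do.\<close>
  then show ?case by (intro dpoly.mon[where l="[0]" and c=0]) auto
next
  case (Cons i l)
  have 1: "Ds (mon (i # l)) x t = \<kappa> i x t * Ds (mon l) x t + \<kappa> (Suc i) x t * mon l x t"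
    if "x \<in> {0..L}" "t > 0" for x t
    using Ds_mult[OF smooth_\<kappa> smooth_mon that, of i l] by (simp add: mon_def[abs_def])
  have 2: "dpoly (mu (i # l) + 2) (wt (i # l) + 1) (\<lambda>x t. \<kappa> i x t * Ds (mon l) x t)"
    by (rule dpoly_mono[OF dpoly_mult[OF dpoly_\<kappa> Cons.IH]]) auto
  have "dpoly (mu l) (wt l) (mon l)"
    by (rule dpoly.mon[where l=l and c=1]) auto
  then have 3: "dpoly (mu (i # l) + 2) (wt (i # l) + 1) (\<lambda>x t. \<kappa> (Suc i) x t * mon l x t)"
    by (rule dpoly_mono[OF dpoly_mult[OF dpoly_\<kappa>]]) auto
  from 2 3 1 show ?case by (rule dpoly.add)
qed

lemma dpoly_Ds: "dpoly p w f \<Longrightarrow> dpoly (p + 2) (w + 1) (Ds f)"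
proof (induction rule: dpoly.induct)
  case (mon l f c)
  have "Ds f x t = c * Ds (mon l) x t" if "x \<in> {0..L}" "t > 0" for x t
  proof -
    have "Ds f x t = Ds (\<lambda>x t. c * mon l x t) x t"
      by (rule Ds_cong) (use that mon in auto)
    then show ?thesis using Ds_linear[OF bounded_linear_mult_right smooth_mon that] by simp
  qed
  then show ?case using mon(1,2)
    by (intro dpoly_cong[OF dpoly_mono[OF dpoly_cmult[OF dpoly_Ds_mon]]]) auto
next
  case (add f g h)
  have "Ds h x t = Ds f x t + Ds g x t" if "x \<in> {0..L}" "t > 0" for x t
  proof -
    have "Ds h x t = Ds (\<lambda>x t. f x t + g x t) x t"
      by (rule Ds_cong) (use that add in auto)
    then show ?thesis using Ds_add[OF dpoly_smooth[OF add.hyps(1)] dpoly_smooth[OF add.hyps(2)] that] by simp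
  qed
  with add.IH show ?case by (rule dpoly.add)
qed

text \<open>Each monomial of odd weight contains a factor of even index, and the bound on
  \<open>mu\<close> limits that index, so that this can serve as the step of an induction on the
  order.\<close>

lemma dpoly_eq_0:
  assumes "dpoly p w f" "odd w" "x \<in> {0..L}" "t > 0"
    and "\<And>i. even i \<Longrightarrow> 2 * i + 1 \<le> p \<Longrightarrow> \<kappa> i x t = 0"
  shows "f x t = 0"
  using assms(1)
proof (induction rule: dpoly.induct)
  case (mon l f c)
  then obtain i where i: "i \<in> set l" "even i" using even_index_of_odd_wt[of l] assms(2) by auto
  then have "\<kappa> i x t = 0" using assms(5) mu_ge[OF i(1)] mon(1) by auto
  then have "mon l x t = 0" using i by (auto simp: mon_def prod_list_zero_iff)
  then show ?case using mon(3)[OF assms(3,4)] by simp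
next
  case (add f g h)
  then show ?case using assms by simp
qed

text \<open>The speed \<open>V\<close> without its leading term: a cubic and a linear term in the
  curvature, with \<open>mu\<close> at most 3 instead of 5.\<close>

abbreviation W :: "real \<Rightarrow> real \<Rightarrow> real" where
  "W x t \<equiv> V x t + 2 * \<kappa> 2 x t"

lemma dpoly_W: "dpoly 3 1 W"
proof (rule dpoly_cong)
  have 1: "dpoly 1 1 (\<kappa> 0)" using dpoly_\<kappa>[of 0] by simp
  have "dpoly (1 + (1 + 1)) (1 + (1 + 1)) (\<lambda>x t. \<kappa> 0 x t * (\<kappa> 0 x t * \<kappa> 0 x t))"
    by (intro dpoly_mult 1)
  then have "dpoly 3 1 (\<lambda>x t. (-1) * (\<kappa> 0 x t * (\<kappa> 0 x t * \<kappa> 0 x t)))"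
    by (intro dpoly_cmult) (auto elim: dpoly_mono)
  moreover have "dpoly 3 1 (\<lambda>x t. lam\<^sup>2 * \<kappa> 0 x t)"
    by (rule dpoly_mono[OF dpoly_cmult[OF 1]]) auto
  ultimately show "dpoly 3 1 (\<lambda>x t. (-1) * (\<kappa> 0 x t * (\<kappa> 0 x t * \<kappa> 0 x t)) + lam\<^sup>2 * \<kappa> 0 x t)"
    by (rule dpoly_plus)
qed (simp add: V_eq power3_eq_cube)

lemma dpoly_V: "dpoly 5 1 V"
proof (rule dpoly_cong)
  have "dpoly 5 1 (\<kappa> 2)" using dpoly_mono[OF dpoly_\<kappa>[of 2], of 5 1] by simp
  then show "dpoly 5 1 (\<lambda>x t. W x t + (-2) * \<kappa> 2 x t)"
    by (intro dpoly_plus dpoly_cmult dpoly_mono[OF dpoly_W]) auto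
qed simp

lemma Ds_plus_\<kappa>:
  assumes "smooth_xt L f" "x \<in> {0..L}" "t > 0"
  shows "Ds (\<lambda>x t. f x t + c * \<kappa> n x t) x t = Ds f x t + c * \<kappa> (Suc n) x t"
  using Ds_add[OF assms(1) smooth_xt_mult[OF smooth_xt_const smooth_\<kappa>] assms(2,3), of c n]
    Ds_linear[OF bounded_linear_mult_right smooth_\<kappa> assms(2,3), of c n] by simp

text \<open>The monomial \<open>\<kappa> (n + 4)\<close> has \<open>mu\<close> equal to 2n + 9, so
  the remainder is smaller by 2; this is the gap that the energy estimate exploits. The induction
  step uses the commutator, whose term has \<open>mu\<close> at most 1 + 5 + (2n + 3), exactly the
  bound for n + 1.\<close>

lemma dpoly_DT_\<kappa>: "dpoly (2 * n + 7) (n + 1) (\<lambda>x t. DT (\<kappa> n) x t + 2 * \<kappa> (n + 4) x t)"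
proof (induction n)
  case 0
  have smW: "smooth_xt L W" using dpoly_W dpoly_smooth by blast
  have 1: "DT (\<kappa> 0) x t + 2 * \<kappa> 4 x t = Ds (Ds W) x t + \<kappa> 0 x t * (\<kappa> 0 x t * V x t)"
    if "x \<in> {0..L}" "t > 0" for x t
  proof -
    have "Ds V y t = Ds W y t + (-2) * \<kappa> 3 y t" if "y \<in> {0..L}" for y
    proof -
      have "Ds V y t = Ds (\<lambda>x t. W x t + (-2) * \<kappa> 2 x t) y t"
        by (rule Ds_cong) (use that in auto)
      then show ?thesis using Ds_plus_\<kappa>[OF smW that \<open>t > 0\<close>, of "-2" 2] by (simp add: eval_nat_numeral)
    qed
    then have "Ds (Ds V) x t = Ds (\<lambda>x t. Ds W x t + (-2) * \<kappa> 3 x t) x t"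
      by (intro Ds_cong that) auto
    then have "Ds (Ds V) x t = Ds (Ds W) x t - 2 * \<kappa> 4 x t"
      using Ds_plus_\<kappa>[OF smooth_Ds[OF smW] that, of "-2" 3] by (simp add: eval_nat_numeral)
    then show ?thesis using DT_\<kappa>_0[OF that] by (simp add: power2_eq_square)
  qed
  have "dpoly 7 1 (Ds (Ds W))"
    by (rule dpoly_mono[OF dpoly_Ds[OF dpoly_Ds[OF dpoly_W]]]) auto
  moreover have "dpoly 7 1 (\<lambda>x t. \<kappa> 0 x t * (\<kappa> 0 x t * V x t))"
    by (rule dpoly_mono[OF dpoly_mult[OF dpoly_\<kappa> dpoly_mult[OF dpoly_\<kappa> dpoly_V]]]) auto
  ultimately have "dpoly 7 1 (\<lambda>x t. DT (\<kappa> 0) x t + 2 * \<kappa> 4 x t)"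
    by (rule dpoly.add) (rule 1)
  then show ?case by simp
next
  case (Suc n)
  let ?P = "\<lambda>x t. DT (\<kappa> n) x t + 2 * \<kappa> (n + 4) x t"
  have 1: "DT (\<kappa> (Suc n)) x t + 2 * \<kappa> (Suc n + 4) x t = Ds ?P x t + \<kappa> 0 x t * (V x t * \<kappa> (Suc n) x t)"
    if "x \<in> {0..L}" "t > 0" for x t
    using DT_Ds[OF smooth_\<kappa> that, of n] Ds_plus_\<kappa>[OF smooth_xt_DT[OF L_pos smooth_\<kappa>] that, of n 2 "n + 4"]
    by simp
  have "dpoly (2 * Suc n + 7) (Suc n + 1) (Ds ?P)"
    by (rule dpoly_mono[OF dpoly_Ds[OF Suc.IH]]) auto
  moreover have "dpoly (2 * Suc n + 7) (Suc n + 1) (\<lambda>x t. \<kappa> 0 x t * (V x t * \<kappa> (Suc n) x t))"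
    by (rule dpoly_mono[OF dpoly_mult[OF dpoly_\<kappa> dpoly_mult[OF dpoly_V dpoly_\<kappa>]]]) auto
  ultimately show ?case by (rule dpoly.add) (rule 1)
qed

text \<open>Order 0 is given, and at order 2 the vanishing of \<open>V\<close> and of the curvature
  leaves only the second derivative. For n = m + 4, the identity \<open>\<kappa> m x t = 0\<close>
  holds at the end point for all positive times; differentiated in time it leaves a multiple of
  \<open>\<kappa> (m + 4)\<close> and a remainder of odd weight, each monomial of which contains an
  even derivative of lower order.\<close>

lemma \<kappa>_boundary:
  assumes "even n" "t > 0" "x \<in> {0, L}"
  shows "\<kappa> n x t = 0"
  using assms(1,2)
proof (induction n arbitrary: t rule: less_induct)
  case (less n)
  have x: "x \<in> {0..L}" using assms(3) L_pos by auto
  consider "n = 0" | "n = 2" | m where "n = m + 4" "even m"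
  proof -
    have "n = 0 \<or> n = 2 \<or> n \<ge> 4" using less.prems(1) by presburger
    then show ?thesis using that less.prems(1)
      by (metis even_add even_numeral le_add_diff_inverse2)
  qed
  then show ?case
  proof cases
    case 1
    then show ?thesis using \<kappa>_0_boundary less.prems assms(3) by auto
  next
    case 2
    then show ?thesis using \<kappa>_0_boundary V_boundary V_eq[of x t] less.prems assms(3) by auto
  next
    case 3
    have "DT (\<kappa> m) x t = DT (\<lambda>x t. 0) x t"
      by (rule DT_cong) (use 3 less in auto)
    also have "\<dots> = 0" by (rule DT_eqI) simp
    finally have "DT (\<kappa> m) x t = 0" .
    moreover have "DT (\<kappa> m) x t + 2 * \<kappa> (m + 4) x t = 0"
    proof (rule dpoly_eq_0[OF dpoly_DT_\<kappa> _ x less.prems(2)])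
      fix i assume "even i" "2 * i + 1 \<le> 2 * m + 7"
      then have "i < n" using 3 by presburger
      then show "\<kappa> i x t = 0" using less \<open>even i\<close> by auto
    qed (use 3 in auto)
    ultimately show ?thesis using 3 by simp
  qed
qed

end

section \<open>Interpolation along a curve\<close>

lemma integral_Cauchy_Schwarz:
  fixes g h v :: "real \<Rightarrow> real"
  assumes "continuous_on {a..b} g" "continuous_on {a..b} h" "continuous_on {a..b} v"
    and v: "\<And>x. x \<in> {a..b} \<Longrightarrow> v x \<ge> 0"
  shows "integral {a..b} (\<lambda>x. g x * h x * v x)
    \<le> sqrt (integral {a..b} (\<lambda>x. (g x)\<^sup>2 * v x)) * sqrt (integral {a..b} (\<lambda>x. (h x)\<^sup>2 * v x))"
proof -
  let ?A = "integral {a..b} (\<lambda>x. (g x)\<^sup>2 * v x)" and ?C = "integral {a..b} (\<lambda>x. (h x)\<^sup>2 * v x)"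
    and ?B = "integral {a..b} (\<lambda>x. g x * h x * v x)"
  have i: "(\<lambda>x. (g x)\<^sup>2 * v x) integrable_on {a..b}" "(\<lambda>x. (h x)\<^sup>2 * v x) integrable_on {a..b}"
    "(\<lambda>x. g x * h x * v x) integrable_on {a..b}"
    by (auto intro!: integrable_continuous_real continuous_intros assms)
  have pos: "0 \<le> ?A" "0 \<le> ?C"
    using v by (auto intro!: integral_nonneg i)
  \<comment> \<open>The weighted integral of (g - s h)^2 as a quadratic in s. Below, s is the
    minimiser B / C or, if C = 0, a value that would make the expression equal to -1.\<close>
  have q: "0 \<le> ?A - 2 * s * ?B + s\<^sup>2 * ?C" for s
  proof -
    have "0 \<le> integral {a..b} (\<lambda>x. (g x - s * h x)\<^sup>2 * v x)"
      using v by (intro integral_nonneg integrable_continuous_real continuous_intros assms) auto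
    also have "(\<lambda>x. (g x - s * h x)\<^sup>2 * v x) = (\<lambda>x. (g x)\<^sup>2 * v x - (2 * s) * (g x * h x * v x) + s\<^sup>2 * ((h x)\<^sup>2 * v x))"
      by (auto simp: power2_eq_square algebra_simps)
    also have "integral {a..b} \<dots> = ?A - 2 * s * ?B + s\<^sup>2 * ?C"
      by (intro integral_unique has_integral_add has_integral_diff has_integral_mult_right integrable_integral i)
    finally show ?thesis .
  qed
  have "?B\<^sup>2 \<le> ?A * ?C"
  proof (cases "?C = 0")
    case True
    have "?B = 0"
    proof (rule ccontr)
      assume "?B \<noteq> 0"
      then show False using q[of "(?A + 1) / (2 * ?B)"] True by simp
    qed
    then show ?thesis using True by simp
  next
    case False
    then show ?thesis using q[of "?B / ?C"] pos by (simp add: power2_eq_square field_simps)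
  qed
  then show ?thesis using real_le_rsqrt by (simp add: real_sqrt_mult[symmetric])
qed

text \<open>A discrete maximum principle, which avoids logarithms because entries may be zero. At
  the first index where a maximum M > 1 is attained the left neighbour is strictly smaller, and
  log-convexity would give M^2 < M^2.\<close>

lemma log_convex_le_1:
  fixes b :: "nat \<Rightarrow> real"
  assumes "\<And>j. b j \<ge> 0" "\<And>j. j + 2 \<le> N \<Longrightarrow> (b (j + 1))\<^sup>2 \<le> b j * b (j + 2)"
    and "b 0 \<le> 1" "b N \<le> 1" "j \<le> N"
  shows "b j \<le> 1"
proof (rule ccontr)
  assume "\<not> b j \<le> 1"
  define M where "M = Max (b ` {..N})"
  have le: "b i \<le> M" if "i \<le> N" for i unfolding M_def using that by (intro Max_ge) auto
  have "M > 1" using le[OF assms(5)] \<open>\<not> b j \<le> 1\<close> by simp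
  have "M \<in> b ` {..N}" unfolding M_def by (intro Max_in) auto
  then have ex: "\<exists>i. i \<le> N \<and> b i = M" by auto
  define i where "i = (LEAST i. i \<le> N \<and> b i = M)"
  have i: "i \<le> N" "b i = M" using LeastI_ex[OF ex] unfolding i_def by auto
  have "i \<noteq> 0" "i \<noteq> N" using assms(3,4) i \<open>M > 1\<close> by (metis not_less)+
  then obtain k where k: "i = Suc k" "k + 2 \<le> N" using i(1) by (cases i) auto
  have "b k < M"
    using not_less_Least[of k "\<lambda>i. i \<le> N \<and> b i = M"] le[of k] k unfolding i_def[symmetric] by force
  have "M\<^sup>2 \<le> b k * b (k + 2)" using assms(2)[OF k(2)] i(2) k(1) by simp
  also have "\<dots> \<le> b k * M" using le[OF k(2)] assms(1) by (intro mult_left_mono) auto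
  also have "\<dots> < M * M" using \<open>b k < M\<close> \<open>M > 1\<close> by simp
  finally show False by (simp add: power2_eq_square)
qed

text \<open>Division by the geometric sequence A q^j preserves log-convexity and makes both end
  values at most 1.\<close>

lemma log_convex_interpolation:
  fixes a :: "nat \<Rightarrow> real"
  assumes "\<And>j. a j \<ge> 0" "\<And>j. (a (j + 1))\<^sup>2 \<le> a j * a (j + 2)"
    and "a 0 \<le> A" "a N \<le> A * q ^ N" "A > 0" "q > 0" "j \<le> N"
  shows "a j \<le> A * q ^ j"
proof -
  have "a j / (A * q ^ j) \<le> 1"
  proof (rule log_convex_le_1[where N=N and b="\<lambda>j. a j / (A * q ^ j)"])
    fix j
    have "(a (j+1))\<^sup>2 / (A * q ^ (j+1))\<^sup>2 \<le> (a j * a (j+2)) / (A * q ^ (j+1))\<^sup>2"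
      using assms(2) by (intro divide_right_mono) auto
    then show "(a (j+1) / (A * q ^ (j+1)))\<^sup>2 \<le> a j / (A * q ^ j) * (a (j+2) / (A * q ^ (j+2)))"
      by (simp add: power_divide power_mult_distrib power2_eq_square algebra_simps)
  qed (use assms in \<open>auto simp: divide_le_eq\<close>)
  then show ?thesis using assms by (simp add: divide_le_eq)
qed

text \<open>
  The curvature and its arc length derivatives on a fixed curve of speed \<open>v\<close>.  The vanishing of
  the even derivatives at the end points removes all boundary terms.
\<close>

locale jet =
  fixes L :: real and v :: "real \<Rightarrow> real" and f :: "nat \<Rightarrow> real \<Rightarrow> real"
  assumes L_pos: "L > 0"
    and v_cont: "continuous_on {0..L} v"
    and v_pos: "\<And>x. x \<in> {0..L} \<Longrightarrow> v x > 0"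
    and f_deriv: "\<And>n x. x \<in> {0..L} \<Longrightarrow> (f n has_vector_derivative v x * f (Suc n) x) (at x within {0..L})"
    and f_bdry: "\<And>n. even n \<Longrightarrow> f n 0 = 0" "\<And>n. even n \<Longrightarrow> f n L = 0"
begin

definition nm :: "nat \<Rightarrow> real" where
  "nm n = sqrt (integral {0..L} (\<lambda>x. (f n x)\<^sup>2 * v x))"

lemma f_cont: "continuous_on {0..L} (f n)"
  using f_deriv by (rule has_vector_derivative_continuous_on)

lemma v_nonneg: "x \<in> {0..L} \<Longrightarrow> v x \<ge> 0"
  using v_pos[of x] by simp

lemma nm_nonneg: "nm n \<ge> 0"
  unfolding nm_def using v_nonneg
  by (auto intro!: integral_nonneg integrable_continuous_real continuous_intros f_cont v_cont)

lemma nm_square: "(nm n)\<^sup>2 = integral {0..L} (\<lambda>x. (f n x)\<^sup>2 * v x)"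
  using nm_nonneg[of n] unfolding nm_def by simp

lemma abs_product_integral:
  "integral {0..L} (\<lambda>x. \<bar>f n x\<bar> * \<bar>f m x\<bar> * v x) \<le> nm n * nm m"
  using integral_Cauchy_Schwarz[of 0 L "\<lambda>x. \<bar>f n x\<bar>" "\<lambda>x. \<bar>f m x\<bar>" v] v_nonneg
  by (auto simp: nm_def intro!: continuous_intros f_cont v_cont)

lemma integral_by_parts:
  "integral {0..L} (\<lambda>x. f n x * f (Suc m) x * v x) + integral {0..L} (\<lambda>x. f (Suc n) x * f m x * v x)
     = f n L * f m L - f n 0 * f m 0"
proof -
  have "((\<lambda>x. f n x * (v x * f (Suc m) x) + (v x * f (Suc n) x) * f m x) has_integral
      f n L * f m L - f n 0 * f m 0) {0..L}"
    using L_pos by (intro fundamental_theorem_of_calculus has_vector_derivative_mult f_deriv) auto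
  then have "integral {0..L} (\<lambda>x. f n x * f (Suc m) x * v x + f (Suc n) x * f m x * v x) = f n L * f m L - f n 0 * f m 0"
    by (intro integral_unique) (simp add: algebra_simps)
  then show ?thesis
    by (subst (asm) integral_add) (auto intro!: integrable_continuous_real continuous_intros f_cont v_cont)
qed

text \<open>Integration by parts shifts one derivative, and Cauchy-Schwarz concludes. The boundary
  term is a product of two consecutive derivatives, one of which has even order.\<close>

lemma nm_log_convex: "(nm (n + 1))\<^sup>2 \<le> nm n * nm (n + 2)"
proof -
  have "f n L * f (Suc n) L - f n 0 * f (Suc n) 0 = 0"
    using f_bdry by (cases "even n") auto
  then have "(nm (n + 1))\<^sup>2 = - integral {0..L} (\<lambda>x. f n x * f (n + 2) x * v x)"
    using integral_by_parts[of n "Suc n"] unfolding nm_square by (simp add: power2_eq_square)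
  also have "\<dots> = integral {0..L} (\<lambda>x. - (f n x * f (n + 2) x * v x))" by simp
  also have "\<dots> \<le> integral {0..L} (\<lambda>x. \<bar>f n x\<bar> * \<bar>f (n + 2) x\<bar> * v x)"
  proof (intro integral_le integrable_continuous_real continuous_intros f_cont v_cont)
    fix x assume "x \<in> {0..L}"
    then have "- (f n x * f (n + 2) x) * v x \<le> \<bar>f n x * f (n + 2) x\<bar> * v x"
      using v_nonneg by (intro mult_right_mono) auto
    then show "- (f n x * f (n + 2) x * v x) \<le> \<bar>f n x\<bar> * \<bar>f (n + 2) x\<bar> * v x" by (simp add: abs_mult)
  qed
  also have "\<dots> \<le> nm n * nm (n + 2)" by (rule abs_product_integral)
  finally show ?thesis .
qed

text \<open>For odd order by Rolle's theorem, as the preceding even derivative vanishes at both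
  ends.\<close>

lemma f_has_zero: "\<exists>z\<in>{0..L}. f n z = 0"
proof (cases "even n")
  case True
  then show ?thesis using f_bdry L_pos by (intro bexI[where x=0]) auto
next
  case False
  then obtain m where m: "n = Suc m" "even m" by (cases n) auto
  have "\<exists>z. 0 < z \<and> z < L \<and> (\<lambda>h. h * (v z * f n z)) = (\<lambda>_. 0)"
  proof (rule Rolle_deriv[where f="f m" and f'="\<lambda>x h. h * (v x * f n x)", OF L_pos])
    show "f m 0 = f m L" using f_bdry m by simp
    show "continuous_on {0..L} (f m)" by (rule f_cont)
    show "(f m has_derivative (\<lambda>h. h * (v x * f n x))) (at x)" if "0 < x" "x < L" for x
      using f_deriv[of x m] that m(1) at_within_Icc_at[of 0 x L]
      by (simp add: has_vector_derivative_def)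
  qed
  then obtain z where z: "0 < z" "z < L" "(\<lambda>h. h * (v z * f n z)) = (\<lambda>_. 0)" by blast
  then have "1 * (v z * f n z) = 0" by metis
  then show ?thesis using v_pos[of z] z(1,2) by (intro bexI[where x=z]) auto
qed

text \<open>The fundamental theorem applied to the square of f n between a zero and x, then
  Cauchy-Schwarz. Starting from a zero avoids a mean value term, which would bring in the length of
  the curve.\<close>

lemma f_square_le: 
  assumes x: "x \<in> {0..L}"
  shows "(f n x)\<^sup>2 \<le> 2 * (nm n * nm (Suc n))"
proof -
  obtain z where z: "z \<in> {0..L}" "f n z = 0" using f_has_zero by blast
  let ?g = "\<lambda>x. f n x * (v x * f (Suc n) x) + (v x * f (Suc n) x) * f n x"
  \<comment> \<open>The zero may lie on either side of x.\<close>
  let ?a = "min x z" and ?b = "max x z"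
  have sub: "{?a..?b} \<subseteq> {0..L}" using x z by auto
  have "((\<lambda>x. f n x * f n x) has_vector_derivative ?g y) (at y within {?a..?b})" if "y \<in> {?a..?b}" for y
    using that sub by (intro has_vector_derivative_mult has_vector_derivative_within_subset[OF f_deriv sub]) auto
  then have "(?g has_integral f n ?b * f n ?b - f n ?a * f n ?a) {?a..?b}"
    by (intro fundamental_theorem_of_calculus) auto
  then have "\<bar>integral {?a..?b} ?g\<bar> = (f n x)\<^sup>2"
    using z(2) by (subst integral_unique) (auto simp: min_def max_def power2_eq_square)
  then have "(f n x)\<^sup>2 \<le> integral {?a..?b} (\<lambda>x. 2 * (\<bar>f n x\<bar> * \<bar>f (Suc n) x\<bar> * v x))"
  proof (elim subst)
    show "\<bar>integral {?a..?b} ?g\<bar> \<le> integral {?a..?b} (\<lambda>x. 2 * (\<bar>f n x\<bar> * \<bar>f (Suc n) x\<bar> * v x))"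
      unfolding real_norm_def[symmetric]
    proof (rule integral_norm_bound_integral)
      show "?g integrable_on {?a..?b}"
        by (intro integrable_continuous_real continuous_on_subset[OF _ sub] continuous_intros f_cont v_cont)
      show "(\<lambda>x. 2 * (norm (f n x) * norm (f (Suc n) x) * v x)) integrable_on {?a..?b}"
        by (intro integrable_continuous_real continuous_on_subset[OF _ sub] continuous_intros f_cont v_cont)
      fix y assume "y \<in> {?a..?b}"
      then have "v y \<ge> 0" using sub v_nonneg by blast
      have "?g y = 2 * (f n y * f (Suc n) y * v y)" by simp
      then show "norm (?g y) \<le> 2 * (norm (f n y) * norm (f (Suc n) y) * v y)"
        using \<open>v y \<ge> 0\<close> by (simp add: abs_mult)
    qed
  qed
  also have "\<dots> \<le> integral {0..L} (\<lambda>x. 2 * (\<bar>f n x\<bar> * \<bar>f (Suc n) x\<bar> * v x))"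
    using sub v_nonneg
    by (intro integral_subset_le integrable_continuous_real continuous_on_subset[OF _ sub] continuous_intros f_cont v_cont) auto
  also have "\<dots> \<le> 2 * (nm n * nm (Suc n))" using abs_product_integral[of n "Suc n"] by simp
  finally show ?thesis .
qed

lemma prod_list_abs_le:
  fixes B r :: real
  assumes "\<And>i. i \<in> set l \<Longrightarrow> \<bar>f i x\<bar> \<le> B * r ^ (2 * i + 1)" "B \<ge> 0" "r \<ge> 0"
  shows "\<bar>\<Prod>i\<leftarrow>l. f i x\<bar> \<le> B ^ length l * r ^ mu l"
  using assms(1)
proof (induction l)
  case (Cons i l)
  have "\<bar>f i x\<bar> * \<bar>\<Prod>i\<leftarrow>l. f i x\<bar> \<le> (B * r ^ (2 * i + 1)) * (B ^ length l * r ^ mu l)"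
    using Cons assms(2,3) by (intro mult_mono) auto
  then show ?case by (simp add: abs_mult power_add algebra_simps)
qed simp

lemma prod_list_map_remove1:
  fixes g :: "nat \<Rightarrow> real"
  shows "i \<in> set l \<Longrightarrow> (\<Prod>j\<leftarrow>l. g j) = g i * (\<Prod>j\<leftarrow>remove1 i l. g j)"
  by (induction l) auto

text \<open>
  Two factors of the product, one of them of maximal order, are estimated in \<open>L\<^sup>2\<close>, the others
  uniformly.
\<close>

lemma monomial_integral_le:
  assumes "even n" "mu l \<le> 2 * n + 7" "even (wt l + (n + 1))"
    and A: "A \<ge> 1" "nm 0 \<le> A" and r: "r \<ge> 1" "nm (n + 2) \<le> A * r ^ (2 * (n + 2))"
  shows "\<bar>integral {0..L} (\<lambda>x. f n x * (\<Prod>i\<leftarrow>l. f i x) * v x)\<bar> \<le> A\<^sup>2 * (2 * A) ^ length l * r ^ (4 * n + 6)"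
proof -
  let ?N = "n + 2"
  \<comment> \<open>Interpolation between the orders 0 and n + 2 with ratio r^2: every derivative
    costs a factor r^2.\<close>
  have nm_le: "nm j \<le> A * r ^ (2 * j)" if "j \<le> ?N" for j
    unfolding power_mult
    by (rule log_convex_interpolation[OF nm_nonneg nm_log_convex A(2) r(2)[unfolded power_mult] _ _ that])
      (use A r in auto)
  \<comment> \<open>The geometric mean of the orders j and j + 1 yields the exponent 2j + 1; the
    constant 2 replaces the square root of 2.\<close>
  have f_le: "\<bar>f j x\<bar> \<le> (2 * A) * r ^ (2 * j + 1)" if "j < ?N" "x \<in> {0..L}" for j x
  proof (rule power2_le_imp_le)
    have "(f j x)\<^sup>2 \<le> 2 * (nm j * nm (Suc j))" by (rule f_square_le[OF that(2)])
    also have "\<dots> \<le> 2 * ((A * r ^ (2 * j)) * (A * r ^ (2 * Suc j)))"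
      using nm_le[of j] nm_le[of "Suc j"] that A r nm_nonneg by (intro mult_left_mono mult_mono) auto
    also have "\<dots> = 2 * (A * r ^ (2 * j + 1))\<^sup>2"
      by (simp add: power2_eq_square algebra_simps)
    also have "\<dots> \<le> 4 * (A * r ^ (2 * j + 1))\<^sup>2" by simp
    also have "\<dots> = (2 * A * r ^ (2 * j + 1))\<^sup>2" by (simp add: power_mult_distrib)
    finally show "\<bar>f j x\<bar>\<^sup>2 \<le> (2 * A * r ^ (2 * j + 1))\<^sup>2" by simp
  qed (use A r in simp)
  \<comment> \<open>For even n the weight of l is odd, while the empty list has weight 0.\<close>
  have "l \<noteq> []" using assms(1,3) by auto
  define i where "i = Max (set l)"
  define l' where "l' = remove1 i l"
  have i: "i \<in> set l" "\<And>j. j \<in> set l \<Longrightarrow> j \<le> i" unfolding i_def using \<open>l \<noteq> []\<close> by auto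
  have mul: "mu l = 2 * i + 1 + mu l'" and wtl: "wt l = i + 1 + wt l'" and lenl: "length l = Suc (length l')"
    and prod: "(\<Prod>j\<leftarrow>l. f j x) = f i x * (\<Prod>j\<leftarrow>l'. f j x)" for x
    using i(1) sum_list_map_remove1[of i l "\<lambda>i. 2 * i + 1"] sum_list_map_remove1[of i l "\<lambda>i. i + 1"]
      prod_list_map_remove1[of i l "\<lambda>j. f j x"] length_pos_if_in_set[of i l]
    by (auto simp: mu_def wt_def l'_def length_remove1)
  \<comment> \<open>An entry j that remains satisfies j \<le> i, so (2j + 1) + (2i + 1) \<le> 2n + 7
    forces j < n + 2, and the uniform bound applies to it.\<close>
  have l': "j < ?N" if "j \<in> set l'" for j
    using mu_ge[OF that] i(2)[of j] that notin_set_remove1[of j l i] mul assms(2) unfolding l'_def by fastforce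
  \<comment> \<open>The size bound would allow i = n + 3, but only as the single factor. Its weight
    n + 4 has the wrong parity.\<close>
  have iN: "i \<le> ?N"
  proof (rule ccontr)
    assume "\<not> i \<le> ?N"
    then have "i = n + 3" "mu l' = 0" using mul assms(2) by auto
    then have "l' = []" by (cases l') auto
    then show False using wtl \<open>i = n + 3\<close> assms(1,3) by auto
  qed
  let ?C = "(2 * A) ^ length l' * r ^ mu l'"
  have "\<bar>integral {0..L} (\<lambda>x. f n x * (\<Prod>i\<leftarrow>l. f i x) * v x)\<bar> \<le> integral {0..L} (\<lambda>x. ?C * (\<bar>f n x\<bar> * \<bar>f i x\<bar> * v x))"
    unfolding real_norm_def[symmetric]
  proof (rule integral_norm_bound_integral)
    have "continuous_on {0..L} (\<lambda>x. \<Prod>i\<leftarrow>l. f i x)" for l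
      by (induction l) (auto intro!: continuous_intros f_cont)
    then show "(\<lambda>x. f n x * (\<Prod>i\<leftarrow>l. f i x) * v x) integrable_on {0..L}"
      by (intro integrable_continuous_real continuous_intros f_cont v_cont)
    show "(\<lambda>x. ?C * (norm (f n x) * norm (f i x) * v x)) integrable_on {0..L}"
      by (intro integrable_continuous_real continuous_intros f_cont v_cont)
    fix x assume x: "x \<in> {0..L}"
    have "\<bar>\<Prod>j\<leftarrow>l'. f j x\<bar> \<le> ?C"
      using A r f_le l' x by (intro prod_list_abs_le) auto
    then have "\<bar>\<Prod>j\<leftarrow>l'. f j x\<bar> * (\<bar>f n x\<bar> * \<bar>f i x\<bar> * v x) \<le> ?C * (\<bar>f n x\<bar> * \<bar>f i x\<bar> * v x)"
      using v_nonneg[OF x] by (intro mult_right_mono) auto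
    then show "norm (f n x * (\<Prod>i\<leftarrow>l. f i x) * v x) \<le> ?C * (norm (f n x) * norm (f i x) * v x)"
      using v_nonneg[OF x] by (simp add: prod abs_mult algebra_simps)
  qed
  also have "\<dots> \<le> ?C * (nm n * nm i)"
    using abs_product_integral[of n i] A r by (simp add: mult_left_mono)
  also have "\<dots> \<le> ?C * ((A * r ^ (2 * n)) * (A * r ^ (2 * i)))"
    using nm_le[of n] nm_le[OF iN] A r nm_nonneg by (intro mult_left_mono mult_mono) auto
  also have "\<dots> = A\<^sup>2 * (2 * A) ^ length l' * r ^ (2 * n + 2 * i + mu l')"
    by (simp add: power_add power2_eq_square algebra_simps)
  \<comment> \<open>Removing i from l leaves the exponent 2n + 2i + mu l' = 2n + mu l - 1, which is
    at most 4n + 6.\<close>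
  also have "\<dots> \<le> A\<^sup>2 * (2 * A) ^ length l * r ^ (4 * n + 6)"
    using A r mul lenl assms(2) by (intro mult_mono power_increasing) (auto simp: algebra_simps)
  finally show ?thesis .
qed

end

section \<open>Energy estimates\<close>

text \<open>With K / c as the equilibrium, the excess of y over it multiplied by the integrating
  factor exp (c t) is nonincreasing.\<close>

lemma damped_bound:
  fixes y y' :: "real \<Rightarrow> real"
  assumes d: "\<And>t. t \<ge> a \<Longrightarrow> (y has_real_derivative y' t) (at t)"
    and le: "\<And>t. t \<ge> a \<Longrightarrow> y' t \<le> K - c * y t" and "c > 0" "t \<ge> a"
  shows "y t \<le> K / c + \<bar>y a - K / c\<bar>"
proof -
  let ?z = "\<lambda>t. (y t - K / c) * exp (c * t)"
  have "?z t \<le> ?z a"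
  proof (rule DERIV_nonpos_imp_nonincreasing[OF assms(4)])
    fix s assume "a \<le> s" "s \<le> t"
    then have "(?z has_real_derivative (y' s * exp (c * s) + (exp (c * s) * c) * (y s - K / c))) (at s)"
      using d by (auto intro!: derivative_eq_intros)
    moreover have "y' s * exp (c * s) + (exp (c * s) * c) * (y s - K / c) = exp (c * s) * (y' s - (K - c * y s))"
      using assms(3) by (simp add: field_simps)
    moreover have "exp (c * s) * (y' s - (K - c * y s)) \<le> 0"
      using le[OF \<open>a \<le> s\<close>] by (simp add: mult_nonneg_nonpos)
    ultimately show "\<exists>y. (?z has_real_derivative y) (at s) \<and> y \<le> 0" by auto
  qed
  also have "\<dots> \<le> \<bar>y a - K / c\<bar> * exp (c * a)" by (intro mult_right_mono) auto
  also have "\<dots> \<le> \<bar>y a - K / c\<bar> * exp (c * t)" using assms by (intro mult_left_mono) auto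
  finally show ?thesis by simp
qed

text \<open>A Young inequality with integer exponents: either C \<le> r^2 and the first term on the
  right dominates, or r^2 < C and the second one does.\<close>

lemma power_absorb:
  fixes C r :: real
  assumes "C \<ge> 0" "r \<ge> 0"
  shows "C * r ^ (2 * m) \<le> r ^ (2 * m + 2) + C ^ (m + 1)"
proof (cases "C \<le> r\<^sup>2")
  case True
  then have "C * r ^ (2 * m) \<le> r\<^sup>2 * r ^ (2 * m)" using assms by (intro mult_right_mono) auto
  also have "\<dots> = r ^ (2 * m + 2)" by (simp add: power_add power2_eq_square)
  also have "\<dots> \<le> r ^ (2 * m + 2) + C ^ (m + 1)" using assms by simp
  finally show ?thesis .
next
  case False
  then have "(r\<^sup>2) ^ m \<le> C ^ m" by (intro power_mono) auto
  then have "C * r ^ (2 * m) \<le> C ^ (m + 1)" using assms by (simp add: power_mult mult_left_mono)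
  also have "\<dots> \<le> r ^ (2 * m + 2) + C ^ (m + 1)" using assms by simp
  finally show ?thesis .
qed

context elastic_flow
begin

lemma jet: "t > 0 \<Longrightarrow> jet L (\<lambda>x. speed x t) (\<lambda>n x. \<kappa> n x t)"
  by unfold_locales
    (use L_pos smooth_xt_continuous_x[OF L_pos smooth_speed] speed_pos \<kappa>_boundary
      Ds_has_vector_derivative[OF smooth_\<kappa>] in auto)

definition intg :: "(real \<Rightarrow> real \<Rightarrow> real) \<Rightarrow> real \<Rightarrow> real" where
  "intg f t = integral {0..L} (\<lambda>x. f x t * speed x t)"

definition l2 :: "nat \<Rightarrow> real \<Rightarrow> real" where
  "l2 n t = jet.nm L (\<lambda>x. speed x t) (\<lambda>n x. \<kappa> n x t) n"

lemma l2_nonneg: "t > 0 \<Longrightarrow> l2 n t \<ge> 0"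
  unfolding l2_def by (rule jet.nm_nonneg[OF jet])

lemma l2_square: "t > 0 \<Longrightarrow> (l2 n t)\<^sup>2 = intg (\<lambda>x t. (\<kappa> n x t)\<^sup>2) t"
  unfolding l2_def intg_def by (rule jet.nm_square[OF jet])

lemma smooth_integrable: "smooth_xt L f \<Longrightarrow> t > 0 \<Longrightarrow> (\<lambda>x. f x t * speed x t) integrable_on {0..L}"
  by (intro integrable_continuous_real smooth_xt_continuous_x[OF L_pos] smooth_xt_mult smooth_speed)

lemma intg_add: "smooth_xt L f \<Longrightarrow> smooth_xt L g \<Longrightarrow> t > 0 \<Longrightarrow>
    intg (\<lambda>x t. f x t + g x t) t = intg f t + intg g t"
  unfolding intg_def distrib_right by (intro integral_add smooth_integrable)

lemma intg_cmult: "intg (\<lambda>x t. c * f x t) t = c * intg f t"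
  unfolding intg_def by (simp add: mult.assoc)

lemma intg_cong: "(\<And>x. x \<in> {0..L} \<Longrightarrow> f x t = g x t) \<Longrightarrow> intg f t = intg g t"
  unfolding intg_def by (intro integral_cong) simp

lemma intg_mono: "smooth_xt L f \<Longrightarrow> smooth_xt L g \<Longrightarrow> t > 0 \<Longrightarrow>
    (\<And>x. x \<in> {0..L} \<Longrightarrow> f x t \<le> g x t) \<Longrightarrow> intg f t \<le> intg g t"
  unfolding intg_def using speed_pos[of _ t]
  by (intro integral_le smooth_integrable mult_right_mono) (auto simp: less_imp_le)

lemma intg_nonneg: "smooth_xt L f \<Longrightarrow> t > 0 \<Longrightarrow>
    (\<And>x. x \<in> {0..L} \<Longrightarrow> 0 \<le> f x t) \<Longrightarrow> 0 \<le> intg f t"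
  unfolding intg_def using speed_pos[of _ t]
  by (intro integral_nonneg smooth_integrable mult_nonneg_nonneg) (auto simp: less_imp_le)

text \<open>The term with the curvature and \<open>V\<close> is the time derivative of the arc
  length element.\<close>

lemma intg_deriv:
  assumes "smooth_xt L f" "t > 0"
  shows "(intg f has_real_derivative intg (\<lambda>x t. DT f x t - \<kappa> 0 x t * V x t * f x t) t) (at t)"
proof -
  have "((\<lambda>t. integral {0..L} (\<lambda>x. f x t * speed x t)) has_vector_derivative
      integral {0..L} (\<lambda>x. DT (\<lambda>x t. f x t * speed x t) x t)) (at t)"
    by (rule integral_slice_has_derivative[OF L_pos smooth_xt_mult[OF assms(1) smooth_speed] _ assms(2)])
      (use L_pos in auto)
  moreover have "integral {0..L} (\<lambda>x. DT (\<lambda>x t. f x t * speed x t) x t)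
      = intg (\<lambda>x t. DT f x t - \<kappa> 0 x t * V x t * f x t) t"
    unfolding intg_def
  proof (rule integral_cong)
    fix x assume x: "x \<in> {0..L}"
    show "DT (\<lambda>x t. f x t * speed x t) x t = (DT f x t - \<kappa> 0 x t * V x t * f x t) * speed x t"
      using DT_bilinear[OF L_pos bounded_bilinear_mult assms(1) smooth_speed x assms(2)]
      by (simp add: DT_speed[OF x assms(2)] algebra_simps)
  qed
  ultimately show ?thesis
    unfolding intg_def has_real_derivative_iff_has_vector_derivative by simp
qed

lemma intg_by_parts:
  assumes "smooth_xt L f" "smooth_xt L g" "t > 0" "f 0 t * g 0 t = 0" "f L t * g L t = 0"
  shows "intg (\<lambda>x t. f x t * Ds g x t) t = - intg (\<lambda>x t. Ds f x t * g x t) t"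
proof -
  have "((\<lambda>x. f x t * (speed x t * Ds g x t) + (speed x t * Ds f x t) * g x t) has_integral
      f L t * g L t - f 0 t * g 0 t) {0..L}"
    using L_pos Ds_has_vector_derivative[OF assms(1) _ assms(3)] Ds_has_vector_derivative[OF assms(2) _ assms(3)]
    by (intro fundamental_theorem_of_calculus has_vector_derivative_mult) auto
  then have "intg (\<lambda>x t. f x t * Ds g x t + Ds f x t * g x t) t = 0"
    unfolding intg_def by (intro integral_unique) (simp add: algebra_simps assms)
  moreover have "intg (\<lambda>x t. f x t * Ds g x t + Ds f x t * g x t) t
      = intg (\<lambda>x t. f x t * Ds g x t) t + intg (\<lambda>x t. Ds f x t * g x t) t"
    by (intro intg_add smooth_xt_mult smooth_Ds assms)
  ultimately show ?thesis by simp
qed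

section \<open>Dissipation of the elastic energy\<close>

definition En :: "real \<Rightarrow> real" where
  "En = intg (\<lambda>x t. (\<kappa> 0 x t)\<^sup>2 + lam\<^sup>2)"

lemma smooth_\<kappa>_square: "smooth_xt L (\<lambda>x t. (\<kappa> n x t)\<^sup>2)"
  unfolding power2_eq_square by (intro smooth_xt_mult smooth_\<kappa>)

lemma smooth_V_square: "smooth_xt L (\<lambda>x t. (V x t)\<^sup>2)"
  unfolding power2_eq_square by (intro smooth_xt_mult smooth_V)

text \<open>The flow is the gradient flow of this energy. Two integrations by parts carry both
  derivatives from \<open>V\<close> over to the curvature; the boundary terms contain the curvature
  or \<open>V\<close> and vanish. The factor that then multiplies \<open>V\<close> is exactly
  \<open>- V\<close>.\<close>

lemma En_deriv:
  assumes "t > 0"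
  shows "(En has_real_derivative - intg (\<lambda>x t. (V x t)\<^sup>2) t) (at t)"
proof -
  let ?f = "\<lambda>x t. (\<kappa> 0 x t)\<^sup>2 + lam\<^sup>2"
  have D: "DT ?f x t = 2 * (\<kappa> 0 x t * DT (\<kappa> 0) x t)" if "x \<in> {0..L}" for x
    using DT_bilinear[OF L_pos bounded_bilinear_mult smooth_\<kappa> smooth_\<kappa> that assms, of 0 0]
      DT_add[OF L_pos smooth_\<kappa>_square smooth_xt_const that assms, of 0 "lam\<^sup>2"]
      DT_eqI[of "\<lambda>x t. lam\<^sup>2" x 0 t]
    by (simp add: power2_eq_square)
  \<comment> \<open>\<open>?h\<close> gathers the terms free of derivatives: twice curvature cubed
    times \<open>V\<close> from the evolution of the curvature, minus the product of curvature,
    \<open>V\<close> and energy density from the arc length element.\<close>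
  let ?g = "\<lambda>x t. \<kappa> 0 x t * Ds (Ds V) x t" and ?h = "\<lambda>x t. (\<kappa> 0 x t)^3 * V x t - lam\<^sup>2 * \<kappa> 0 x t * V x t"
  have sm: "smooth_xt L ?g" "smooth_xt L ?h"
    unfolding power3_eq_cube diff_conv_add_uminus
    by (intro smooth_xt_mult smooth_xt_add smooth_\<kappa> smooth_Ds smooth_V smooth_xt_const
        smooth_xt_linear[OF bounded_linear_minus[OF bounded_linear_ident]])+
  have sm2: "smooth_xt L (\<lambda>x t. \<kappa> 2 x t * V x t)" by (intro smooth_xt_mult smooth_\<kappa> smooth_V)
  have "intg ?g t = - intg (\<lambda>x t. Ds (\<kappa> 0) x t * Ds V x t) t"
    by (rule intg_by_parts[OF smooth_\<kappa> smooth_Ds[OF smooth_V] assms]) (use \<kappa>_0_boundary assms in auto)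
  also have "intg (\<lambda>x t. Ds (\<kappa> 0) x t * Ds V x t) t = - intg (\<lambda>x t. Ds (Ds (\<kappa> 0)) x t * V x t) t"
    by (rule intg_by_parts[OF smooth_Ds[OF smooth_\<kappa>] smooth_V assms]) (use V_boundary assms in auto)
  finally have g: "intg ?g t = intg (\<lambda>x t. \<kappa> 2 x t * V x t) t" by (simp add: numeral_2_eq_2)
  have "intg (\<lambda>x t. DT ?f x t - \<kappa> 0 x t * V x t * ?f x t) t = intg (\<lambda>x t. 2 * ?g x t + ?h x t) t"
  proof (rule intg_cong)
    fix x assume x: "x \<in> {0..L}"
    show "DT ?f x t - \<kappa> 0 x t * V x t * ?f x t = 2 * ?g x t + ?h x t"
      unfolding D[OF x] DT_\<kappa>_0[OF x assms] by (simp add: power2_eq_square power3_eq_cube algebra_simps)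
  qed
  also have "\<dots> = 2 * intg ?g t + intg ?h t"
    unfolding intg_add[OF smooth_xt_mult[OF smooth_xt_const sm(1)] sm(2) assms] intg_cmult ..
  also have "\<dots> = intg (\<lambda>x t. 2 * (\<kappa> 2 x t * V x t) + ?h x t) t"
    unfolding g intg_add[OF smooth_xt_mult[OF smooth_xt_const sm2] sm(2) assms] intg_cmult ..
  also have "\<dots> = intg (\<lambda>x t. (-1) * (V x t)\<^sup>2) t"
    by (rule intg_cong) (simp add: V_eq power2_eq_square power3_eq_cube algebra_simps)
  also have "\<dots> = - intg (\<lambda>x t. (V x t)\<^sup>2) t" by (subst intg_cmult) simp
  finally have e: "intg (\<lambda>x t. DT ?f x t - \<kappa> 0 x t * V x t * ?f x t) t = - intg (\<lambda>x t. (V x t)\<^sup>2) t" .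
  show ?thesis
    using intg_deriv[OF smooth_xt_add[OF smooth_\<kappa>_square smooth_xt_const] assms, of 0 "lam\<^sup>2"] unfolding e En_def .
qed

lemma En_antimono:
  assumes "0 < s" "s \<le> t"
  shows "En t \<le> En s"
proof (rule DERIV_nonpos_imp_nonincreasing[OF assms(2)])
  fix r assume "s \<le> r"
  then have "r > 0" using assms by simp
  then show "\<exists>y. (En has_real_derivative y) (at r) \<and> y \<le> 0"
    using En_deriv[OF \<open>r > 0\<close>] intg_nonneg[OF smooth_V_square \<open>r > 0\<close>]
    by (intro exI[where x="- intg (\<lambda>x t. (V x t)\<^sup>2) r"]) simp
qed

lemma En_ge:
  assumes "t > 0"
  shows "(l2 0 t)\<^sup>2 \<le> En t" "lam\<^sup>2 * intg (\<lambda>x t. 1) t \<le> En t"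
proof -
  show "(l2 0 t)\<^sup>2 \<le> En t"
    unfolding l2_square[OF assms] En_def
    by (intro intg_mono smooth_xt_add smooth_\<kappa>_square smooth_xt_const assms) auto
  have "intg (\<lambda>x t. lam\<^sup>2 * 1) t \<le> En t"
    unfolding En_def
    by (intro intg_mono smooth_xt_add smooth_\<kappa>_square smooth_xt_const assms) auto
  then show "lam\<^sup>2 * intg (\<lambda>x t. 1) t \<le> En t" by (simp only: intg_cmult)
qed

lemma dissipation_small:
  assumes "\<delta> > 0" "s > 0"
  shows "\<exists>t\<ge>s. intg (\<lambda>x t. (V x t)\<^sup>2) t \<le> \<delta>"
proof (rule ccontr)
  assume *: "\<not> ?thesis"
  have En0: "En t \<ge> 0" if "t > 0" for t
    using En_ge(1)[OF that] zero_le_power2 order_trans by blast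
  \<comment> \<open>A time span over which dissipation at rate \<delta> uses up
    \<open>En s + 1\<close>, more than the energy available.\<close>
  define M where "M = (En s + 1) / \<delta>"
  have M: "M > 0" unfolding M_def using En0[OF assms(2)] assms(1) by (intro divide_pos_pos) auto
  have "\<exists>\<xi>>s. \<xi> < s + M \<and> En (s + M) - En s = (s + M - s) * (- intg (\<lambda>x t. (V x t)\<^sup>2) \<xi>)"
    by (rule MVT2) (use M En_deriv assms in auto)
  then obtain \<xi> where \<xi>: "\<xi> > s" "En (s + M) - En s = M * (- intg (\<lambda>x t. (V x t)\<^sup>2) \<xi>)" by auto
  have "intg (\<lambda>x t. (V x t)\<^sup>2) \<xi> > \<delta>" using * \<xi>(1) by (meson less_imp_le not_le)
  then have "M * \<delta> \<le> M * intg (\<lambda>x t. (V x t)\<^sup>2) \<xi>" using M by simp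
  then have "En (s + M) \<le> En s - M * \<delta>" using \<xi>(2) by simp
  also have "\<dots> < 0" using assms by (simp add: M_def)
  finally show False using En0[of "s + M"] M assms by simp
qed

text \<open>The constant is fixed before t and r, so it serves for all times even when r is chosen
  depending on t. Monomials have such a bound, and the constants of finitely many of them add
  up.\<close>

lemma dpoly_intg_bound:
  assumes "dpoly (2 * n + 7) (n + 1) f" "even n" "A \<ge> 1"
  shows "\<exists>C\<ge>0. \<forall>t>0. \<forall>r\<ge>1. l2 0 t \<le> A \<longrightarrow> l2 (n + 2) t \<le> A * r ^ (2 * (n + 2)) \<longrightarrow>
    \<bar>intg (\<lambda>x t. \<kappa> n x t * f x t) t\<bar> \<le> C * r ^ (4 * n + 6)"
  using assms(1)
proof (induction rule: dpoly.induct)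
  case (mon l f c)
  have "\<bar>intg (\<lambda>x t. \<kappa> n x t * f x t) t\<bar> \<le> \<bar>c\<bar> * (A\<^sup>2 * (2 * A) ^ length l) * r ^ (4 * n + 6)"
    if "t > 0" "r \<ge> 1" "l2 0 t \<le> A" "l2 (n + 2) t \<le> A * r ^ (2 * (n + 2))" for t r
  proof -
    have "intg (\<lambda>x t. \<kappa> n x t * f x t) t = intg (\<lambda>x t. c * (\<kappa> n x t * mon l x t)) t"
      by (rule intg_cong) (use that mon in auto)
    then have "\<bar>intg (\<lambda>x t. \<kappa> n x t * f x t) t\<bar> = \<bar>c\<bar> * \<bar>intg (\<lambda>x t. \<kappa> n x t * mon l x t) t\<bar>"
      by (simp add: intg_cmult abs_mult)
    also have "\<dots> \<le> \<bar>c\<bar> * (A\<^sup>2 * (2 * A) ^ length l * r ^ (4 * n + 6))"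
      unfolding intg_def mon_def
      by (intro mult_left_mono jet.monomial_integral_le[OF jet])
        (use that mon assms in \<open>auto simp: l2_def[symmetric]\<close>)
    finally show ?thesis by (simp add: mult.assoc)
  qed
  then show ?case using assms(3) by (intro exI[where x="\<bar>c\<bar> * (A\<^sup>2 * (2 * A) ^ length l)"]) auto
next
  case (add f g h)
  obtain C1 where C1: "C1 \<ge> 0" "\<forall>t>0. \<forall>r\<ge>1. l2 0 t \<le> A \<longrightarrow> l2 (n + 2) t \<le> A * r ^ (2 * (n + 2)) \<longrightarrow>
      \<bar>intg (\<lambda>x t. \<kappa> n x t * f x t) t\<bar> \<le> C1 * r ^ (4 * n + 6)"
    using add.IH(1) by (elim exE conjE) (rule that)
  obtain C2 where C2: "C2 \<ge> 0" "\<forall>t>0. \<forall>r\<ge>1. l2 0 t \<le> A \<longrightarrow> l2 (n + 2) t \<le> A * r ^ (2 * (n + 2)) \<longrightarrow>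
      \<bar>intg (\<lambda>x t. \<kappa> n x t * g x t) t\<bar> \<le> C2 * r ^ (4 * n + 6)"
    using add.IH(2) by (elim exE conjE) (rule that)
  have "\<bar>intg (\<lambda>x t. \<kappa> n x t * h x t) t\<bar> \<le> (C1 + C2) * r ^ (4 * n + 6)"
    if *: "t > 0" "r \<ge> 1" "l2 0 t \<le> A" "l2 (n + 2) t \<le> A * r ^ (2 * (n + 2))" for t r
  proof -
    have "intg (\<lambda>x t. \<kappa> n x t * h x t) t = intg (\<lambda>x t. \<kappa> n x t * f x t + \<kappa> n x t * g x t) t"
      by (rule intg_cong) (use that add.hyps(3) in \<open>auto simp: algebra_simps\<close>)
    also have "\<dots> = intg (\<lambda>x t. \<kappa> n x t * f x t) t + intg (\<lambda>x t. \<kappa> n x t * g x t) t"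
      using add.hyps(1,2) that by (intro intg_add smooth_xt_mult smooth_\<kappa> dpoly_smooth)
    finally show ?thesis using C1(2)[rule_format, OF *] C2(2)[rule_format, OF *] by (simp add: distrib_right)
  qed
  then show ?case using C1(1) C2(1) by (intro exI[where x="C1 + C2"]) auto
qed

text \<open>Two integrations by parts turn the product of \<open>\<kappa> n\<close> and
  \<open>\<kappa> (n + 4)\<close> into the square of \<open>\<kappa> (n + 2)\<close>; the boundary
  terms contain the factors \<open>\<kappa> n\<close> and \<open>\<kappa> (n + 2)\<close>, both of
  even order. \<open>Q\<close> takes up everything else, including the change of the arc length
  element.\<close>

lemma l2_square_deriv:
  assumes "even n"
  obtains Q where "dpoly (2 * n + 7) (n + 1) Q"
    "\<And>t. t > 0 \<Longrightarrow> ((\<lambda>t. (l2 n t)\<^sup>2) has_real_derivative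
        - 4 * (l2 (n + 2) t)\<^sup>2 + intg (\<lambda>x t. \<kappa> n x t * Q x t) t) (at t)"
proof
  let ?P = "\<lambda>x t. DT (\<kappa> n) x t + 2 * \<kappa> (n + 4) x t"
  let ?Q = "\<lambda>x t. 2 * ?P x t + (-1) * (\<kappa> 0 x t * (V x t * \<kappa> n x t))"
  show Q: "dpoly (2 * n + 7) (n + 1) ?Q"
  proof (rule dpoly_plus[OF dpoly_cmult[OF dpoly_DT_\<kappa>] dpoly_cmult])
    show "dpoly (2 * n + 7) (n + 1) (\<lambda>x t. \<kappa> 0 x t * (V x t * \<kappa> n x t))"
      by (rule dpoly_mono[OF dpoly_mult[OF dpoly_\<kappa> dpoly_mult[OF dpoly_V dpoly_\<kappa>]]]) auto
  qed
  fix t :: real assume t: "t > 0"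
  have b: "\<kappa> i 0 t = 0" "\<kappa> i L t = 0" if "even i" for i
    using \<kappa>_boundary[OF that t] by auto
  have "intg (\<lambda>x t. \<kappa> n x t * Ds (\<kappa> (n + 3)) x t) t = - intg (\<lambda>x t. Ds (\<kappa> n) x t * \<kappa> (n + 3) x t) t"
    by (rule intg_by_parts[OF smooth_\<kappa> smooth_\<kappa> t]) (use b[of n] b[of "n + 2"] assms in auto)
  also have "intg (\<lambda>x t. Ds (\<kappa> n) x t * \<kappa> (n + 3) x t) t = intg (\<lambda>x t. \<kappa> (n + 1) x t * Ds (\<kappa> (n + 2)) x t) t"
    by (simp add: eval_nat_numeral)
  also have "\<dots> = - intg (\<lambda>x t. Ds (\<kappa> (n + 1)) x t * \<kappa> (n + 2) x t) t"
    by (rule intg_by_parts[OF smooth_\<kappa> smooth_\<kappa> t]) (use b[of n] b[of "n + 2"] assms in auto)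
  also have "intg (\<lambda>x t. Ds (\<kappa> (n + 1)) x t * \<kappa> (n + 2) x t) t = (l2 (n + 2) t)\<^sup>2"
    unfolding l2_square[OF t] by (simp add: power2_eq_square)
  finally have top: "intg (\<lambda>x t. \<kappa> n x t * \<kappa> (n + 4) x t) t = (l2 (n + 2) t)\<^sup>2"
    by (simp add: eval_nat_numeral)
  have "intg (\<lambda>x t. DT (\<lambda>x t. (\<kappa> n x t)\<^sup>2) x t - \<kappa> 0 x t * V x t * (\<kappa> n x t)\<^sup>2) t
      = intg (\<lambda>x t. (- 4) * (\<kappa> n x t * \<kappa> (n + 4) x t) + \<kappa> n x t * ?Q x t) t"
  proof (rule intg_cong)
    fix x assume x: "x \<in> {0..L}"
    show "DT (\<lambda>x t. (\<kappa> n x t)\<^sup>2) x t - \<kappa> 0 x t * V x t * (\<kappa> n x t)\<^sup>2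
        = (- 4) * (\<kappa> n x t * \<kappa> (n + 4) x t) + \<kappa> n x t * ?Q x t"
      using DT_bilinear[OF L_pos bounded_bilinear_mult smooth_\<kappa> smooth_\<kappa> x t, of n n]
      by (simp add: power2_eq_square algebra_simps)
  qed
  also have "\<dots> = - 4 * (l2 (n + 2) t)\<^sup>2 + intg (\<lambda>x t. \<kappa> n x t * ?Q x t) t"
    unfolding intg_add[OF smooth_xt_mult[OF smooth_xt_const smooth_xt_mult[OF smooth_\<kappa> smooth_\<kappa>]]
        smooth_xt_mult[OF smooth_\<kappa> dpoly_smooth[OF Q]] t] intg_cmult top ..
  finally have "(intg (\<lambda>x t. (\<kappa> n x t)\<^sup>2) has_real_derivative
      - 4 * (l2 (n + 2) t)\<^sup>2 + intg (\<lambda>x t. \<kappa> n x t * ?Q x t) t) (at t)"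
    using intg_deriv[OF smooth_\<kappa>_square t, of n] by simp
  then show "((\<lambda>t. (l2 n t)\<^sup>2) has_real_derivative
      - 4 * (l2 (n + 2) t)\<^sup>2 + intg (\<lambda>x t. \<kappa> n x t * ?Q x t) t) (at t)"
    by (rule has_field_derivative_transform_within_open[where S="{0<..}"]) (use t l2_square in auto)
qed

lemma l2_even_bound:
  assumes "even n"
  shows "\<exists>B. \<forall>t\<ge>1. l2 n t \<le> B"
proof -
  obtain Q where Q: "dpoly (2 * n + 7) (n + 1) Q"
    "\<And>t. t > 0 \<Longrightarrow> ((\<lambda>t. (l2 n t)\<^sup>2) has_real_derivative
        - 4 * (l2 (n + 2) t)\<^sup>2 + intg (\<lambda>x t. \<kappa> n x t * Q x t) t) (at t)"
    using l2_square_deriv[OF assms] by blast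
  let ?N = "n + 2"
  \<comment> \<open>A bound for the norm of order 0 by the energy at time 1, increased by 1 so that
    A is at least 1.\<close>
  define A where "A = 1 + sqrt (En 1)"
  have A: "A \<ge> 1" "l2 0 t \<le> A" if "t \<ge> 1" for t
  proof -
    have "0 \<le> En 1" using En_ge(1)[of 1] zero_le_power2 order_trans by (metis zero_less_one)
    then show "A \<ge> 1" by (simp add: A_def)
    have "(l2 0 t)\<^sup>2 \<le> En 1" using En_ge(1)[of t] En_antimono[of 1 t] that by linarith
    then show "l2 0 t \<le> A" using real_le_rsqrt by (fastforce simp: A_def)
  qed
  obtain C where C: "C \<ge> 0" "\<forall>t>0. \<forall>r\<ge>1. l2 0 t \<le> A \<longrightarrow> l2 (n + 2) t \<le> A * r ^ (2 * (n + 2)) \<longrightarrow>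
      \<bar>intg (\<lambda>x t. \<kappa> n x t * Q x t) t\<bar> \<le> C * r ^ (4 * n + 6)"
    using dpoly_intg_bound[OF Q(1) assms A(1)[OF order_refl]] by (elim exE conjE) (rule that)
  \<comment> \<open>The 4 stems from (1 + a)^2 \<le> 2 + 2 a^2 taken twice, the power of C from
    \<open>power_absorb\<close> with m = 2n + 3.\<close>
  define K where "K = 4 + C ^ (2 * n + 4)"
  have "- 4 * (l2 ?N t)\<^sup>2 + intg (\<lambda>x t. \<kappa> n x t * Q x t) t \<le> K - (1 / A\<^sup>2) * (l2 n t)\<^sup>2" if t: "t \<ge> 1" for t
  proof -
    have t0: "t > 0" using t by simp
    \<comment> \<open>Normalised so that r^(2n+4) is the norm of order n + 2 plus 1; the added 1
      ensures r \<ge> 1.\<close>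
    define r where "r = root (2 * ?N) (1 + l2 ?N t)"
    have r: "r ^ (2 * ?N) = 1 + l2 ?N t" "r \<ge> 1"
      using l2_nonneg[OF t0, of ?N] unfolding r_def by (intro real_root_pow_pos2, auto)
    have aN: "l2 ?N t \<le> A * r ^ (2 * ?N)"
    proof -
      have "1 * (1 + l2 ?N t) \<le> A * (1 + l2 ?N t)" using A(1)[OF t] l2_nonneg[OF t0, of ?N] by (intro mult_right_mono) auto
      then show ?thesis using r(1) by simp
    qed
    \<comment> \<open>Interpolation also bounds the n-th norm by a power of r, which lets part of
      the good term act as damping.\<close>
    have "l2 n t \<le> A * (r\<^sup>2) ^ n"
      unfolding l2_def
    proof (rule log_convex_interpolation[where N="?N"])
      show "jet.nm L (\<lambda>x. speed x t) (\<lambda>n x. \<kappa> n x t) ?N \<le> A * (r\<^sup>2) ^ ?N"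
        using aN by (simp only: l2_def power_mult)
    qed (use jet.nm_nonneg[OF jet[OF t0]] jet.nm_log_convex[OF jet[OF t0]] A[OF t] r in \<open>auto simp: l2_def\<close>)
    then have "(l2 n t)\<^sup>2 \<le> (A * (r\<^sup>2) ^ n)\<^sup>2" using l2_nonneg[OF t0] by (intro power_mono) auto
    also have "\<dots> = A\<^sup>2 * r ^ (4 * n)" by (simp add: power_mult_distrib power_mult[symmetric])
    also have "\<dots> \<le> A\<^sup>2 * r ^ (4 * n + 8)" using r(2) by (intro mult_left_mono power_increasing) auto
    finally have an: "(1 / A\<^sup>2) * (l2 n t)\<^sup>2 \<le> r ^ (4 * n + 8)"
      using A(1)[OF t] by (simp add: divide_le_eq mult.commute)
    have "r ^ (4 * n + 8) = (1 + l2 ?N t)\<^sup>2" unfolding r(1)[symmetric] power_mult[symmetric]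
      by (rule arg_cong[where f="power r"]) simp
    also have "\<dots> \<le> 2 + 2 * (l2 ?N t)\<^sup>2"
      using zero_le_power2[of "1 - l2 ?N t"] by (simp add: power2_eq_square algebra_simps)
    \<comment> \<open>The good term is worth two copies of r^(4n+8): one absorbs the error term, the
      other provides the damping.\<close>
    finally have top: "2 * r ^ (4 * n + 8) \<le> 4 + 4 * (l2 ?N t)\<^sup>2" by simp
    have "intg (\<lambda>x t. \<kappa> n x t * Q x t) t \<le> C * r ^ (2 * (2 * n + 3))"
      using C(2)[rule_format, OF t0 r(2) A(2)[OF t] aN] by (simp add: algebra_simps)
    also have "\<dots> \<le> r ^ (4 * n + 8) + C ^ (2 * n + 4)"
      using power_absorb[OF C(1), of r "2 * n + 3"] r(2) by (simp add: algebra_simps)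
    finally show ?thesis using an top unfolding K_def by linarith
  qed
  from damped_bound[of 1 "\<lambda>t. (l2 n t)\<^sup>2", OF _ this] Q(2) A(1)[of 1]
  have B: "(l2 n t)\<^sup>2 \<le> K / (1 / A\<^sup>2) + \<bar>(l2 n 1)\<^sup>2 - K / (1 / A\<^sup>2)\<bar>" (is "_ \<le> ?B") if "t \<ge> 1" for t
    using that by simp
  have "l2 n t \<le> sqrt ?B" if "t \<ge> 1" for t using B[OF that] by (rule real_le_rsqrt)
  then show ?thesis by blast
qed

text \<open>An odd order lies between two even ones, and log-convexity bounds it by them.\<close>

lemma l2_bound: "\<exists>B. \<forall>t\<ge>1. l2 n t \<le> B"
proof (cases "even n")
  case True
  then show ?thesis by (rule l2_even_bound)
next
  case False
  then obtain m where m: "n = m + 1" "even m" by (metis oddE even_mult_iff even_numeral)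
  obtain B1 B2 where B: "\<And>t. t \<ge> 1 \<Longrightarrow> l2 m t \<le> B1" "\<And>t. t \<ge> 1 \<Longrightarrow> l2 (m + 2) t \<le> B2"
    using l2_even_bound[OF m(2)] l2_even_bound[of "m + 2"] m(2) by auto
  have "l2 n t \<le> sqrt (B1 * B2)" if "t \<ge> 1" for t
  proof (rule real_le_rsqrt)
    have t: "t > 0" using that by simp
    have "(l2 n t)\<^sup>2 \<le> l2 m t * l2 (m + 2) t" unfolding l2_def m(1) by (rule jet.nm_log_convex[OF jet[OF t]])
    also have "\<dots> \<le> B1 * B2"
      using B[OF that] l2_nonneg[OF t, of m] l2_nonneg[OF t, of "m + 2"] by (intro mult_mono) linarith+
    finally show "(l2 n t)\<^sup>2 \<le> B1 * B2" .
  qed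
  then show ?thesis by blast
qed

lemma \<kappa>_bound: "\<exists>B. \<forall>t\<ge>1. \<forall>x\<in>{0..L}. \<bar>\<kappa> n x t\<bar> \<le> B"
proof -
  obtain B1 B2 where B: "\<And>t. t \<ge> 1 \<Longrightarrow> l2 n t \<le> B1" "\<And>t. t \<ge> 1 \<Longrightarrow> l2 (Suc n) t \<le> B2"
    using l2_bound[of n] l2_bound[of "Suc n"] by auto
  have "\<bar>\<kappa> n x t\<bar> \<le> sqrt (2 * (B1 * B2))" if "t \<ge> 1" "x \<in> {0..L}" for t x
  proof (rule real_le_rsqrt)
    have t: "t > 0" using that by simp
    have "(\<kappa> n x t)\<^sup>2 \<le> 2 * (l2 n t * l2 (Suc n) t)"
      unfolding l2_def using jet.f_square_le[OF jet[OF t] that(2)] .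
    also have "\<dots> \<le> 2 * (B1 * B2)"
      using B[OF that(1)] l2_nonneg[OF t, of n] l2_nonneg[OF t, of "Suc n"]
      by (intro mult_left_mono mult_mono) linarith+
    finally show "\<bar>\<kappa> n x t\<bar>\<^sup>2 \<le> 2 * (B1 * B2)" by simp
  qed
  then show ?thesis by blast
qed

lemma dpoly_bound: "dpoly p w f \<Longrightarrow> \<exists>B. \<forall>t\<ge>1. \<forall>x\<in>{0..L}. \<bar>f x t\<bar> \<le> B"
proof (induction rule: dpoly.induct)
  case (mon l f c)
  have "\<exists>B. \<forall>t\<ge>1. \<forall>x\<in>{0..L}. \<bar>mon l x t\<bar> \<le> B"
  proof (induction l)
    case (Cons i l)
    obtain B1 where B1: "\<forall>t\<ge>1. \<forall>x\<in>{0..L}. \<bar>mon l x t\<bar> \<le> B1" using Cons.IH by blast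
    obtain B2 where B2: "\<forall>t\<ge>1. \<forall>x\<in>{0..L}. \<bar>\<kappa> i x t\<bar> \<le> B2" using \<kappa>_bound by blast
    have "\<bar>mon (i # l) x t\<bar> \<le> B2 * B1" if "t \<ge> 1" "x \<in> {0..L}" for x t
    proof -
      have "\<bar>\<kappa> i x t\<bar> * \<bar>mon l x t\<bar> \<le> B2 * B1"
        using B1[rule_format, OF that] B2[rule_format, OF that] by (intro mult_mono) linarith+
      then show ?thesis by (simp add: mon_def abs_mult)
    qed
    then show ?case by blast
  qed (auto simp: mon_def)
  then obtain B where B: "\<forall>t\<ge>1. \<forall>x\<in>{0..L}. \<bar>mon l x t\<bar> \<le> B" by blast
  have "\<bar>f x t\<bar> \<le> \<bar>c\<bar> * B" if "t \<ge> 1" "x \<in> {0..L}" for x t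
    using mon(3)[OF that(2), of t] mult_left_mono[OF B[rule_format, OF that], of "\<bar>c\<bar>"] that by (simp add: abs_mult)
  then show ?case by blast
next
  case (add f g h)
  obtain B1 where B1: "\<forall>t\<ge>1. \<forall>x\<in>{0..L}. \<bar>f x t\<bar> \<le> B1" using add.IH(1) by blast
  obtain B2 where B2: "\<forall>t\<ge>1. \<forall>x\<in>{0..L}. \<bar>g x t\<bar> \<le> B2" using add.IH(2) by blast
  have "\<bar>h x t\<bar> \<le> B1 + B2" if "t \<ge> 1" "x \<in> {0..L}" for x t
    using B1[rule_format, OF that] B2[rule_format, OF that] add.hyps(3)[OF that(2), of t] that by auto
  then show ?case by blast
qed

end

section \<open>Reparametrization by constant speed\<close>

text \<open>The inverse function rule within sets, so that it covers the end points of an interval.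
  Having a left inverse, \<phi> is injective; hence \<phi> z differs from \<phi> y for z different
  from y and the difference quotients of \<sigma> may be composed with \<phi>.\<close>

lemma inverse_has_derivative_within:
  fixes \<sigma> :: "real \<Rightarrow> real"
  assumes inv: "\<And>y. y \<in> T \<Longrightarrow> \<phi> y \<in> S" "\<And>y. y \<in> T \<Longrightarrow> \<sigma> (\<phi> y) = y"
    and cont: "continuous_on T \<phi>" and y: "y \<in> T"
    and d: "(\<sigma> has_real_derivative d) (at (\<phi> y) within S)" "d \<noteq> 0"
  shows "(\<phi> has_real_derivative inverse d) (at y within T)"
proof -
  have "((\<lambda>w. (\<sigma> w - \<sigma> (\<phi> y)) / (w - \<phi> y)) \<longlongrightarrow> d) (at (\<phi> y) within S)"
    using d(1) by (simp add: has_field_derivative_iff)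
  then have "((\<lambda>w. inverse ((\<sigma> w - \<sigma> (\<phi> y)) / (w - \<phi> y))) \<longlongrightarrow> inverse d) (at (\<phi> y) within S)"
    by (rule tendsto_inverse[OF _ d(2)])
  moreover have "filterlim \<phi> (at (\<phi> y) within S) (at y within T)"
    unfolding filterlim_at
  proof
    show "\<forall>\<^sub>F x in at y within T. \<phi> x \<in> S \<and> \<phi> x \<noteq> \<phi> y"
      using inv y by (auto simp: eventually_at_filter intro!: eventuallyI) metis
    show "(\<phi> \<longlongrightarrow> \<phi> y) (at y within T)" using cont y by (simp add: continuous_on_def)
  qed
  ultimately have "((\<lambda>z. inverse ((\<sigma> (\<phi> z) - \<sigma> (\<phi> y)) / (\<phi> z - \<phi> y))) \<longlongrightarrow> inverse d) (at y within T)"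
    by (rule filterlim_compose)
  then have "((\<lambda>z. (\<phi> z - \<phi> y) / (z - y)) \<longlongrightarrow> inverse d) (at y within T)"
    by (rule Lim_transform_within[where d=1]) (use inv y in \<open>auto simp: field_simps\<close>)
  then show ?thesis by (simp add: has_field_derivative_iff)
qed

lemma constant_speed_parameter:
  fixes v :: "real \<Rightarrow> real"
  assumes L: "L > 0" and cont: "continuous_on {0..L} v" and pos: "\<And>x. x \<in> {0..L} \<Longrightarrow> v x > 0"
  obtains \<phi> where "bij_betw \<phi> {0..L} {0..L}" "\<phi> 0 = 0" "\<phi> L = L"
    "\<And>x. x \<in> {0..L} \<Longrightarrow>
      (\<phi> has_real_derivative integral {0..L} v / L * inverse (v (\<phi> x))) (at x within {0..L})"
proof -
  let ?I = "{0..L}"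
  define \<alpha> where "\<alpha> = integral ?I v / L"
  \<comment> \<open>Arc length divided by the mean speed \<alpha>, so that \<sigma> maps the
    interval onto itself. The parameter \<phi> is its inverse.\<close>
  define \<sigma> where "\<sigma> x = integral {0..x} v / \<alpha>" for x
  have D: "((\<lambda>x. integral {0..x} v) has_real_derivative v x) (at x within ?I)" if "x \<in> ?I" for x
    using integral_has_real_derivative[OF cont that] .
  have mono0: "integral {0..x} v < integral {0..y} v" if "x \<in> ?I" "y \<in> ?I" "x < y" for x y
  proof (rule DERIV_pos_imp_increasing_open[OF that(3)])
    fix z assume "x < z" "z < y"
    then show "\<exists>d. ((\<lambda>x. integral {0..x} v) has_real_derivative d) (at z) \<and> 0 < d"
      using D[of z] pos[of z] that at_within_Icc_at[of 0 z L] by auto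
  next
    show "continuous_on {x..y} (\<lambda>x. integral {0..x} v)"
      using DERIV_continuous_on[OF D] by (rule continuous_on_subset) (use that in auto)
  qed
  have "\<alpha> > 0" unfolding \<alpha>_def using mono0[of 0 L] L by simp
  have D\<sigma>: "(\<sigma> has_real_derivative v x / \<alpha>) (at x within ?I)" if "x \<in> ?I" for x
    unfolding \<sigma>_def using DERIV_cdivide[OF D[OF that]] .
  have mono: "\<sigma> x < \<sigma> y" if "x \<in> ?I" "y \<in> ?I" "x < y" for x y
    using mono0[OF that] \<open>\<alpha> > 0\<close> by (simp add: \<sigma>_def divide_strict_right_mono)
  have mono_le: "\<sigma> x \<le> \<sigma> y" if "x \<in> ?I" "y \<in> ?I" "x \<le> y" for x y
    using mono[OF that(1,2)] that(3) by (cases "x = y") simp_all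
  have \<sigma>0: "\<sigma> 0 = 0" "\<sigma> L = L" using \<open>\<alpha> > 0\<close> L by (auto simp: \<sigma>_def \<alpha>_def)
  have c\<sigma>: "continuous_on ?I \<sigma>" using DERIV_continuous_on[OF D\<sigma>] .
  have inj: "inj_on \<sigma> ?I" using mono by (intro linorder_inj_onI') (metis less_irrefl)
  have img: "\<sigma> ` ?I = ?I"
  proof
    show "\<sigma> ` ?I \<subseteq> ?I"
    proof
      fix y assume "y \<in> \<sigma> ` ?I"
      then obtain x where x: "x \<in> ?I" "y = \<sigma> x" by auto
      have "\<sigma> 0 \<le> \<sigma> x" "\<sigma> x \<le> \<sigma> L"
        using mono_le[of 0 x] mono_le[of x L] x L by simp_all
      then show "y \<in> ?I" using \<sigma>0 x by simp
    qed
    show "?I \<subseteq> \<sigma> ` ?I"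
    proof
      fix y assume "y \<in> ?I"
      then show "y \<in> \<sigma> ` ?I" using IVT'[of \<sigma> 0 y L] \<sigma>0 L c\<sigma> by force
    qed
  qed
  define \<phi> where "\<phi> = the_inv_into ?I \<sigma>"
  have \<phi>I: "\<phi> y \<in> ?I" if "y \<in> ?I" for y
    unfolding \<phi>_def by (rule the_inv_into_into[OF inj _ order_refl]) (use img that in simp)
  have \<sigma>\<phi>: "\<sigma> (\<phi> y) = y" if "y \<in> ?I" for y
    unfolding \<phi>_def by (rule f_the_inv_into_f[OF inj]) (use img that in simp)
  have c\<phi>: "continuous_on ?I \<phi>"
    using continuous_on_inv_into[OF c\<sigma> _ inj] img by (simp add: \<phi>_def)
  show ?thesis
  proof
    show "bij_betw \<phi> ?I ?I"
      using bij_betw_the_inv_into[of \<sigma> ?I ?I] inj img by (simp add: bij_betw_def \<phi>_def)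
    show "\<phi> 0 = 0" "\<phi> L = L"
      using the_inv_into_f_f[OF inj, of 0] the_inv_into_f_f[OF inj, of L] \<sigma>0 L by (auto simp: \<phi>_def)
    show "(\<phi> has_real_derivative integral ?I v / L * inverse (v (\<phi> x))) (at x within ?I)" if "x \<in> ?I" for x
    proof (rule DERIV_cong)
      show "(\<phi> has_real_derivative inverse (v (\<phi> x) / \<alpha>)) (at x within ?I)"
        using \<open>\<alpha> > 0\<close> pos[OF \<phi>I[OF that]]
        by (intro inverse_has_derivative_within[OF \<phi>I \<sigma>\<phi> c\<phi> that D\<sigma>[OF \<phi>I[OF that]]]) auto
    qed (simp add: \<alpha>_def inverse_eq_divide)
  qed
qed

text \<open>Bootstrapping: if \<phi> is of class C^k, so is the right-hand side of its differential
  equation, and \<phi> is of class C^(k+1).\<close>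

lemma smooth_on_autonomous_ode:
  fixes \<phi> w :: "real \<Rightarrow> real"
  assumes \<phi>: "\<And>x. x \<in> {0..L} \<Longrightarrow> \<phi> x \<in> {0..L}"
    and d: "\<And>x. x \<in> {0..L} \<Longrightarrow> (\<phi> has_real_derivative c * inverse (G 0 (\<phi> x))) (at x within {0..L})"
    and G: "\<And>n x. x \<in> {0..L} \<Longrightarrow> (G n has_vector_derivative G (Suc n) x) (at x within {0..L})"
    and nz: "\<And>x. x \<in> {0..L} \<Longrightarrow> G 0 x \<noteq> (0::real)"
  shows "smooth_on {0..L} \<phi>"
proof -
  have "Ck_on k {0..L} \<phi>" for k
  proof (induction k)
    case 0
    show ?case using DERIV_continuous_on[OF d] by simp
  next
    case (Suc k)
    have "Ck_on k {0..L} (\<lambda>x. G 0 (\<phi> x))"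
      by (rule Ck_on_compose_real[where T="{0..L}" and G=G, OF \<phi> G Suc])
    then have "Ck_on k {0..L} (\<lambda>x. inverse (G 0 (\<phi> x)))"
      by (rule Ck_on_inverse[rotated]) (use nz \<phi> in auto)
    then have "Ck_on k {0..L} (\<lambda>x. c * inverse (G 0 (\<phi> x)) * v)" for v
      by (intro Ck_on_mult Ck_on_const)
    then show ?case unfolding Ck_on.simps using d
      by (intro exI[where x="\<lambda>x v. c * inverse (G 0 (\<phi> x)) * v"]) (auto simp: has_field_derivative_def)
  qed
  then show ?thesis by (simp add: smooth_on_def)
qed

section \<open>Constant speed curves\<close>

text \<open>The determinant of first and second derivative over the cubed speed, at one point, with
  \<open>g n\<close> for the n-th derivative there. As an algebraic expression in finitely many
  numbers it passes to limits.\<close>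

definition const_speed_curvature :: "real \<Rightarrow> (nat \<Rightarrow> real^2) \<Rightarrow> real" where
  "const_speed_curvature \<alpha> g = (g 2 \<bullet> rot (g 1)) / \<alpha>^3"

text \<open>The normal speed in the same terms. Differentiating the determinant twice leaves only
  two products, since a vector is orthogonal to its own rotation; the two arc length derivatives
  raise the power of \<alpha> from 3 to 5.\<close>

definition const_speed_elastic :: "real \<Rightarrow> real \<Rightarrow> (nat \<Rightarrow> real^2) \<Rightarrow> real" where
  "const_speed_elastic lam \<alpha> g =
     - 2 * ((g 4 \<bullet> rot (g 1) + g 3 \<bullet> rot (g 2)) / \<alpha>^5)
     - (const_speed_curvature \<alpha> g)^3 + lam\<^sup>2 * const_speed_curvature \<alpha> g"

text \<open>At constant speed each arc length derivative is the parameter derivative divided by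
  \<alpha>, so no derivatives of the speed enter.\<close>

lemma const_speed_curve:
  fixes G :: "nat \<Rightarrow> real \<Rightarrow> real^2"
  assumes L: "L > 0" and "\<alpha> > 0"
    and G: "\<And>n x. x \<in> {0..L} \<Longrightarrow> (G n has_vector_derivative G (Suc n) x) (at x within {0..L})"
    and speed: "\<And>x. x \<in> {0..L} \<Longrightarrow> norm (G 1 x) = \<alpha>" and x: "x \<in> {0..L}"
  shows "curvature L (G 0) x = const_speed_curvature \<alpha> (\<lambda>n. G n x)"
    and "elastic_speed lam L (G 0) x = const_speed_elastic lam \<alpha> (\<lambda>n. G n x)"
proof -
  have dxG: "dx L (G n) x = G (Suc n) x" if "x \<in> {0..L}" for n x
    by (rule dx_eqI[OF L that G[OF that]])
  have ds: "ds L (G 0) h x = d /\<^sub>R \<alpha>"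
    if "x \<in> {0..L}" "(h' has_vector_derivative d) (at x within {0..L})" "\<And>y. y \<in> {0..L} \<Longrightarrow> h y = h' y"
    for h h' :: "real \<Rightarrow> 'c::real_normed_vector" and d x
    using dx_cong[OF that(3) that(1)] dx_eqI[OF L that(1,2)] speed[OF that(1)] by (simp add: ds_def dxG[OF that(1)])
  have T: "ds L (G 0) (G 0) x = G 1 x /\<^sub>R \<alpha>" if "x \<in> {0..L}" for x
    using ds[OF that G[OF that, of 0]] by simp
  have TT: "ds L (G 0) (ds L (G 0) (G 0)) x = (G 2 x /\<^sub>R \<alpha>) /\<^sub>R \<alpha>" if "x \<in> {0..L}" for x
    by (rule ds[OF that _ T]) (use G[OF that, of 1] in \<open>auto intro!: derivative_eq_intros simp: numeral_2_eq_2\<close>)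
  have rot_scale: "rot (c *\<^sub>R u) = c *\<^sub>R rot u" for c u
    by (rule linear_scale[OF bounded_linear.linear[OF bounded_linear_rot]])
  have K: "curvature L (G 0) x = (G 2 x \<bullet> rot (G 1 x)) / \<alpha>^3" if "x \<in> {0..L}" for x
    unfolding curvature_def unit_normal_def TT[OF that] T[OF that] rot_scale
    by (simp add: power3_eq_cube field_simps)
  have D: "((\<lambda>x. G n x \<bullet> rot (G m x)) has_vector_derivative
      G n x \<bullet> rot (G (Suc m) x) + G (Suc n) x \<bullet> rot (G m x)) (at x within {0..L})" if "x \<in> {0..L}" for n m x
    by (intro bounded_bilinear.has_vector_derivative[OF bounded_bilinear_inner]
        bounded_linear.has_vector_derivative[OF bounded_linear_rot] G that)
  have Ks: "ds L (G 0) (curvature L (G 0)) x = (G 3 x \<bullet> rot (G 1 x)) / \<alpha>^4" if "x \<in> {0..L}" for x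
  proof -
    have "((\<lambda>x. (G 2 x \<bullet> rot (G 1 x)) / \<alpha>^3) has_vector_derivative (G 3 x \<bullet> rot (G 1 x)) / \<alpha>^3) (at x within {0..L})"
      using has_vector_derivative_divide[OF D[OF that, of 2 1]] by (simp add: eval_nat_numeral inner_rot)
    from ds[OF that this K] show ?thesis using \<open>\<alpha> > 0\<close> by (simp add: field_simps eval_nat_numeral)
  qed
  have Kss: "ds L (G 0) (ds L (G 0) (curvature L (G 0))) x
      = (G 4 x \<bullet> rot (G 1 x) + G 3 x \<bullet> rot (G 2 x)) / \<alpha>^5"
  proof -
    have "((\<lambda>x. (G 3 x \<bullet> rot (G 1 x)) / \<alpha>^4) has_vector_derivative
        (G 4 x \<bullet> rot (G 1 x) + G 3 x \<bullet> rot (G 2 x)) / \<alpha>^4) (at x within {0..L})"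
      using has_vector_derivative_divide[OF D[OF x, of 3 1]] by (simp add: eval_nat_numeral add.commute)
    from ds[OF x this Ks] show ?thesis using \<open>\<alpha> > 0\<close> by (simp add: field_simps eval_nat_numeral)
  qed
  show "curvature L (G 0) x = const_speed_curvature \<alpha> (\<lambda>n. G n x)"
    using K[OF x] by (simp add: const_speed_curvature_def)
  show "elastic_speed lam L (G 0) x = const_speed_elastic lam \<alpha> (\<lambda>n. G n x)"
    unfolding elastic_speed_def const_speed_elastic_def Kss K[OF x] const_speed_curvature_def ..
qed

lemma tendsto_const_speed_curvature:
  assumes "\<And>n. (\<lambda>i. g i n) \<longlonglongrightarrow> h n" "\<alpha> \<longlonglongrightarrow> \<beta>" "\<beta> \<noteq> 0"
  shows "(\<lambda>i. const_speed_curvature (\<alpha> i) (g i)) \<longlonglongrightarrow> const_speed_curvature \<beta> h"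
  unfolding const_speed_curvature_def
  by (intro tendsto_intros assms bounded_linear.tendsto[OF bounded_linear_rot]) (use assms(3) in simp)

lemma tendsto_const_speed_elastic:
  assumes "\<And>n. (\<lambda>i. g i n) \<longlonglongrightarrow> h n" "\<alpha> \<longlonglongrightarrow> \<beta>" "\<beta> \<noteq> 0"
  shows "(\<lambda>i. const_speed_elastic lam (\<alpha> i) (g i)) \<longlonglongrightarrow> const_speed_elastic lam \<beta> h"
  unfolding const_speed_elastic_def
  by (intro tendsto_intros tendsto_const_speed_curvature assms bounded_linear.tendsto[OF bounded_linear_rot])
    (use assms(3) in simp)

section \<open>Compactness in the smooth topology\<close>

lemma uniform_limit_derivative:
  fixes f :: "nat \<Rightarrow> real \<Rightarrow> 'a::banach"
  assumes d: "\<And>n x. x \<in> {0..L} \<Longrightarrow> (f n has_vector_derivative f' n x) (at x within {0..L})"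
    and f: "uniform_limit {0..L} f g sequentially" and f': "uniform_limit {0..L} f' g' sequentially"
    and x: "x \<in> {0..L}"
  shows "(g has_vector_derivative g' x) (at x within {0..L})"
proof -
  have "\<exists>h. \<forall>x\<in>{0..L}. (\<lambda>n. f n x) \<longlonglongrightarrow> h x \<and> (h has_derivative (\<lambda>s. s *\<^sub>R g' x)) (at x within {0..L})"
  proof (rule has_derivative_sequence)
    show "(f n has_derivative (\<lambda>s. s *\<^sub>R f' n x)) (at x within {0..L})" if "x \<in> {0..L}" for n x
      using d[OF that] by (simp add: has_vector_derivative_def)
    show "\<forall>\<^sub>F n in sequentially. \<forall>x\<in>{0..L}. \<forall>s. norm (s *\<^sub>R f' n x - s *\<^sub>R g' x) \<le> e * norm s" if "e > 0" for e
      using uniform_limitD[OF f' that]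
    proof eventually_elim
      case (elim n)
      show ?case
      proof (intro ballI allI)
        fix x s :: real assume "x \<in> {0..L}"
        then have "norm (f' n x - g' x) \<le> e" using elim by (auto simp: dist_norm less_imp_le)
        then show "norm (s *\<^sub>R f' n x - s *\<^sub>R g' x) \<le> e * norm s"
          using mult_left_mono[of "norm (f' n x - g' x)" e "\<bar>s\<bar>"]
          by (simp add: scaleR_diff_right[symmetric] mult.commute)
      qed
    qed
    show "(\<lambda>n. f n x) \<longlonglongrightarrow> g x" using tendsto_uniform_limitI[OF f x] .
  qed (use x in auto)
  then obtain h where h: "\<And>x. x \<in> {0..L} \<Longrightarrow> (\<lambda>n. f n x) \<longlonglongrightarrow> h x"
    "\<And>x. x \<in> {0..L} \<Longrightarrow> (h has_vector_derivative g' x) (at x within {0..L})"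
    unfolding has_vector_derivative_def by blast
  have "g y = h y" if "y \<in> {0..L}" for y
    using LIMSEQ_unique[OF tendsto_uniform_limitI[OF f that] h(1)[OF that]] .
  then show ?thesis using has_vector_derivative_transform[OF x _ h(2)[OF x], of g] by auto
qed

lemma uniform_limit_offset:
  assumes "uniform_limit S (\<lambda>i. f (i + m)) h sequentially"
  shows "uniform_limit S f h sequentially"
  unfolding uniform_limit_iff
proof (intro allI impI)
  fix e :: real assume "e > 0"
  then have "\<forall>\<^sub>F i in sequentially. \<forall>x\<in>S. dist (f (i + m) x) (h x) < e"
    using assms unfolding uniform_limit_iff by blast
  then show "\<forall>\<^sub>F i in sequentially. \<forall>x\<in>S. dist (f i x) (h x) < e"
    by (rule eventually_sequentially_seg[where P="\<lambda>i. \<forall>x\<in>S. dist (f i x) (h x) < e", THEN iffD1])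
qed

text \<open>A bound of order n + 1 makes the derivatives of order n equi-Lipschitz, so every order
  admits a convergent refinement; the diagonal sequence serves all orders at once.\<close>

lemma smooth_compactness:
  fixes G :: "nat \<Rightarrow> nat \<Rightarrow> real \<Rightarrow> 'a::{banach, heine_borel}"
  assumes d: "\<And>i n x. x \<in> {0..L} \<Longrightarrow> (G i n has_vector_derivative G i (Suc n) x) (at x within {0..L})"
    and B: "\<And>n. \<exists>B. \<forall>i. \<forall>x\<in>{0..L}. norm (G i n x) \<le> B"
  shows "\<exists>k g. strict_mono (k :: nat \<Rightarrow> nat) \<and>
    (\<forall>n. uniform_limit {0..L} (\<lambda>i. G (k i) n) (g n) sequentially) \<and>
    (\<forall>n. \<forall>x\<in>{0..L}. (g n has_vector_derivative g (Suc n) x) (at x within {0..L}))"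
proof -
  let ?P = "\<lambda>n s. \<exists>h. uniform_limit {0..L} (\<lambda>i. G (s i) n) h sequentially"
  interpret subseqs ?P
  proof
    fix n and s :: "nat \<Rightarrow> nat" assume "strict_mono s"
    obtain B0 where B0: "\<forall>i. \<forall>x\<in>{0..L}. norm (G i n x) \<le> B0" using B by blast
    obtain B1 where B1: "\<forall>i. \<forall>x\<in>{0..L}. norm (G i (Suc n) x) \<le> B1" using B by blast
    have lip: "norm (G i n x - G i n y) \<le> \<bar>B1\<bar> * norm (x - y)" if "x \<in> {0..L}" "y \<in> {0..L}" for i x y
    proof (rule differentiable_bound[where S="{0..L}" and f'="\<lambda>x h. h *\<^sub>R G i (Suc n) x"])
      show "onorm (\<lambda>h. h *\<^sub>R G i (Suc n) z) \<le> \<bar>B1\<bar>" if "z \<in> {0..L}" for z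
      proof (rule onorm_le)
        fix h :: real
        have "norm (G i (Suc n) z) \<le> \<bar>B1\<bar>" using B1[rule_format, OF that, of i] by linarith
        then show "norm (h *\<^sub>R G i (Suc n) z) \<le> \<bar>B1\<bar> * norm h"
          using mult_left_mono[of "norm (G i (Suc n) z)" "\<bar>B1\<bar>" "\<bar>h\<bar>"] by (simp add: mult.commute)
      qed
    qed (use d that in \<open>auto simp: has_vector_derivative_def\<close>)
    obtain h r where r: "strict_mono (r :: nat \<Rightarrow> nat)"
      and h: "\<And>e. 0 < e \<Longrightarrow> \<exists>N. \<forall>i x. i \<ge> N \<and> x \<in> {0..L} \<longrightarrow> norm (G (s (r i)) n x - h x) < e"
    proof (rule Arzela_Ascoli[of "{0..L}" "\<lambda>i. G (s i) n" B0])
      show "\<exists>d>0. \<forall>i y. y \<in> {0..L} \<and> norm (x - y) < d \<longrightarrow> norm (G (s i) n x - G (s i) n y) < e"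
        if "x \<in> {0..L}" "0 < e" for x e
      proof (intro exI[where x="e / (\<bar>B1\<bar> + 1)"] conjI allI impI)
        show "e / (\<bar>B1\<bar> + 1) > 0" using that by simp
        fix i y assume y: "y \<in> {0..L} \<and> norm (x - y) < e / (\<bar>B1\<bar> + 1)"
        have "norm (G (s i) n x - G (s i) n y) \<le> (\<bar>B1\<bar> + 1) * norm (x - y)"
          using lip[OF that(1), of y "s i"] y norm_ge_zero[of "x - y"] by (simp add: distrib_right)
        also have "\<dots> < e" using y by (simp add: less_divide_eq mult.commute)
        finally show "norm (G (s i) n x - G (s i) n y) < e" .
      qed
    qed (use B0 in auto)
    have "uniform_limit {0..L} (\<lambda>i. G ((s \<circ> r) i) n) h sequentially"
      unfolding uniform_limit_sequentially_iff dist_norm o_def using h by blast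
    then show "\<exists>r'. strict_mono r' \<and> ?P n (s \<circ> r')" using r by blast
  qed
  have "\<exists>h. uniform_limit {0..L} (\<lambda>i. G (diagseq i) n) h sequentially" for n
  proof -
    \<comment> \<open>The diagonal sequence is a subsequence of the refinement for order n from
      index n + 1 on, whence the shift, which \<open>uniform_limit_offset\<close> removes.\<close>
    have "?P n (diagseq \<circ> (+) (Suc n))"
    proof (rule diagseq_holds)
      fix r s :: "nat \<Rightarrow> nat" and n assume r: "strict_mono r" and "?P n s"
      then obtain h where "uniform_limit {0..L} (\<lambda>i. G (s i) n) h sequentially" by blast
      from filterlim_compose[OF this filterlim_subseq[OF r]]
      show "?P n (s \<circ> r)" by (auto simp: o_def)
    qed
    then obtain h where "uniform_limit {0..L} (\<lambda>i. G (diagseq (i + Suc n)) n) h sequentially"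
      by (auto simp: o_def add.commute)
    then have "uniform_limit {0..L} (\<lambda>i. G (diagseq i) n) h sequentially"
      by (rule uniform_limit_offset[where f="\<lambda>i. G (diagseq i) n"])
    then show ?thesis by blast
  qed
  then have "\<forall>n. \<exists>h. uniform_limit {0..L} (\<lambda>i. G (diagseq i) n) h sequentially" by blast
  from choice[OF this] obtain g where g: "\<And>n. uniform_limit {0..L} (\<lambda>i. G (diagseq i) n) (g n) sequentially"
    by blast
  show ?thesis
    by (intro exI[where x=diagseq] exI[where x=g] conjI allI ballI subseq_diagseq g
        uniform_limit_derivative[OF d g g])
qed

section \<open>Convergence to a stationary solution\<close>

context elastic_flow
begin

section \<open>Bounds for the length, the curves and the normal speed\<close>

definition len :: "real \<Rightarrow> real" where
  "len t = integral {0..L} (\<lambda>x. speed x t)"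

lemma len_eq: "len t = intg (\<lambda>x t. 1) t"
  by (simp add: len_def intg_def)

lemma len_le: "lam \<noteq> 0 \<Longrightarrow> t \<ge> 1 \<Longrightarrow> len t \<le> En 1 / lam\<^sup>2"
  using En_ge(2)[of t] En_antimono[of 1 t] by (simp add: len_eq[symmetric] le_divide_eq mult.commute)

text \<open>A chord is no longer than its arc. Since the end point at x = 0 is fixed, this confines
  the curves; for x = L it bounds the length from below.\<close>

lemma norm_\<gamma>_diff_le:
  assumes "t > 0" "x \<in> {0..L}"
  shows "norm (\<gamma> x t - \<gamma> 0 t) \<le> len t"
proof -
  have sub: "{0..x} \<subseteq> {0..L}" using assms by auto
  have d: "((\<lambda>y. \<gamma> y t) has_vector_derivative DX L \<gamma> y t) (at y within {0..x})" if "y \<in> {0..x}" for y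
    using DX[OF L_pos smooth _ assms(1)] that sub by (blast intro: has_vector_derivative_within_subset)
  have "\<gamma> x t - \<gamma> 0 t = integral {0..x} (\<lambda>y. DX L \<gamma> y t)"
    using fundamental_theorem_of_calculus[of 0 x, OF _ d] assms by (intro integral_unique[symmetric]) auto
  also have "norm \<dots> \<le> integral {0..x} (\<lambda>y. speed y t)"
    unfolding speed_def
    using smooth_xt_continuous_x[OF L_pos smooth_xt_DX[OF L_pos smooth] assms(1)]
    by (intro integral_norm_bound_integral integrable_continuous_real continuous_on_subset[OF _ sub]
        continuous_on_norm) auto
  also have "\<dots> \<le> len t"
    unfolding len_def using smooth_xt_continuous_x[OF L_pos smooth_speed assms(1)] sub
    by (intro integral_subset_le integrable_continuous_real continuous_on_subset[OF _ sub])
      (auto simp: speed_def)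
  finally show ?thesis .
qed

lemma len_ge: "t > 0 \<Longrightarrow> R > 0 \<Longrightarrow> R \<le> len t"
proof -
  assume t: "t > 0" "R > 0"
  have "norm (\<gamma> L t - \<gamma> 0 t) = R"
    using boundary[OF t(1)] t(2) by (simp add: boundary_conditions_def norm_eq_sqrt_inner inner_vec_def sum_2)
  then show ?thesis using norm_\<gamma>_diff_le[of t L] t L_pos by simp
qed

text \<open>By the Frenet formulas the frame coefficients change into f' - g \<kappa> and g' + f
  \<kappa>, so they remain differential polynomials in the curvature, for which uniform bounds are
  available.\<close>

lemma Ds_iter_\<gamma>:
  "\<exists>f g. dpoly (2 * n) n f \<and> dpoly (2 * n) n g \<and>
    (\<forall>x\<in>{0..L}. \<forall>t>0. (Ds ^^ Suc n) \<gamma> x t = f x t *\<^sub>R tang x t + g x t *\<^sub>R nrml x t)"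
proof (induction n)
  case 0
  show ?case
    by (intro exI[where x="\<lambda>x t. 1"] exI[where x="\<lambda>x t. 0"] conjI dpoly_const) (auto simp: tang_def)
next
  case (Suc n)
  then obtain f g where fg: "dpoly (2 * n) n f" "dpoly (2 * n) n g"
    and e: "\<And>x t. x \<in> {0..L} \<Longrightarrow> t > 0 \<Longrightarrow> (Ds ^^ Suc n) \<gamma> x t = f x t *\<^sub>R tang x t + g x t *\<^sub>R nrml x t"
    by blast
  note sm = dpoly_smooth[OF fg(1)] dpoly_smooth[OF fg(2)]
  let ?f = "\<lambda>x t. Ds f x t + (-1) * (g x t * \<kappa> 0 x t)" and ?g = "\<lambda>x t. Ds g x t + f x t * \<kappa> 0 x t"
  have "(Ds ^^ Suc (Suc n)) \<gamma> x t = ?f x t *\<^sub>R tang x t + ?g x t *\<^sub>R nrml x t" if "x \<in> {0..L}" "t > 0" for x t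
  proof -
    have "(Ds ^^ Suc (Suc n)) \<gamma> x t = Ds ((Ds ^^ Suc n) \<gamma>) x t" by simp
    also have "\<dots> = Ds (\<lambda>x t. f x t *\<^sub>R tang x t + g x t *\<^sub>R nrml x t) x t"
      by (rule Ds_cong) (use that e in auto)
    also have "\<dots> = Ds (\<lambda>x t. f x t *\<^sub>R tang x t) x t + Ds (\<lambda>x t. g x t *\<^sub>R nrml x t) x t"
      by (intro Ds_add smooth_xt_scaleR sm smooth_tang smooth_nrml that)
    also have "\<dots> = ?f x t *\<^sub>R tang x t + ?g x t *\<^sub>R nrml x t"
      unfolding Ds_scaleR[OF sm(1) smooth_tang that] Ds_scaleR[OF sm(2) smooth_nrml that]
        frenet_tang[OF that] frenet_nrml[OF that] by (simp add: algebra_simps)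
    finally show ?thesis .
  qed
  moreover have "dpoly (2 * Suc n) (Suc n) ?f" "dpoly (2 * Suc n) (Suc n) ?g"
    by (intro dpoly_plus dpoly_cmult dpoly_mono[OF dpoly_Ds[OF fg(1)]] dpoly_mono[OF dpoly_Ds[OF fg(2)]]
        dpoly_mono[OF dpoly_mult[OF fg(1) dpoly_\<kappa>]] dpoly_mono[OF dpoly_mult[OF fg(2) dpoly_\<kappa>]]; simp)+
  ultimately show ?case by blast
qed

lemma Ds_iter_\<gamma>_bound:
  assumes "lam \<noteq> 0"
  shows "\<exists>B. \<forall>t\<ge>1. \<forall>x\<in>{0..L}. norm ((Ds ^^ n) \<gamma> x t) \<le> B"
proof (cases n)
  case 0
  have "norm (\<gamma> x t) \<le> En 1 / lam\<^sup>2" if "t \<ge> 1" "x \<in> {0..L}" for t x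
  proof -
    have "\<gamma> 0 t = 0"
      using boundary[of t] that by (simp add: boundary_conditions_def vec_eq_iff forall_2)
    then show ?thesis using norm_\<gamma>_diff_le[of t x] len_le[OF assms, of t] that by simp
  qed
  then show ?thesis using 0 by (intro exI[where x="En 1 / lam\<^sup>2"]) simp
next
  case (Suc m)
  obtain f g where fg: "dpoly (2 * m) m f" "dpoly (2 * m) m g"
    and e: "\<And>x t. x \<in> {0..L} \<Longrightarrow> t > 0 \<Longrightarrow> (Ds ^^ n) \<gamma> x t = f x t *\<^sub>R tang x t + g x t *\<^sub>R nrml x t"
    using Ds_iter_\<gamma>[of m] Suc by blast
  obtain B1 where B1: "\<forall>t\<ge>1. \<forall>x\<in>{0..L}. \<bar>f x t\<bar> \<le> B1" using dpoly_bound[OF fg(1)] by blast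
  obtain B2 where B2: "\<forall>t\<ge>1. \<forall>x\<in>{0..L}. \<bar>g x t\<bar> \<le> B2" using dpoly_bound[OF fg(2)] by blast
  have "norm ((Ds ^^ n) \<gamma> x t) \<le> B1 + B2" if "t \<ge> 1" "x \<in> {0..L}" for x t
  proof -
    have t: "t > 0" using that by simp
    have "norm ((Ds ^^ n) \<gamma> x t) \<le> \<bar>f x t\<bar> + \<bar>g x t\<bar>"
      unfolding e[OF that(2) t]
      using norm_triangle_ineq[of "f x t *\<^sub>R tang x t" "g x t *\<^sub>R nrml x t"]
        norm_tang[OF that(2) t] norm_nrml[OF that(2) t] by simp
    then show ?thesis using B1[rule_format, OF that] B2[rule_format, OF that] by linarith
  qed
  then show ?thesis by blast
qed

text \<open>Smallness in L^2 becomes uniform smallness: \<open>V\<close> vanishes at x = 0, so its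
  square is the integral of its derivative, in which \<open>Ds V\<close> is bounded and
  Cauchy-Schwarz compares the rest with the dissipation and the length.\<close>

lemma V_square_le:
  assumes "t > 0" "x \<in> {0..L}" "\<And>y. y \<in> {0..L} \<Longrightarrow> \<bar>Ds V y t\<bar> \<le> B"
  shows "(V x t)\<^sup>2 \<le> 2 * B * (sqrt (intg (\<lambda>x t. (V x t)\<^sup>2) t) * sqrt (len t))"
proof -
  have sub: "{0..x} \<subseteq> {0..L}" using assms by auto
  have B: "B \<ge> 0" using assms(3)[OF assms(2)] by linarith
  have cV: "continuous_on {0..L} (\<lambda>x. V x t)" and cv: "continuous_on {0..L} (\<lambda>x. speed x t)"
    and cDV: "continuous_on {0..L} (\<lambda>x. Ds V x t)"
    by (intro smooth_xt_continuous_x[OF L_pos _ assms(1)] smooth_V smooth_speed smooth_Ds)+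
  have vpos: "speed y t \<ge> 0" for y by (simp add: speed_def)
  let ?g = "\<lambda>y. V y t * (speed y t * Ds V y t) + (speed y t * Ds V y t) * V y t"
  have "((\<lambda>y. V y t * V y t) has_vector_derivative ?g y) (at y within {0..x})" if "y \<in> {0..x}" for y
    using Ds_has_vector_derivative[OF smooth_V _ assms(1), of y] that sub
    by (intro has_vector_derivative_mult has_vector_derivative_within_subset[OF _ sub]) auto
  then have "(?g has_integral V x t * V x t - V 0 t * V 0 t) {0..x}"
    using assms(2) by (intro fundamental_theorem_of_calculus) auto
  then have "(V x t)\<^sup>2 = integral {0..x} ?g"
    using V_boundary[OF assms(1)] by (subst integral_unique) (auto simp: power2_eq_square)
  also have "\<dots> \<le> integral {0..x} (\<lambda>y. 2 * B * (\<bar>V y t\<bar> * 1 * speed y t))"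
  proof (rule integral_le)
    fix y assume "y \<in> {0..x}"
    then have "\<bar>Ds V y t\<bar> \<le> B" using sub assms(3) by blast
    then have "\<bar>V y t * Ds V y t\<bar> \<le> \<bar>V y t\<bar> * B"
      unfolding abs_mult by (rule mult_left_mono[OF _ abs_ge_zero])
    then have "(V y t * Ds V y t) * speed y t \<le> (\<bar>V y t\<bar> * B) * speed y t"
      using vpos[of y] by (rule mult_right_mono[OF order_trans[OF abs_ge_self]])
    then show "?g y \<le> 2 * B * (\<bar>V y t\<bar> * 1 * speed y t)" by (simp add: algebra_simps)
  qed (intro integrable_continuous_real continuous_on_subset[OF _ sub] continuous_intros cV cv cDV)+
  also have "\<dots> \<le> integral {0..L} (\<lambda>y. 2 * B * (\<bar>V y t\<bar> * 1 * speed y t))"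
    using sub vpos B
    by (intro integral_subset_le integrable_continuous_real continuous_on_subset[OF _ sub] continuous_intros cV cv) auto
  also have "\<dots> = 2 * B * integral {0..L} (\<lambda>y. \<bar>V y t\<bar> * 1 * speed y t)" by simp
  also have "\<dots> \<le> 2 * B * (sqrt (intg (\<lambda>x t. (V x t)\<^sup>2) t) * sqrt (len t))"
    using integral_Cauchy_Schwarz[of 0 L "\<lambda>y. \<bar>V y t\<bar>" "\<lambda>y. 1" "\<lambda>y. speed y t"] vpos B continuous_on_rabs[OF cV] cv
    by (intro mult_left_mono) (auto simp: intg_def len_def intro!: continuous_intros cV cv)
  finally show ?thesis .
qed

section \<open>Constant speed parametrization at a fixed time\<close>

lemma constant_speed_reparametrization:
  assumes "t > 0" "R > 0"
  obtains \<phi> where "reparametrization L \<phi>" "\<phi> 0 = 0" "\<phi> L = L" "\<And>x. x \<in> {0..L} \<Longrightarrow> \<phi> x \<in> {0..L}"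
    "\<And>x. x \<in> {0..L} \<Longrightarrow> (\<phi> has_real_derivative len t / L * inverse (speed (\<phi> x) t)) (at x within {0..L})"
proof -
  note c = smooth_xt_continuous_x[OF L_pos smooth_speed assms(1)]
  obtain \<phi> where \<phi>: "bij_betw \<phi> {0..L} {0..L}" "\<phi> 0 = 0" "\<phi> L = L"
    "\<And>x. x \<in> {0..L} \<Longrightarrow> (\<phi> has_real_derivative len t / L * inverse (speed (\<phi> x) t)) (at x within {0..L})"
    using constant_speed_parameter[OF L_pos c speed_pos[OF _ assms(1)]] unfolding len_def by blast
  have I: "\<phi> x \<in> {0..L}" if "x \<in> {0..L}" for x using bij_betwE[OF \<phi>(1)] that by blast
  have s: "smooth_xt L ((DX L ^^ n) speed)" for n
    by (induction n) (use smooth_speed smooth_xt_DX[OF L_pos] in auto)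
  have "smooth_on {0..L} \<phi>"
  proof (rule smooth_on_autonomous_ode[where G="\<lambda>n x. (DX L ^^ n) speed x t" and c="len t / L"])
    fix n x assume x: "x \<in> {0..L}"
    show "\<phi> x \<in> {0..L}" by (rule I[OF x])
    show "(\<phi> has_real_derivative len t / L * inverse ((DX L ^^ 0) speed (\<phi> x) t)) (at x within {0..L})"
      using \<phi>(4)[OF x] by simp
    show "((\<lambda>x. (DX L ^^ n) speed x t) has_vector_derivative (DX L ^^ Suc n) speed x t) (at x within {0..L})"
      using DX[OF L_pos s x assms(1)] by simp
    show "(DX L ^^ 0) speed x t \<noteq> 0" using speed_pos[OF x assms(1)] by simp
  qed
  moreover have "dx L \<phi> x > 0" if "x \<in> {0..L}" for x
  proof -
    have "dx L \<phi> x = len t / L * inverse (speed (\<phi> x) t)"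
      using dx_eqI[OF L_pos that] \<phi>(4)[OF that] by (simp add: has_real_derivative_iff_has_vector_derivative)
    then show ?thesis using len_ge[OF assms] assms(2) L_pos speed_pos[OF I[OF that] assms(1)] by simp
  qed
  ultimately show ?thesis using that[of \<phi>] \<phi> I by (simp add: reparametrization_def)
qed

lemma smooth_Ds_iter_\<gamma>: "smooth_xt L ((Ds ^^ n) \<gamma>)"
  by (induction n) (auto intro: smooth smooth_Ds)

context
  fixes t :: real and \<phi> :: "real \<Rightarrow> real"
  assumes t: "t > 0" and R: "R > 0"
    and \<phi>: "\<And>x. x \<in> {0..L} \<Longrightarrow> \<phi> x \<in> {0..L}"
      "\<And>x. x \<in> {0..L} \<Longrightarrow> (\<phi> has_real_derivative len t / L * inverse (speed (\<phi> x) t)) (at x within {0..L})"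
begin

text \<open>The speed from the chain rule cancels against the one in the derivative of \<phi>, so a
  parameter derivative is an arc length derivative times the constant
  \<open>len t / L\<close>.\<close>

lemma reparam_deriv:
  assumes "smooth_xt L f" "x \<in> {0..L}"
  shows "((\<lambda>x. f (\<phi> x) t) has_vector_derivative (len t / L) *\<^sub>R Ds f (\<phi> x) t) (at x within {0..L})"
proof -
  have "((\<lambda>y. f y t) \<circ> \<phi> has_vector_derivative
      (len t / L * inverse (speed (\<phi> x) t)) *\<^sub>R (speed (\<phi> x) t *\<^sub>R Ds f (\<phi> x) t)) (at x within {0..L})"
  proof (rule vector_diff_chain_within)
    show "((\<lambda>y. f y t) has_vector_derivative speed (\<phi> x) t *\<^sub>R Ds f (\<phi> x) t) (at (\<phi> x) within \<phi> ` {0..L})"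
      using \<phi>(1) by (intro has_vector_derivative_within_subset[OF Ds_has_vector_derivative[OF assms(1) \<phi>(1)[OF assms(2)] t]]) auto
  qed (use \<phi>(2)[OF assms(2)] in \<open>simp add: has_real_derivative_iff_has_vector_derivative\<close>)
  moreover have "(len t / L * inverse (speed (\<phi> x) t)) *\<^sub>R (speed (\<phi> x) t *\<^sub>R Ds f (\<phi> x) t) = (len t / L) *\<^sub>R Ds f (\<phi> x) t"
    using speed_pos[OF \<phi>(1)[OF assms(2)] t] by simp
  ultimately show ?thesis by (simp only: o_def)
qed

lemma reparam_derivs:
  assumes "x \<in> {0..L}"
  shows "((\<lambda>x. (len t / L) ^ n *\<^sub>R (Ds ^^ n) \<gamma> (\<phi> x) t) has_vector_derivative
    (len t / L) ^ Suc n *\<^sub>R (Ds ^^ Suc n) \<gamma> (\<phi> x) t) (at x within {0..L})"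
  using bounded_linear.has_vector_derivative[OF bounded_linear_scaleR_right reparam_deriv[OF smooth_Ds_iter_\<gamma> assms], of "(len t / L) ^ n" n]
  by (simp add: mult.commute)

abbreviation curve :: "real \<Rightarrow> real^2" where
  "curve \<equiv> \<lambda>x. \<gamma> (\<phi> x) t"

lemma reparam_speed: "x \<in> {0..L} \<Longrightarrow> norm (dx L curve x) = len t / L"
  using dx_eqI[OF L_pos _ reparam_deriv[OF smooth]] norm_tang[OF \<phi>(1) t] len_ge[OF t R] R L_pos
  by (simp add: tang_def)

text \<open>Arc length derivatives are geometric: the factor \<open>len t / L\<close> of the
  derivative is also the speed of the new curve and cancels.\<close>

lemma reparam_ds:
  assumes "smooth_xt L f" "x \<in> {0..L}" "\<And>y. y \<in> {0..L} \<Longrightarrow> h y = f (\<phi> y) t"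
  shows "ds L curve h x = Ds f (\<phi> x) t"
proof -
  have "dx L h x = (len t / L) *\<^sub>R Ds f (\<phi> x) t"
    using dx_cong[OF assms(3,2)] dx_eqI[OF L_pos assms(2) reparam_deriv[OF assms(1,2)]] by simp
  moreover have "len t > 0" "L \<noteq> 0" using len_ge[OF t R] R L_pos by simp_all
  ultimately show ?thesis by (simp add: ds_def reparam_speed[OF assms(2)])
qed

lemma reparam_curvature: "x \<in> {0..L} \<Longrightarrow> curvature L curve x = \<kappa> 0 (\<phi> x) t"
proof -
  have T: "ds L curve curve x = tang (\<phi> x) t" if "x \<in> {0..L}" for x
    using reparam_ds[OF smooth that] by (simp add: tang_def)
  assume x: "x \<in> {0..L}"
  have "ds L curve (ds L curve curve) x = Ds tang (\<phi> x) t"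
    by (rule reparam_ds[OF smooth_tang x T])
  then show ?thesis
    by (simp add: curvature_def unit_normal_def \<kappa>_0_eq nrml_def T[OF x])
qed

lemma reparam_elastic_speed: "x \<in> {0..L} \<Longrightarrow> elastic_speed lam L curve x = V (\<phi> x) t"
proof -
  have 1: "ds L curve (curvature L curve) x = \<kappa> 1 (\<phi> x) t" if "x \<in> {0..L}" for x
    using reparam_ds[OF smooth_\<kappa> that reparam_curvature] by simp
  assume x: "x \<in> {0..L}"
  have "ds L curve (ds L curve (curvature L curve)) x = Ds (\<kappa> 1) (\<phi> x) t"
    by (rule reparam_ds[OF smooth_\<kappa> x 1])
  then show ?thesis
    unfolding elastic_speed_def V_eq reparam_curvature[OF x] by (simp add: numeral_2_eq_2)
qed

end

section \<open>Passage to the limit\<close>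

lemma subconvergence:
  assumes "lam \<noteq> 0" "R > 0"
  shows "\<exists>(t :: nat \<Rightarrow> real) (\<phi> :: nat \<Rightarrow> real \<Rightarrow> real) (\<gamma>_hat :: real \<Rightarrow> real^2).
           (\<forall>i. t i \<ge> 0) \<and> filterlim t at_top sequentially \<and>
           (\<forall>i. reparametrization L (\<phi> i)) \<and>
           smoothly_converges L (\<lambda>i x. \<gamma> (\<phi> i x) (t i)) \<gamma>_hat \<and>
           stationary_solution lam L R \<gamma>_hat"
proof -
  \<comment> \<open>The lower bound sends the times to infinity and keeps them at least 1, the range
    of the uniform estimates.\<close>
  have "\<forall>i. \<exists>t\<ge>real (Suc i). intg (\<lambda>x t. (V x t)\<^sup>2) t \<le> inverse (real (Suc i))"
    by (intro allI dissipation_small) auto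
  from choice[OF this] obtain t where t: "\<And>i. t i \<ge> real (Suc i)"
    "\<And>i. intg (\<lambda>x t. (V x t)\<^sup>2) (t i) \<le> inverse (real (Suc i))" by blast
  have t1: "t i \<ge> 1" for i using t(1)[of i] by simp
  have t0: "t i > 0" for i using t1[of i] by simp
  have "\<forall>i. \<exists>\<phi>. reparametrization L \<phi> \<and> \<phi> 0 = 0 \<and> \<phi> L = L \<and> (\<forall>x\<in>{0..L}. \<phi> x \<in> {0..L} \<and>
      (\<phi> has_real_derivative len (t i) / L * inverse (speed (\<phi> x) (t i))) (at x within {0..L}))"
  proof
    fix i
    show "\<exists>\<phi>. reparametrization L \<phi> \<and> \<phi> 0 = 0 \<and> \<phi> L = L \<and> (\<forall>x\<in>{0..L}. \<phi> x \<in> {0..L} \<and>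
      (\<phi> has_real_derivative len (t i) / L * inverse (speed (\<phi> x) (t i))) (at x within {0..L}))"
      by (rule constant_speed_reparametrization[OF t0[of i] assms(2)]) (intro exI conjI ballI, assumption+)
  qed
  from choice[OF this] obtain \<phi> where "\<forall>i. reparametrization L (\<phi> i) \<and> \<phi> i 0 = 0 \<and> \<phi> i L = L \<and>
      (\<forall>x\<in>{0..L}. \<phi> i x \<in> {0..L} \<and>
      (\<phi> i has_real_derivative len (t i) / L * inverse (speed (\<phi> i x) (t i))) (at x within {0..L}))" ..
  then have \<phi>: "reparametrization L (\<phi> i)" "\<phi> i 0 = 0" "\<phi> i L = L"
      "x \<in> {0..L} \<Longrightarrow> \<phi> i x \<in> {0..L}"
      "x \<in> {0..L} \<Longrightarrow> (\<phi> i has_real_derivative len (t i) / L * inverse (speed (\<phi> i x) (t i))) (at x within {0..L})"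
    for i x by auto
  note rp = t0 assms(2) \<phi>(4,5)
  \<comment> \<open>The n-th parameter derivative of the i-th curve at constant speed.\<close>
  define G where "G i n x = (len (t i) / L) ^ n *\<^sub>R (Ds ^^ n) \<gamma> (\<phi> i x) (t i)" for i n x
  have G0: "G i 0 = (\<lambda>x. \<gamma> (\<phi> i x) (t i))" for i by (rule ext) (simp add: G_def)
  have dG: "(G i n has_vector_derivative G i (Suc n) x) (at x within {0..L})" if "x \<in> {0..L}" for i n x
    unfolding G_def by (rule reparam_derivs[OF rp that])
  let ?M = "En 1 / lam\<^sup>2"
  have len: "R \<le> len (t i)" "len (t i) \<le> ?M" for i
    using len_ge[OF t0 assms(2)] len_le[OF assms(1) t1] by auto
  have bG: "\<exists>B. \<forall>i. \<forall>x\<in>{0..L}. norm (G i n x) \<le> B" for n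
  proof -
    obtain B where B: "\<forall>t\<ge>1. \<forall>x\<in>{0..L}. norm ((Ds ^^ n) \<gamma> x t) \<le> B"
      using Ds_iter_\<gamma>_bound[OF assms(1)] by blast
    have "norm (G i n x) \<le> (?M / L) ^ n * B" if x: "x \<in> {0..L}" for i x
    proof -
      have pw: "\<bar>len (t i) / L\<bar> ^ n \<le> (?M / L) ^ n"
        using len[of i] L_pos assms(2) divide_right_mono[of "len (t i)" ?M L] by (intro power_mono) auto
      show ?thesis
        unfolding G_def norm_scaleR power_abs
        by (rule mult_mono[OF pw B[rule_format, OF t1 \<phi>(4)[OF x]]
            order_trans[OF zero_le_power[OF abs_ge_zero] pw] norm_ge_zero])
    qed
    then show ?thesis by blast
  qed
  have "\<exists>k g. strict_mono (k :: nat \<Rightarrow> nat) \<and>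
      (\<forall>n. uniform_limit {0..L} (\<lambda>i. G (k i) n) (g n) sequentially) \<and>
      (\<forall>n. \<forall>x\<in>{0..L}. (g n has_vector_derivative g (Suc n) x) (at x within {0..L}))"
    by (rule smooth_compactness[where G=G, OF dG bG])
  then obtain k g where kg: "strict_mono (k :: nat \<Rightarrow> nat) \<and>
      (\<forall>n. uniform_limit {0..L} (\<lambda>i. G (k i) n) (g n) sequentially) \<and>
      (\<forall>n. \<forall>x\<in>{0..L}. (g n has_vector_derivative g (Suc n) x) (at x within {0..L}))"
    by (elim exE)
  then have k: "strict_mono k"
    and g: "\<And>n. uniform_limit {0..L} (\<lambda>i. G (k i) n) (g n) sequentially"
    and dg: "\<And>n x. x \<in> {0..L} \<Longrightarrow> (g n has_vector_derivative g (Suc n) x) (at x within {0..L})"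
    by blast+
  have lim: "(\<lambda>i. G (k i) n x) \<longlonglongrightarrow> g n x" if "x \<in> {0..L}" for n x
    using tendsto_uniform_limitI[OF g that] .
  define \<alpha> where "\<alpha> i = len (t i) / L" for i
  have \<alpha>: "\<alpha> i > 0" "\<alpha> i \<ge> R / L" for i
    using len[of i] L_pos assms(2) by (auto simp: \<alpha>_def divide_right_mono)
  have speedG: "norm (G i 1 x) = \<alpha> i" if "x \<in> {0..L}" for i x
    using reparam_speed[OF rp that, of i] dx_eqI[OF L_pos that dG[OF that, of i 0]] by (simp add: G0 \<alpha>_def)
  \<comment> \<open>The approximating speeds do not depend on x, hence neither does their limit;
    being at least R / L it is positive, which makes the limit curve regular.\<close>
  define \<beta> where "\<beta> = norm (g 1 0)"
  have lim\<alpha>: "(\<lambda>i. \<alpha> (k i)) \<longlonglongrightarrow> norm (g 1 x)" if "x \<in> {0..L}" for x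
    using tendsto_norm[OF lim[OF that, of 1]] speedG[OF that] by simp
  have speedg: "norm (g 1 x) = \<beta>" if "x \<in> {0..L}" for x
    using LIMSEQ_unique[OF lim\<alpha>[OF that] lim\<alpha>[of 0]] L_pos by (simp add: \<beta>_def)
  have lim\<beta>: "(\<lambda>i. \<alpha> (k i)) \<longlonglongrightarrow> \<beta>" using lim\<alpha>[of 0] L_pos by (simp add: \<beta>_def)
  have \<beta>: "\<beta> > 0"
    using LIMSEQ_le_const[OF lim\<beta>, of "R / L"] \<alpha>(2) L_pos assms(2) by (auto intro: less_le_trans[of 0 "R / L"])
  have V0: "(\<lambda>i. V (\<phi> (k i) x) (t (k i))) \<longlonglongrightarrow> 0" if x: "x \<in> {0..L}" for x
  proof -
    obtain B where B: "\<forall>t\<ge>1. \<forall>x\<in>{0..L}. \<bar>Ds V x t\<bar> \<le> B" using dpoly_bound[OF dpoly_Ds[OF dpoly_V]] by blast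
    have B0: "B \<ge> 0" using B[rule_format, OF order_refl x] by linarith
    have "(\<lambda>i. sqrt (2 * B * (sqrt (inverse (real (Suc i))) * sqrt ?M))) \<longlonglongrightarrow> sqrt (2 * B * (sqrt 0 * sqrt ?M))"
      by (intro tendsto_intros LIMSEQ_inverse_real_of_nat)
    then have lim_bound: "(\<lambda>i. sqrt (2 * B * (sqrt (inverse (real (Suc i))) * sqrt ?M))) \<longlonglongrightarrow> 0"
      by simp
    have le: "\<bar>V (\<phi> i x) (t i)\<bar> \<le> sqrt (2 * B * (sqrt (inverse (real (Suc i))) * sqrt ?M))" for i
    proof (rule real_le_rsqrt)
      have "(V (\<phi> i x) (t i))\<^sup>2 \<le> 2 * B * (sqrt (intg (\<lambda>x t. (V x t)\<^sup>2) (t i)) * sqrt (len (t i)))"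
        by (rule V_square_le[OF t0 \<phi>(4)[OF x]]) (use B t1 in auto)
      also have "\<dots> \<le> 2 * B * (sqrt (inverse (real (Suc i))) * sqrt ?M)"
        using t(2)[of i] len[of i] B0 assms(2)
        by (intro mult_left_mono mult_mono real_sqrt_le_mono) auto
      finally show "\<bar>V (\<phi> i x) (t i)\<bar>\<^sup>2 \<le> 2 * B * (sqrt (inverse (real (Suc i))) * sqrt ?M)" by simp
    qed
    have "(\<lambda>i. V (\<phi> i x) (t i)) \<longlonglongrightarrow> 0"
      using le by (intro Lim_null_comparison[OF always_eventually lim_bound]) simp
    from LIMSEQ_subseq_LIMSEQ[OF this k] show ?thesis by (simp add: o_def)
  qed
  \<comment> \<open>At constant speed the normal speed is a fixed continuous expression in the speed
    and the derivatives up to order four, so it converges to that of the limit curve, while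
    \<open>V0\<close> says that it tends to zero.\<close>
  have elastic: "elastic_speed lam L (g 0) x = 0" if x: "x \<in> {0..L}" for x
  proof -
    have "(\<lambda>i. const_speed_elastic lam (\<alpha> (k i)) (\<lambda>n. G (k i) n x)) \<longlonglongrightarrow> const_speed_elastic lam \<beta> (\<lambda>n. g n x)"
      using \<beta> by (intro tendsto_const_speed_elastic lim x lim\<beta>) auto
    moreover have "const_speed_elastic lam (\<alpha> i) (\<lambda>n. G i n x) = V (\<phi> i x) (t i)" for i
      using const_speed_curve(2)[where G="G i" and lam=lam, OF L_pos \<alpha>(1) dG speedG x] reparam_elastic_speed[OF rp x, of i] by (simp add: G0)
    ultimately have "const_speed_elastic lam \<beta> (\<lambda>n. g n x) = 0"
      using LIMSEQ_unique[OF _ V0[OF x]] by simp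
    then show ?thesis using const_speed_curve(2)[where G=g and lam=lam, OF L_pos \<beta> dg speedg x] by simp
  qed
  have curv: "curvature L (g 0) x = 0" if x: "x \<in> {0, L}" for x
  proof -
    have xI: "x \<in> {0..L}" using x L_pos by auto
    have "(\<lambda>i. const_speed_curvature (\<alpha> (k i)) (\<lambda>n. G (k i) n x)) \<longlonglongrightarrow> const_speed_curvature \<beta> (\<lambda>n. g n x)"
      using \<beta> by (intro tendsto_const_speed_curvature lim xI lim\<beta>) auto
    moreover have "const_speed_curvature (\<alpha> i) (\<lambda>n. G i n x) = 0" for i
    proof -
      have "const_speed_curvature (\<alpha> i) (\<lambda>n. G i n x) = \<kappa> 0 (\<phi> i x) (t i)"
        using const_speed_curve(1)[where G="G i", OF L_pos \<alpha>(1) dG speedG xI] reparam_curvature[OF rp xI, of i] by (simp add: G0)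
      then show ?thesis using \<kappa>_0_boundary[OF t0[of i]] \<phi>(2)[of i] \<phi>(3)[of i] x by auto
    qed
    ultimately have "const_speed_curvature \<beta> (\<lambda>n. g n x) = 0" by (simp add: LIMSEQ_const_iff)
    then show ?thesis using const_speed_curve(1)[where G=g, OF L_pos \<beta> dg speedg xI] by simp
  qed
  \<comment> \<open>The reparametrizations keep 0 and L fixed, so the end points of all curves
    agree.\<close>
  have ends: "g 0 0 = vector [0, 0]" "g 0 L = vector [R, 0]"
    using lim[of 0 0] lim[of L 0] L_pos \<phi>(2,3) boundary[OF t0]
    by (auto simp: G_def boundary_conditions_def LIMSEQ_const_iff)
  have "stationary_solution lam L R (g 0)"
    unfolding stationary_solution_def
  proof (intro conjI ballI)
    show "smooth_on {0..L} (g 0)" by (rule smooth_on_derivs[where G=g, OF dg])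
    show "regular_curve L (g 0)"
      unfolding regular_curve_def
    proof
      fix x assume x: "x \<in> {0..L}"
      show "dx L (g 0) x \<noteq> 0" using dx_eqI[OF L_pos x dg[OF x]] speedg[OF x] \<beta> by auto
    qed
    show "2 * ds L (g 0) (ds L (g 0) (curvature L (g 0))) x + (curvature L (g 0) x)^3
        - lam\<^sup>2 * curvature L (g 0) x = 0" if "x \<in> {0..L}" for x
      using elastic[OF that] by (simp add: elastic_speed_def)
    show "boundary_conditions L R (g 0)" using ends curv by (simp add: boundary_conditions_def)
  qed
  moreover have "smoothly_converges L (\<lambda>i x. \<gamma> (\<phi> (k i) x) (t (k i))) (g 0)"
    unfolding smoothly_converges_def
  proof
    fix n
    have "(dx L ^^ n) (\<lambda>x. \<gamma> (\<phi> (k i) x) (t (k i))) x = G (k i) n x" if "x \<in> {0..L}" for i x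
      by (rule dx_iter_eqI[where G="G (k i)", OF L_pos dG _ that]) (simp_all add: G0)
    moreover have "(dx L ^^ n) (g 0) x = g n x" if "x \<in> {0..L}" for x
      by (rule dx_iter_eqI[where G=g, OF L_pos dg _ that]) simp_all
    ultimately show "uniform_limit {0..L} (\<lambda>i. (dx L ^^ n) (\<lambda>x. \<gamma> (\<phi> (k i) x) (t (k i)))) ((dx L ^^ n) (g 0)) sequentially"
      using g[of n] by (subst uniform_limit_cong'[where g="\<lambda>i. G (k i) n" and i="g n"]) auto
  qed
  moreover have "filterlim (\<lambda>i. t (k i)) at_top sequentially"
  proof (rule filterlim_at_top_mono[OF filterlim_real_sequentially])
    have "real i \<le> t (k i)" for i using t(1)[of "k i"] seq_suble[OF k, of i] by linarith
    then show "\<forall>\<^sub>F i in sequentially. real i \<le> t (k i)" by simp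
  qed
  moreover have "t (k i) \<ge> 0" for i using t0[of "k i"] by simp
  ultimately show ?thesis using \<phi>(1)
    by (intro exI[where x="\<lambda>i. t (k i)"] exI[where x="\<lambda>i. \<phi> (k i)"] exI[where x="g 0"]) auto
qed

end

theorem theorem2p4:
  fixes lam L R :: real
    and \<Gamma>0 :: "real \<Rightarrow> real^2"
    and \<gamma> :: "real \<Rightarrow> real \<Rightarrow> real^2"
  assumes "lam \<noteq> 0" "L > 0" "R > 0"
    and "smooth_on {0..L} \<Gamma>0"
    and "\<forall>x\<in>{0..L}. norm (dx L \<Gamma>0 x) = 1"
    and "\<Gamma>0 0 = vector [0, 0]" "\<Gamma>0 L = vector [R, 0]"
    and "curvature L \<Gamma>0 0 = 0" "curvature L \<Gamma>0 L = 0"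
    and "elastic_flow_solution lam L R \<Gamma>0 \<gamma>"
  shows "\<exists>(t :: nat \<Rightarrow> real) (\<phi> :: nat \<Rightarrow> real \<Rightarrow> real) (\<gamma>_hat :: real \<Rightarrow> real^2).
           (\<forall>i. t i \<ge> 0) \<and> filterlim t at_top sequentially \<and>
           (\<forall>i. reparametrization L (\<phi> i)) \<and>
           smoothly_converges L (\<lambda>i x. \<gamma> (\<phi> i x) (t i)) \<gamma>_hat \<and>
           stationary_solution lam L R \<gamma>_hat"
proof -
  interpret elastic_flow lam L R \<gamma>
    using assms(2,10) by unfold_locales (auto simp: elastic_flow_solution_def smooth_xt_def)
  show ?thesis by (rule subconvergence[OF assms(1,3)])
qed

end
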